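(* Let $p\in(1,\infty)$ and let $\varphi=(\varphi_1,0,0,0)$ be a function in $L^p(\partial D'_\beta)$. Then $$\lim_{N\to\infty}\|S\varphi-S_N\varphi\|_{H^p(D'_\beta)}=0.$$
   Context: Fix $\beta>\frac{\pi}{2}$, and let $\mathbb T=\mathbb R/\mathbb Z$. Let $$D'_\beta=\{(z_1,z_2)\in\mathbb C^2: |\operatorname{Im}z_1-\log|z_2|^2|<\tfrac{\pi}{2},\ |\log|z_2|^2|<\beta-\tfrac{\pi}{2}\}.$$ Put $(\eta_1,\eta_2,\eta_3,\eta_4)=(\beta,\beta-\pi,-\beta,-(\beta-\pi))$ and $(\sigma_1,\sigma_2,\sigma_3,\sigma_4)=(1,1,-1,-1)$. The distinguished boundary is $\partial D'_\beta=\bigcup_{\ell=1}^4E_\ell$, $E_\ell=\{(x+i\eta_\ell,e^{\frac{\sigma_\ell}2(\beta-\frac\pi2)}e^{2\pi i\theta}):x\in\mathbb R,\theta\in\mathbb T\}$, each $E_\ell$ identified with $\mathbb R\times\mathbb T$. A function on $\partial D'_\beta$ is a vector $\varphi=(\varphi_1,\dots,\varphi_4)$ of functions on $\mathbb R\times\mathbb T$, with $\|\varphi\|^p_{L^p(\partial D'_\beta)}=\sum_\ell\|\varphi_\ell\|^p_{L^p(\mathbb R\times\mathbb T)}$. For $p\in(1,\infty)$, $H^p(D'_\beta)$ is the space of holomorphic $F$ on $D'_\beta$ such that $\|F\|^p_{H^p(D'_\beta)}=\sup_{(t,s)\in[0,\frac\pi2)\times[0,\beta-\frac\pi2)}\mathcal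 L_pF(t,s)<\infty$, where $\mathcal L_pF(t,s)$ is the sum of the four integrals $\int_{\mathbb R}\int_0^1|F(x\pm i(s+t),e^{\pm\frac s2}e^{2\pi i\theta})|^p\,d\theta\,dx$ and $\int_{\mathbb R}\int_0^1|F(x\pm i(s-t),e^{\pm\frac s2}e^{2\pi i\theta})|^p\,d\theta\,dx$ (same sign in both arguments). $\mathcal F_{\mathbb R}\psi(\xi,\hat j)$ denotes the Fourier transform in the first variable of the $j$-th Fourier coefficient (w.r.t. $e^{2\pi ij\gamma}$) in the second variable of $\psi(x,\gamma)$, and $\mathcal F^{-1}_{\mathbb R}$ the inverse Fourier transform in the first variable. For $\varphi=(\varphi_1,0,0,0)$ define $$S_N\varphi(x+iy,e^{\frac s2}e^{2\pi i\gamma})=\sum_{j=-N}^{N}e^{2\pi ij\gamma}\mathcal F^{-1}_{\mathbb R}\left[\frac{e^{-(\beta-\frac\pi2+s)(\cdot-\frac j2)}e^{-(\frac\pi2-s+y)(\cdot)}\mathcal F_{\mathbb R}\varphi_1(\cdot,\hat j)}{4\cosh[\pi\cdot]\cosh[(2\beta-\pi)(\cdot-\frac j2)]}\right](x).$$ $S\varphi$ is given by the same formula with the sum over all $j\in\mathbb Z$ when $\varphi_1$ is a finite sum $\sum_{|j|<N}\varphi_1(x,j)e^{2\pi ij\gamma}$ with $\varphi_1(\cdot,j)\in C_0^\infty(\mathbb R)$; $S$ is extended by density to a bounded linear operator $L^p(\partial D'_\beta)\to H^p(D'_\beta)$. *)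

theory Defs
  imports "HOL-Analysis.Analysis"
begin

section \<open>The domain and its Hardy space\<close>

text \<open>The condition \<open>z2 \<noteq> 0\<close> is implicit in the finiteness of \<open>log |z2|^2\<close>;
  it has to be stated because \<open>ln 0 = 0\<close> in HOL.\<close>

definition worm :: "real \<Rightarrow> (complex \<times> complex) set" where
  "worm \<beta> = {(z1, z2). z2 \<noteq> 0 \<and> \<bar>Im z1 - ln ((cmod z2)\<^sup>2)\<bar> < pi / 2
                        \<and> \<bar>ln ((cmod z2)\<^sup>2)\<bar> < \<beta> - pi / 2}"

definition holomorphic2_on :: "(complex \<times> complex \<Rightarrow> complex) \<Rightarrow> (complex \<times> complex) set \<Rightarrow> bool" where
  "holomorphic2_on F D \<longleftrightarrow>
     (\<forall>z\<in>D. \<exists>a b. (F has_derivative (\<lambda>(h, k). a * h + b * k)) (at z within D))"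

definition line_integral :: "real \<Rightarrow> (complex \<times> complex \<Rightarrow> complex) \<Rightarrow> real \<Rightarrow> real \<Rightarrow> ennreal" where
  "line_integral p F y s =
     (\<integral>\<^sup>+x. (\<integral>\<^sup>+\<theta>\<in>{0..1}.
        ennreal (cmod (F (Complex x y, of_real (exp (s / 2)) * exp (2 * of_real pi * \<i> * of_real \<theta>))) powr p)
        \<partial>lborel) \<partial>lborel)"

definition L_functional :: "real \<Rightarrow> (complex \<times> complex \<Rightarrow> complex) \<Rightarrow> real \<Rightarrow> real \<Rightarrow> ennreal" where
  "L_functional p F t s =
     line_integral p F (s + t) s + line_integral p F (- (s + t)) (- s) +
     line_integral p F (s - t) s + line_integral p F (- (s - t)) (- s)"

definition Hp_norm_pow :: "real \<Rightarrow> real \<Rightarrow> (complex \<times> complex \<Rightarrow> complex) \<Rightarrow> ennreal" where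
  "Hp_norm_pow \<beta> p F = (SUP (t, s)\<in>{0..<pi / 2} \<times> {0..<\<beta> - pi / 2}. L_functional p F t s)"

definition Hp_norm :: "real \<Rightarrow> real \<Rightarrow> (complex \<times> complex \<Rightarrow> complex) \<Rightarrow> ennreal" where
  "Hp_norm \<beta> p F =
     (if Hp_norm_pow \<beta> p F = \<infinity> then \<infinity> else ennreal (enn2real (Hp_norm_pow \<beta> p F) powr (1 / p)))"

definition Hp_space :: "real \<Rightarrow> real \<Rightarrow> (complex \<times> complex \<Rightarrow> complex) set" where
  "Hp_space \<beta> p = {F. holomorphic2_on F (worm \<beta>) \<and> Hp_norm_pow \<beta> p F < \<infinity>}"


section \<open>Functions on the distinguished boundary\<close>

text \<open>\<open>\<real>/\<int>\<close> is represented by its fundamental domain \<open>[0,1)\<close>.  Each of the four components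
  \<open>E\<^sub>l\<close> of the boundary is identified with \<open>\<real> \<times> \<real>/\<int>\<close> through \<open>(x, \<theta>)\<close>, so that a function on the
  boundary is a vector of four functions of \<open>(x, \<theta>)\<close>.  Elements of the Lebesgue space are
  represented by Borel functions; the values at \<open>\<theta> \<notin> [0,1)\<close> are irrelevant.\<close>

type_synonym boundary_fun = "4 \<Rightarrow> real \<times> real \<Rightarrow> complex"

definition cylinder :: "(real \<times> real) measure" where
  "cylinder = restrict_space lborel (UNIV \<times> {0..<1})"

definition Lp_boundary :: "real \<Rightarrow> boundary_fun set" where
  "Lp_boundary p = {\<phi>. \<forall>l. \<phi> l \<in> borel_measurable cylinder \<and>
                             integrable cylinder (\<lambda>w. cmod (\<phi> l w) powr p)}"

definition Lp_norm :: "real \<Rightarrow> boundary_fun \<Rightarrow> real" where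
  "Lp_norm p \<phi> = (\<Sum>l\<in>UNIV. LINT w|cylinder. cmod (\<phi> l w) powr p) powr (1 / p)"

text \<open>The boundary function \<open>(\<phi>1, 0, 0, 0)\<close>.\<close>

definition on_E1 :: "(real \<times> real \<Rightarrow> complex) \<Rightarrow> boundary_fun" where
  "on_E1 \<phi>1 = (\<lambda>l. if l = 1 then \<phi>1 else (\<lambda>_. 0))"


section \<open>Fourier transforms\<close>

text \<open>The normalisation \<open>exp (- \<i> x \<xi>)\<close> is the one for which the functions \<open>S_sum\<close> below are
  holomorphic: the integrand of the \<open>j\<close>-th term then depends on the point only through
  \<open>z2^j exp (\<i> z1 \<xi>)\<close>.\<close>

definition fourier :: "(real \<Rightarrow> complex) \<Rightarrow> real \<Rightarrow> complex" where
  "fourier f \<xi> = (LINT x|lborel. exp (- \<i> * of_real (x * \<xi>)) * f x)"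

definition inv_fourier :: "(real \<Rightarrow> complex) \<Rightarrow> real \<Rightarrow> complex" where
  "inv_fourier f x = (LINT \<xi>|lborel. exp (\<i> * of_real (x * \<xi>)) * f \<xi>) / (2 * of_real pi)"

definition fourier_coeff :: "(real \<times> real \<Rightarrow> complex) \<Rightarrow> int \<Rightarrow> real \<Rightarrow> complex" where
  "fourier_coeff \<psi> j x =
     (LINT \<gamma>:{0..<1}|lborel. exp (- 2 * of_real pi * \<i> * of_int j * of_real \<gamma>) * \<psi> (x, \<gamma>))"

definition schwartz :: "(real \<Rightarrow> complex) \<Rightarrow> bool" where
  "schwartz f \<longleftrightarrow> (\<exists>D :: nat \<Rightarrow> real \<Rightarrow> complex. D 0 = f \<and>
     (\<forall>n x. (D n has_vector_derivative D (Suc n) x) (at x)) \<and>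
     (\<forall>n k. bounded (range (\<lambda>x. of_real (x ^ k) * D n x))))"

definition Cc_infinity :: "(real \<Rightarrow> complex) \<Rightarrow> bool" where
  "Cc_infinity f \<longleftrightarrow> (\<exists>D :: nat \<Rightarrow> real \<Rightarrow> complex. D 0 = f \<and>
     (\<forall>n x. (D n has_vector_derivative D (Suc n) x) (at x))) \<and>
     (\<exists>R. \<forall>x. \<bar>x\<bar> > R \<longrightarrow> f x = 0)"

text \<open>For \<open>f\<close> in \<open>L^p\<close>, \<open>p > 2\<close>, the Fourier transform of \<open>f\<close> is in general only a tempered
  distribution, so the operators are taken in the sense of distributions, viewed as
  functionals on Schwartz functions.\<close>

type_synonym distribution = "(real \<Rightarrow> complex) \<Rightarrow> complex"

definition distr_of :: "(real \<Rightarrow> complex) \<Rightarrow> distribution" where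
  "distr_of f = (\<lambda>g. LINT x|lborel. f x * g x)"

definition fourier_distr :: "distribution \<Rightarrow> distribution" where
  "fourier_distr T = (\<lambda>g. T (fourier g))"

definition inv_fourier_distr :: "distribution \<Rightarrow> distribution" where
  "inv_fourier_distr T = (\<lambda>g. T (inv_fourier g))"

definition mult_distr :: "(real \<Rightarrow> complex) \<Rightarrow> distribution \<Rightarrow> distribution" where
  "mult_distr m T = (\<lambda>g. T (\<lambda>\<xi>. m \<xi> * g \<xi>))"

text \<open>The continuous function representing a distribution.  It is unique if it exists.  It
  exists wherever it is used below: the multiplier there is a Schwartz function, so
  the distribution is the convolution of an \<open>L^p\<close> function with a Schwartz function.\<close>

definition fun_of_distr :: "distribution \<Rightarrow> real \<Rightarrow> complex" where
  "fun_of_distr T = (THE u. continuous_on UNIV u \<and>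
     (\<forall>g. schwartz g \<longrightarrow> integrable lborel (\<lambda>x. u x * g x) \<and> distr_of u g = T g))"


section \<open>The operators\<close>

definition S_multiplier :: "real \<Rightarrow> int \<Rightarrow> real \<Rightarrow> real \<Rightarrow> real \<Rightarrow> real" where
  "S_multiplier \<beta> j y s \<xi> =
     exp (- (\<beta> - pi / 2 + s) * (\<xi> - of_int j / 2)) * exp (- (pi / 2 - s + y) * \<xi>) /
     (4 * cosh (pi * \<xi>) * cosh ((2 * \<beta> - pi) * (\<xi> - of_int j / 2)))"

text \<open>A point is written as \<open>(x + \<i> y, exp (s / 2) * exp (2 * pi * \<i> * \<gamma>))\<close>; the choice of
  \<open>\<gamma>\<close> modulo 1 does not matter.\<close>

definition S_term :: "real \<Rightarrow> (real \<times> real \<Rightarrow> complex) \<Rightarrow> int \<Rightarrow> complex \<times> complex \<Rightarrow> complex" where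
  "S_term \<beta> \<phi>1 j = (\<lambda>(z1, z2).
     let x = Re z1; y = Im z1; s = ln ((cmod z2)\<^sup>2); \<gamma> = Arg z2 / (2 * pi) in
     exp (2 * of_real pi * \<i> * of_int j * of_real \<gamma>) *
     fun_of_distr (inv_fourier_distr
       (mult_distr (\<lambda>\<xi>. of_real (S_multiplier \<beta> j y s \<xi>))
         (fourier_distr (distr_of (fourier_coeff \<phi>1 j))))) x)"

definition S_partial :: "real \<Rightarrow> nat \<Rightarrow> (real \<times> real \<Rightarrow> complex) \<Rightarrow> complex \<times> complex \<Rightarrow> complex" where
  "S_partial \<beta> N \<phi>1 z = (\<Sum>j = - int N..int N. S_term \<beta> \<phi>1 j z)"

definition S_sum :: "real \<Rightarrow> (real \<times> real \<Rightarrow> complex) \<Rightarrow> complex \<times> complex \<Rightarrow> complex" where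
  "S_sum \<beta> \<phi>1 z = (\<Sum>\<^sub>\<infinity>j\<in>UNIV. S_term \<beta> \<phi>1 j z)"

definition test_fun :: "(real \<times> real \<Rightarrow> complex) \<Rightarrow> bool" where
  "test_fun \<phi>1 \<longleftrightarrow> (\<exists>(N::nat) c. (\<forall>j::int. Cc_infinity (c j)) \<and>
     (\<forall>x \<gamma>. \<phi>1 (x, \<gamma>) =
        (\<Sum>j | \<bar>j\<bar> < int N. c j x * exp (2 * of_real pi * \<i> * of_int j * of_real \<gamma>))))"

text \<open>\<open>S\<close> is a bounded linear operator from \<open>L^p\<close> of the distinguished boundary to the Hardy
  space which is given by \<open>S_sum\<close> on the dense class of test functions.  By density these
  properties determine \<open>S\<close> on all boundary functions of the form \<open>(\<phi>1, 0, 0, 0)\<close>.\<close>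

definition bounded_extension :: "real \<Rightarrow> real \<Rightarrow> (boundary_fun \<Rightarrow> complex \<times> complex \<Rightarrow> complex) \<Rightarrow> bool" where
  "bounded_extension \<beta> p S \<longleftrightarrow>
     (\<forall>\<phi>\<in>Lp_boundary p. S \<phi> \<in> Hp_space \<beta> p) \<and>
     (\<forall>\<phi>\<in>Lp_boundary p. \<forall>\<psi>\<in>Lp_boundary p. \<forall>z\<in>worm \<beta>.
        S (\<lambda>l w. \<phi> l w + \<psi> l w) z = S \<phi> z + S \<psi> z) \<and>
     (\<forall>\<phi>\<in>Lp_boundary p. \<forall>c. \<forall>z\<in>worm \<beta>. S (\<lambda>l w. c * \<phi> l w) z = c * S \<phi> z) \<and>
     (\<exists>C\<ge>0. \<forall>\<phi>\<in>Lp_boundary p. Hp_norm \<beta> p (S \<phi>) \<le> ennreal (C * Lp_norm p \<phi>)) \<and>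
     (\<forall>\<phi>1. test_fun \<phi>1 \<longrightarrow> (\<forall>z\<in>worm \<beta>. S (on_E1 \<phi>1) z = S_sum \<beta> \<phi>1 z))"

end

theory Submission
  imports Defs "HOL-Probability.Probability"
begin

text \<open>Let \<open>P\<^sub>N\<close> be the truncation to the Fourier modes \<open>\<bar>j\<bar> \<le> N\<close> in the angular variable.  The operator \<open>S\<close>
  acts on each mode by a multiplier, so \<open>S\<^sub>N \<phi> = S (P\<^sub>N \<phi>)\<close>, and boundedness of \<open>S\<close> reduces the claim to
  \<open>P\<^sub>N \<phi> \<longlonglongrightarrow> \<phi>\<close> in \<open>L\<^sup>p\<close>.  Test functions are dense (\<open>test_functions_dense\<close>) and are fixed by \<open>P\<^sub>N\<close> for
  large \<open>N\<close>, so what is needed is a bound of \<open>P\<^sub>N\<close> on \<open>L\<^sup>p\<close> that is uniform in \<open>N\<close>, that is, M. Riesz's theorem.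

  This bound is extracted from the boundedness of \<open>S\<close> itself (\<open>half_line_truncation_bounded\<close>).  When
  the torus approaches the component \<open>E\<^sub>1\<close> of the distinguished boundary, the multiplier of the \<open>j\<close>-th mode tends to the product
  of two smooth steps, \<open>1 / (1 + exp (2 \<pi> \<xi>))\<close> and \<open>1 / (1 + exp (2 (2 \<beta> - \<pi>) (\<xi> - j / 2)))\<close>.  The first is
  close to 1 for very negative \<open>\<xi>\<close>; the second distinguishes large \<open>j\<close> from small \<open>j\<close>, with a transition
  of bounded width.  Given a test function, modulate it in \<open>x\<close> by the frequency \<open>- K\<close> and replace its modes \<open>j\<close>
  by modes with gaps \<open>2 K\<close>.  As \<open>K\<close> grows, all of its modes leave the transition region, and in the limit
  \<open>S\<close> becomes the sharp cutoff \<open>j \<ge> m\<close>.  Neither the modulation nor the dilation of the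
  frequencies changes the \<open>L\<^sup>p\<close> norm, so Fatou's lemma bounds the cutoff by the norm of \<open>S\<close>.  An
  interval of modes is the difference of two half-lines.

  The identity \<open>S\<^sub>N \<phi> = S (P\<^sub>N \<phi>)\<close> holds for test functions by the definition of \<open>S\<close>.  For general \<open>\<phi>\<close>, where
  the terms of \<open>S\<^sub>N\<close> are given by distributions, each term is shown to be the convolution of a Fourier
  coefficient with a kernel that decays like \<open>1 / (1 + x\<^sup>2)\<close> (\<open>multiplier_distribution_eq_convolution\<close>,
  \<open>S_kernel_decay\<close>).  It therefore depends continuously on \<open>\<phi>\<close> at every point, and the identity passes
  to the limit (\<open>S_partial_eq\<close>).\<close>

section \<open>Smooth functions of compact support\<close>

definition infinitely_differentiable :: "(real \<Rightarrow> complex) \<Rightarrow> bool" where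
  "infinitely_differentiable f \<longleftrightarrow> (\<exists>D :: nat \<Rightarrow> real \<Rightarrow> complex. D 0 = f \<and>
     (\<forall>n x. (D n has_vector_derivative D (Suc n) x) (at x)))"

text \<open>Smoothness is coinductive.  This is how closure under products is obtained below without
  writing down the Leibniz rule for higher derivatives.\<close>

lemma infinitely_differentiable_coinduct:
  assumes "f \<in> A" and step: "\<And>g. g \<in> A \<Longrightarrow> \<exists>g'\<in>A. \<forall>x. (g has_vector_derivative g' x) (at x)"
  shows "infinitely_differentiable f"
proof -
  obtain d where d: "\<And>g. g \<in> A \<Longrightarrow> d g \<in> A \<and> (\<forall>x. (g has_vector_derivative d g x) (at x))"
    using bchoice[of A "\<lambda>g g'. g' \<in> A \<and> (\<forall>x. (g has_vector_derivative g' x) (at x))"] step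
    by blast
  have "(d ^^ n) f \<in> A" for n
    by (induction n) (use d assms(1) in auto)
  then show ?thesis
    unfolding infinitely_differentiable_def using d
    by (intro exI[of _ "\<lambda>n. (d ^^ n) f"]) auto
qed

lemma infinitely_differentiable_step:
  assumes "infinitely_differentiable f"
  obtains f' where "infinitely_differentiable f'" "\<And>x. (f has_vector_derivative f' x) (at x)"
proof -
  obtain D where D: "D 0 = f" "\<And>n x. (D n has_vector_derivative D (Suc n) x) (at x)"
    using assms unfolding infinitely_differentiable_def by blast
  have "infinitely_differentiable (D 1)"
    unfolding infinitely_differentiable_def using D
    by (intro exI[of _ "\<lambda>n. D (Suc n)"]) auto
  with D that[of "D 1"] show ?thesis by (metis One_nat_def)
qed

inductive_set smooth_algebra :: "(real \<Rightarrow> complex) set" where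
  base: "infinitely_differentiable f \<Longrightarrow> f \<in> smooth_algebra"
| add: "f \<in> smooth_algebra \<Longrightarrow> g \<in> smooth_algebra \<Longrightarrow> (\<lambda>x. f x + g x) \<in> smooth_algebra"
| mult: "f \<in> smooth_algebra \<Longrightarrow> g \<in> smooth_algebra \<Longrightarrow> (\<lambda>x. f x * g x) \<in> smooth_algebra"

lemma smooth_algebra_smooth:
  assumes "f \<in> smooth_algebra" shows "infinitely_differentiable f"
  using assms
proof (rule infinitely_differentiable_coinduct)
  fix g assume "g \<in> smooth_algebra"
  then show "\<exists>g'\<in>smooth_algebra. \<forall>x. (g has_vector_derivative g' x) (at x)"
  proof induction
    case (base f)
    then show ?case by (meson infinitely_differentiable_step smooth_algebra.base)
  next
    case (add f g)
    then obtain f' g' where "f' \<in> smooth_algebra" "g' \<in> smooth_algebra"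
      "\<And>x. (f has_vector_derivative f' x) (at x)" "\<And>x. (g has_vector_derivative g' x) (at x)"
      by blast
    then show ?case
      by (intro bexI[of _ "\<lambda>x. f' x + g' x"]) (auto intro: has_vector_derivative_add smooth_algebra.add)
  next
    case (mult f g)
    then obtain f' g' where *: "f' \<in> smooth_algebra" "g' \<in> smooth_algebra"
      "\<And>x. (f has_vector_derivative f' x) (at x)" "\<And>x. (g has_vector_derivative g' x) (at x)"
      by blast
    have "(\<lambda>x. f x * g' x + f' x * g x) \<in> smooth_algebra"
      using * mult.hyps by (intro smooth_algebra.add smooth_algebra.mult)
    then show ?case
      using * by (intro bexI[of _ "\<lambda>x. f x * g' x + f' x * g x"]) (auto intro: has_vector_derivative_mult)
  qed
qed

lemma infinitely_differentiable_add:
  "infinitely_differentiable f \<Longrightarrow> infinitely_differentiable g \<Longrightarrow> infinitely_differentiable (\<lambda>x. f x + g x)"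
  by (rule smooth_algebra_smooth[OF smooth_algebra.add[OF smooth_algebra.base smooth_algebra.base]])

lemma infinitely_differentiable_mult:
  "infinitely_differentiable f \<Longrightarrow> infinitely_differentiable g \<Longrightarrow> infinitely_differentiable (\<lambda>x. f x * g x)"
  by (rule smooth_algebra_smooth[OF smooth_algebra.mult[OF smooth_algebra.base smooth_algebra.base]])

lemma infinitely_differentiable_exp: "infinitely_differentiable (\<lambda>x. a * exp (b * of_real x))"
proof (rule infinitely_differentiable_coinduct[where A="range (\<lambda>a x. a * exp (b * of_real x))"])
  show "(\<lambda>x. a * exp (b * of_real x)) \<in> range (\<lambda>a x. a * exp (b * of_real x))"
    by (rule image_eqI[of _ _ a]) auto
  fix g :: "real \<Rightarrow> complex" assume "g \<in> range (\<lambda>a x. a * exp (b * of_real x))"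
  then obtain a where g: "g = (\<lambda>x. a * exp (b * of_real x))" by auto
  have "((\<lambda>x. a * exp (b * of_real x)) has_vector_derivative (a * b) * exp (b * of_real x)) (at x)" for x
    by (auto intro!: derivative_eq_intros has_vector_derivative_real_field)
  then show "\<exists>g'\<in>range (\<lambda>a x. a * exp (b * of_real x)). \<forall>x. (g has_vector_derivative g' x) (at x)"
    unfolding g by (intro bexI[of _ "\<lambda>x. (a * b) * exp (b * of_real x)"] image_eqI[of _ _ "a * b"]) auto
qed

lemma infinitely_differentiable_const: "infinitely_differentiable (\<lambda>x. a)"
  using infinitely_differentiable_exp[of a 0] by simp

lemma infinitely_differentiable_affine:
  assumes "infinitely_differentiable f" shows "infinitely_differentiable (\<lambda>x. f (a * x + b))"
proof -
  obtain D where D: "D 0 = f" "\<And>n x. (D n has_vector_derivative D (Suc n) x) (at x)"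
    using assms unfolding infinitely_differentiable_def by blast
  have "((\<lambda>x. a ^ n *\<^sub>R D n (a * x + b)) has_vector_derivative a ^ Suc n *\<^sub>R D (Suc n) (a * x + b)) (at x)" for n x
  proof -
    have "((\<lambda>x. a * x + b) has_vector_derivative a) (at x)"
      by (auto intro!: derivative_eq_intros)
    from vector_diff_chain_at[OF this D(2)[of n "a * x + b"]]
    have "((\<lambda>x. D n (a * x + b)) has_vector_derivative a *\<^sub>R D (Suc n) (a * x + b)) (at x)"
      by (simp add: o_def)
    then show ?thesis
      by (auto intro!: derivative_eq_intros simp: mult.commute)
  qed
  then show ?thesis
    unfolding infinitely_differentiable_def using D(1)
    by (intro exI[of _ "\<lambda>n x. a ^ n *\<^sub>R D n (a * x + b)"]) auto
qed

definition flat :: "real \<Rightarrow> real" where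
  "flat y = (if 0 < y then exp (- 1 / y) else 0)"

text \<open>All derivatives of \<open>flat\<close> have the form \<open>q (1 / y) exp (- 1 / y)\<close> with a polynomial \<open>q\<close>, and
  the exponential beats every polynomial at the origin.\<close>

lemma poly_exp_neg_tendsto_0: "((\<lambda>u. poly q u * exp (- u)) \<longlongrightarrow> (0::real)) at_top"
proof (induction q)
  case 0 then show ?case by simp
next
  case (pCons a q)
  have "((\<lambda>u. u ^ k / exp u) \<longlongrightarrow> (0::real)) at_top" for k by (rule tendsto_power_div_exp_0)
  have "((\<lambda>u. (\<Sum>i\<le>degree (pCons a q). coeff (pCons a q) i * (u ^ i / exp u))) \<longlongrightarrow>
          (\<Sum>i\<le>degree (pCons a q). coeff (pCons a q) i * 0)) at_top"
    by (intro tendsto_intros tendsto_power_div_exp_0)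
  then show ?case
    by (simp add: poly_altdef sum_distrib_right exp_minus field_simps sum_divide_distrib del: degree_pCons_eq_if coeff_pCons)
qed

lemma flat_poly_has_derivative:
  fixes q :: "real poly"
  defines "g \<equiv> \<lambda>q y. if 0 < y then poly q (1 / y) * exp (- 1 / y) else (0::real)"
  shows "(g q has_field_derivative g (monom 1 2 * (q - pderiv q)) y) (at y)"
proof -
  consider "y > 0" | "y < 0" | "y = 0" by linarith
  then show ?thesis
  proof cases
    case 1
    have "((\<lambda>y. poly q (1 / y) * exp (- 1 / y)) has_field_derivative
        poly (monom 1 2 * (q - pderiv q)) (1 / y) * exp (- 1 / y)) (at y)"
      using 1 by (auto intro!: derivative_eq_intros DERIV_chain2[OF poly_DERIV]
          simp: poly_monom field_simps power2_eq_square)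
    then have "(g q has_field_derivative poly (monom 1 2 * (q - pderiv q)) (1 / y) * exp (- 1 / y)) (at y)"
      by (rule has_field_derivative_transform_within_open[of _ _ _ "{0<..}"])
         (use 1 in \<open>auto simp: g_def\<close>)
    then show ?thesis using 1 by (simp add: g_def)
  next
    case 2
    have "((\<lambda>y. 0) has_field_derivative 0) (at y)" by simp
    then have "(g q has_field_derivative 0) (at y)"
      by (rule has_field_derivative_transform_within_open[of _ _ _ "{..<0}"])
         (use 2 in \<open>auto simp: g_def\<close>)
    then show ?thesis using 2 by (simp add: g_def)
  next
    case 3
    have l: "((\<lambda>h. g q h / h) \<longlongrightarrow> 0) (at_left 0)"
      by (rule tendsto_eventually)
         (auto simp: g_def eventually_at_filter)
    have "((\<lambda>u. poly (pCons 0 q) u * exp (- u)) \<longlongrightarrow> 0) at_top"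
      by (rule poly_exp_neg_tendsto_0)
    then have "((\<lambda>h. poly (pCons 0 q) (inverse h) * exp (- (inverse h))) \<longlongrightarrow> 0) (at_right 0)"
      by (rule filterlim_compose) (rule filterlim_inverse_at_top_right)
    then have r: "((\<lambda>h. g q h / h) \<longlongrightarrow> 0) (at_right 0)"
      by (rule Lim_transform_eventually)
         (auto simp: g_def eventually_at_right_field field_simps intro!: exI[of _ 1])
    have "((\<lambda>h. g q h / h) \<longlongrightarrow> 0) (at 0)"
      using l r filterlim_split_at_real by blast
    then show ?thesis
      unfolding 3 DERIV_def by (simp add: g_def)
  qed
qed

lemma flat_smooth: "infinitely_differentiable (\<lambda>x. of_real (flat x))"
proof -
  define g where "g = (\<lambda>q y. if 0 < y then poly q (1 / y) * exp (- 1 / y) else (0::real))"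
  show ?thesis
  proof (rule infinitely_differentiable_coinduct[where A="range (\<lambda>q x. complex_of_real (g q x))"])
    have "flat = g 1" by (auto simp: flat_def g_def)
    then show "(\<lambda>x. of_real (flat x)) \<in> range (\<lambda>q x. complex_of_real (g q x))"
      by (intro image_eqI[of _ _ 1]) auto
  next
    fix f assume "f \<in> range (\<lambda>q x. complex_of_real (g q x))"
    then obtain q where f: "f = (\<lambda>x. complex_of_real (g q x))" by auto
    have "(f has_vector_derivative of_real (g (monom 1 2 * (q - pderiv q)) x)) (at x)" for x
      using flat_poly_has_derivative[of q x] unfolding f g_def
      by (intro has_vector_derivative_of_real) (simp only: has_real_derivative_iff_has_vector_derivative)
    then show "\<exists>g'\<in>range (\<lambda>q x. complex_of_real (g q x)). \<forall>x. (f has_vector_derivative g' x) (at x)"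
      by (intro bexI[of _ "\<lambda>x. of_real (g (monom 1 2 * (q - pderiv q)) x)"] image_eqI[of _ _ "monom 1 2 * (q - pderiv q)"]) auto
  qed
qed

text \<open>For growing \<open>n\<close> these functions converge to the indicator of \<open>(a, b)\<close>; they serve both as test
  functions that are positive on an interval and as the start of the density argument.\<close>

definition bump :: "nat \<Rightarrow> real \<Rightarrow> real \<Rightarrow> real \<Rightarrow> real" where
  "bump n a b x = flat (real (Suc n) * (x - a)) * flat (real (Suc n) * (b - x))"

lemma flat_bounds: "0 \<le> flat y" "flat y \<le> 1"
  by (auto simp: flat_def)

lemma bump_bounds: "0 \<le> bump n a b x" "bump n a b x \<le> indicator {a<..<b} x"
proof -
  show "0 \<le> bump n a b x" by (simp add: bump_def flat_bounds)
  have "bump n a b x \<le> 1 * 1" unfolding bump_def by (intro mult_mono flat_bounds) auto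
  moreover have "bump n a b x = 0" if "x \<notin> {a<..<b}"
    using that by (auto simp: bump_def flat_def zero_less_mult_iff)
  ultimately show "bump n a b x \<le> indicator {a<..<b} x" by (auto simp: indicator_def)
qed

lemma bump_tendsto: "(\<lambda>n. bump n a b x) \<longlonglongrightarrow> indicator {a<..<b} x"
proof (cases "x \<in> {a<..<b}")
  case True
  have *: "(\<lambda>n. flat (real (Suc n) * c)) \<longlonglongrightarrow> 1" if "c > 0" for c
  proof -
    have "(\<lambda>n. exp (- (1 / c) * inverse (real (Suc n)))) \<longlonglongrightarrow> exp (- (1 / c) * 0)"
      by (intro tendsto_intros LIMSEQ_inverse_real_of_nat)
    moreover have "flat (real (Suc n) * c) = exp (- (1 / c) * inverse (real (Suc n)))" for n
      using that by (simp add: flat_def field_simps del: of_nat_Suc)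
    ultimately show ?thesis by simp
  qed
  have "(\<lambda>n. bump n a b x) \<longlonglongrightarrow> 1 * 1"
    unfolding bump_def using True by (intro tendsto_mult *) auto
  then show ?thesis using True by simp
next
  case False
  then have "bump n a b x = 0" for n
    using bump_bounds[of n a b x] by auto
  then show ?thesis using False by simp
qed

lemma bump_pos: "x \<in> {a<..<b} \<Longrightarrow> bump n a b x > 0"
  by (auto simp: bump_def flat_def)

lemma Cc_infinity_iff:
  "Cc_infinity f \<longleftrightarrow> infinitely_differentiable f \<and> (\<exists>R. \<forall>x. \<bar>x\<bar> > R \<longrightarrow> f x = 0)"
  by (auto simp: Cc_infinity_def infinitely_differentiable_def)

lemma Cc_infinity_bump: "Cc_infinity (\<lambda>x. of_real (bump n a b x))"
  unfolding Cc_infinity_iff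
proof
  have 1: "infinitely_differentiable (\<lambda>x. of_real (flat (real (Suc n) * x + (- real (Suc n) * a))))"
    by (rule infinitely_differentiable_affine[OF flat_smooth])
  have 2: "infinitely_differentiable (\<lambda>x. of_real (flat ((- real (Suc n)) * x + real (Suc n) * b)))"
    by (rule infinitely_differentiable_affine[OF flat_smooth])
  show "infinitely_differentiable (\<lambda>x. of_real (bump n a b x))"
    using infinitely_differentiable_mult[OF 1 2] by (simp add: bump_def algebra_simps)
  have "bump n a b x = 0" if "\<bar>x\<bar> > max \<bar>a\<bar> \<bar>b\<bar>" for x
  proof -
    have "x \<notin> {a<..<b}" using that by auto
    then show ?thesis using bump_bounds[of n a b x] by simp
  qed
  then show "\<exists>R. \<forall>x. \<bar>x\<bar> > R \<longrightarrow> complex_of_real (bump n a b x) = 0"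
    by (intro exI[of _ "max \<bar>a\<bar> \<bar>b\<bar>"]) simp
qed

lemma Cc_infinity_0: "Cc_infinity (\<lambda>x. 0)"
  by (auto simp: Cc_infinity_iff infinitely_differentiable_const)

lemma Cc_infinity_add: "Cc_infinity f \<Longrightarrow> Cc_infinity g \<Longrightarrow> Cc_infinity (\<lambda>x. f x + g x)"
  unfolding Cc_infinity_iff
proof (elim conjE exE, intro conjI)
  fix R R' assume *: "\<forall>x. R < \<bar>x\<bar> \<longrightarrow> f x = 0" "\<forall>x. R' < \<bar>x\<bar> \<longrightarrow> g x = 0"
  then show "\<exists>R. \<forall>x. R < \<bar>x\<bar> \<longrightarrow> f x + g x = 0" by (intro exI[of _ "max R R'"]) auto
qed (rule infinitely_differentiable_add)

lemma Cc_infinity_mult: "infinitely_differentiable f \<Longrightarrow> Cc_infinity g \<Longrightarrow> Cc_infinity (\<lambda>x. f x * g x)"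
  unfolding Cc_infinity_iff
proof (intro conjI; (elim conjE)?)
  assume "infinitely_differentiable f" "infinitely_differentiable g"
  then show "infinitely_differentiable (\<lambda>x. f x * g x)" by (rule infinitely_differentiable_mult)
next
  assume "\<exists>R. \<forall>x. \<bar>x\<bar> > R \<longrightarrow> g x = 0"
  then show "\<exists>R. \<forall>x. \<bar>x\<bar> > R \<longrightarrow> f x * g x = 0" by auto
qed

lemma Cc_infinity_cmult: "Cc_infinity g \<Longrightarrow> Cc_infinity (\<lambda>x. a * g x)"
  by (rule Cc_infinity_mult[OF infinitely_differentiable_const])

lemma Cc_infinity_imp_cont: assumes "Cc_infinity f" shows "continuous_on UNIV f"
proof -
  obtain f' where "\<And>x. (f has_vector_derivative f' x) (at x)"
    using assms infinitely_differentiable_step[of f] unfolding Cc_infinity_iff by blast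
  then show ?thesis
    by (meson continuous_at_imp_continuous_on has_vector_derivative_continuous)
qed

lemma Cc_infinity_step:
  assumes "Cc_infinity f"
  obtains f' where "Cc_infinity f'" "\<And>x. (f has_vector_derivative f' x) (at x)"
proof -
  obtain f' where f': "infinitely_differentiable f'" "\<And>x. (f has_vector_derivative f' x) (at x)"
    using assms infinitely_differentiable_step[of f] unfolding Cc_infinity_iff by blast
  obtain R where R: "\<And>x. \<bar>x\<bar> > R \<Longrightarrow> f x = 0" using assms unfolding Cc_infinity_iff by blast
  have "f' x = 0" if "\<bar>x\<bar> > R" for x
  proof -
    have "((\<lambda>x. 0) has_vector_derivative 0) (at x)" by simp
    then have "(f has_vector_derivative 0) (at x)"
      by (rule has_vector_derivative_transform_within_open[of _ _ _ "{x. \<bar>x\<bar> > R}"])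
         (use that R in \<open>auto intro!: open_Collect_less continuous_intros\<close>)
    with f'(2)[of x] show ?thesis by (rule vector_derivative_unique_at)
  qed
  then show ?thesis using that f' unfolding Cc_infinity_iff by blast
qed

lemma Cc_infinity_bounded:
  assumes "Cc_infinity f" shows "\<exists>B\<ge>0. \<forall>x. cmod (f x) \<le> B"
proof -
  obtain R where R: "\<And>x. \<bar>x\<bar> > R \<Longrightarrow> f x = 0" using assms unfolding Cc_infinity_iff by blast
  have "compact (f ` {-R..R})"
    by (intro compact_continuous_image continuous_on_subset[OF Cc_infinity_imp_cont[OF assms]]) auto
  then obtain B where B: "\<forall>y\<in>f ` {-R..R}. norm y \<le> B"
    using compact_imp_bounded bounded_iff by blast
  have "cmod (f x) \<le> max B 0" for x
    using B R[of x] by (cases "\<bar>x\<bar> > R") (auto simp: abs_le_iff not_less intro: le_max_iff_disj[THEN iffD2])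
  then show ?thesis by (intro exI[of _ "max B 0"]) auto
qed

lemma Cc_infinity_imp_schwartz:
  assumes "Cc_infinity f" shows "schwartz f"
proof -
  have "\<exists>g'. Cc_infinity g' \<and> (\<forall>x. (g has_vector_derivative g' x) (at x))" if "Cc_infinity g" for g
    by (rule Cc_infinity_step[OF that]) blast
  then obtain d where d: "\<And>g. Cc_infinity g \<Longrightarrow> Cc_infinity (d g) \<and> (\<forall>x. (g has_vector_derivative d g x) (at x))"
    by metis
  have D: "Cc_infinity ((d ^^ n) f)" for n
    by (induction n) (use d assms in auto)
  have "bounded (range (\<lambda>x. complex_of_real (x ^ k) * (d ^^ n) f x))" for n k
  proof -
    obtain B where B: "\<And>x. cmod ((d ^^ n) f x) \<le> B" "B \<ge> 0" using Cc_infinity_bounded[OF D[of n]] by blast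
    obtain R where R: "\<And>x. \<bar>x\<bar> > R \<Longrightarrow> (d ^^ n) f x = 0" using D unfolding Cc_infinity_iff by blast
    have "cmod (complex_of_real (x ^ k) * (d ^^ n) f x) \<le> (max 0 R) ^ k * B" for x
    proof (cases "\<bar>x\<bar> > R")
      case True then show ?thesis using R B by simp
    next
      case False
      then show ?thesis using B
        by (auto simp: norm_mult power_abs norm_power intro!: mult_mono power_mono)
    qed
    then show ?thesis unfolding bounded_iff by blast
  qed
  then show ?thesis
    unfolding schwartz_def using d D
    by (intro exI[of _ "\<lambda>n. (d ^^ n) f"]) auto
qed

section \<open>The Fourier transform on the line\<close>

lemma integrable_weight: "integrable lborel (\<lambda>x::real. inverse (1 + x\<^sup>2))"
  using integrable_inverse_1_plus_square by (simp add: einterval_def set_integrable_def)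

lemma integrable_of_quadratic_decay:
  fixes f :: "real \<Rightarrow> complex"
  assumes "f \<in> borel_measurable borel" and "\<And>x. cmod (f x) \<le> C * inverse (1 + x\<^sup>2)"
  shows "integrable lborel f"
proof (rule Bochner_Integration.integrable_bound[where f="\<lambda>x::real. C * inverse (1 + x\<^sup>2)"])
  show "integrable lborel (\<lambda>x::real. C * inverse (1 + x\<^sup>2))"
    by (intro integrable_mult_right integrable_weight)
  show "AE x in lborel. norm (f x) \<le> norm (C * inverse (1 + x\<^sup>2))"
    using assms(2) by (auto intro!: order_trans[OF _ abs_ge_self])
qed (use assms in simp)

text \<open>The exchanges of integrals in this file have this form: two integrable functions of separate
  variables, coupled by a bounded kernel.\<close>

lemma Fubini_bounded_kernel:
  fixes f g :: "real \<Rightarrow> complex" and K :: "real \<Rightarrow> real \<Rightarrow> complex"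
  assumes f: "integrable lborel f" and g: "integrable lborel g"
    and K [measurable]: "(\<lambda>(x, y). K x y) \<in> borel_measurable (borel \<Otimes>\<^sub>M borel)"
    and B: "\<And>x y. cmod (K x y) \<le> B"
  shows "(LINT x|lborel. f x * (LINT y|lborel. g y * K x y)) =
         (LINT y|lborel. g y * (LINT x|lborel. f x * K x y))"
proof -
  have [measurable]: "f \<in> borel_measurable borel" "g \<in> borel_measurable borel"
    using f g by auto
  have gK: "integrable lborel (\<lambda>y. g y * K x y)" for x
  proof (rule Bochner_Integration.integrable_bound[OF integrable_mult_right[OF g, of "of_real B"]])
    have "cmod (g y) * cmod (K x y) \<le> cmod (g y) * \<bar>B\<bar>" for y
      by (intro mult_left_mono order_trans[OF B abs_ge_self]) simp
    then show "AE y in lborel. cmod (g y * K x y) \<le> cmod (of_real B * g y)"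
      by (simp add: norm_mult mult.commute)
  qed simp
  have "integrable (lborel \<Otimes>\<^sub>M lborel) (\<lambda>(x, y). f x * g y * K x y)"
  proof (rule lborel_pair.Fubini_integrable)
    have "(LINT y|lborel. norm (f x * g y * K x y)) \<le> cmod (f x) * (B * (LINT y|lborel. cmod (g y)))" for x
    proof -
      have "(LINT y|lborel. norm (f x * g y * K x y)) = cmod (f x) * (LINT y|lborel. cmod (g y * K x y))"
        by (simp add: norm_mult mult.assoc)
      also have "(LINT y|lborel. cmod (g y * K x y)) \<le> (LINT y|lborel. B * cmod (g y))"
        using B by (intro integral_mono integrable_norm gK integrable_mult_right g)
           (auto simp: norm_mult mult.commute[of B] intro!: mult_left_mono)
      finally show ?thesis by (simp add: mult_left_mono)
    qed
    then show "integrable lborel (\<lambda>x. LINT y|lborel. norm (case (x, y) of (x, y) \<Rightarrow> f x * g y * K x y))"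
      by (intro Bochner_Integration.integrable_bound[OF integrable_mult_left[OF integrable_norm[OF f], of "B * (LINT y|lborel. cmod (g y))"]])
         (auto intro!: order_trans[OF _ abs_ge_self])
    show "AE x in lborel. integrable lborel (\<lambda>y. case (x, y) of (x, y) \<Rightarrow> f x * g y * K x y)"
      using gK by (auto simp: mult.assoc intro!: integrable_mult_right)
  qed simp
  from lborel_pair.Fubini_integral[OF this]
  have "(LINT x|lborel. LINT y|lborel. f x * (g y * K x y)) = (LINT y|lborel. LINT x|lborel. g y * (f x * K x y))"
    by (simp add: mult_ac)
  then show ?thesis by simp
qed

lemma integral_derivative_eq_0:
  fixes F f :: "real \<Rightarrow> complex"
  assumes F: "\<And>x. (F has_vector_derivative f x) (at x)" and cont: "continuous_on UNIV f"
    and f: "integrable lborel f" and lim: "(F \<longlongrightarrow> 0) at_top" "(F \<longlongrightarrow> 0) at_bot"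
  shows "(LINT x|lborel. f x) = 0"
proof -
  have "(LBINT x=-\<infinity>..\<infinity>. f x) = 0 - 0"
  proof (rule interval_integral_FTC_integrable[where F=F])
    show "set_integrable lborel (einterval (-\<infinity>) \<infinity>) f"
      using f by (simp add: einterval_def set_integrable_def)
    show "((F \<circ> real_of_ereal) \<longlongrightarrow> 0) (at_right (-\<infinity>))"
      using lim(2) by (simp add: ereal_tendsto_simps)
    show "((F \<circ> real_of_ereal) \<longlongrightarrow> 0) (at_left \<infinity>)"
      using lim(1) by (simp add: ereal_tendsto_simps)
    show "isCont f x" for x using cont by (simp add: continuous_on_eq_continuous_at)
  qed (use F in auto)
  then show ?thesis
    by (simp add: interval_lebesgue_integral_def einterval_def set_lebesgue_integral_def)
qed

lemma fourier_integrand_integrable: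
  assumes "integrable lborel f" shows "integrable lborel (\<lambda>x. exp (- \<i> * of_real (x * \<xi>)) * f x)"
  using assms by (intro Bochner_Integration.integrable_bound[OF assms]) (auto simp: norm_mult)

lemma norm_fourier_le: "integrable lborel f \<Longrightarrow> cmod (fourier f \<xi>) \<le> (LINT x|lborel. cmod (f x))"
  unfolding fourier_def
  by (rule order_trans[OF integral_norm_bound]) (simp add: norm_mult)

lemma fourier_derivative:
  assumes f: "\<And>x. (f has_vector_derivative f' x) (at x)" and cont: "continuous_on UNIV f'"
    and int: "integrable lborel f" "integrable lborel f'"
    and lim: "(f \<longlongrightarrow> 0) at_top" "(f \<longlongrightarrow> 0) at_bot"
  shows "fourier f' \<xi> = \<i> * of_real \<xi> * fourier f \<xi>"
proof -
  let ?e = "\<lambda>x. exp (- \<i> * of_real (x * \<xi>))"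
  have e: "(?e has_vector_derivative (- \<i> * of_real \<xi>) * ?e x) (at x)" for x
    by (auto intro!: derivative_eq_intros has_vector_derivative_real_field simp: mult_ac)
  have cf: "continuous_on UNIV f"
    using f by (meson continuous_at_imp_continuous_on has_vector_derivative_continuous)
  have lim0: "((\<lambda>x. ?e x * f x) \<longlongrightarrow> 0) F" if "(f \<longlongrightarrow> 0) F" for F
  proof (rule tendsto_norm_zero_cancel)
    show "((\<lambda>x. cmod (?e x * f x)) \<longlongrightarrow> 0) F"
      using tendsto_norm_zero[OF that] by (simp add: norm_mult)
  qed
  have "(LINT x|lborel. ?e x * f' x + (- \<i> * of_real \<xi>) * (?e x * f x)) = 0"
  proof (rule integral_derivative_eq_0[where F="\<lambda>x. ?e x * f x"])
    show "((\<lambda>x. ?e x * f x) has_vector_derivative ?e x * f' x + - \<i> * of_real \<xi> * (?e x * f x)) (at x)" for x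
      using has_vector_derivative_mult[OF e f, of x] by (simp add: mult_ac)
    show "continuous_on UNIV (\<lambda>x. ?e x * f' x + - \<i> * of_real \<xi> * (?e x * f x))"
      by (intro continuous_intros cf cont)
    show "integrable lborel (\<lambda>x. ?e x * f' x + - \<i> * of_real \<xi> * (?e x * f x))"
      by (intro Bochner_Integration.integrable_add integrable_mult_right fourier_integrand_integrable int)
    show "((\<lambda>x. ?e x * f x) \<longlongrightarrow> 0) at_top" "((\<lambda>x. ?e x * f x) \<longlongrightarrow> 0) at_bot"
      using lim0 lim by blast+
  qed
  then have "(LINT x|lborel. ?e x * f' x) + (LINT x|lborel. (- \<i> * of_real \<xi>) * (?e x * f x)) = 0"
    by (subst (asm) Bochner_Integration.integral_add)
       (intro integrable_mult_right fourier_integrand_integrable int)+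
  then show ?thesis
    by (simp add: fourier_def eq_neg_iff_add_eq_0[symmetric] del: of_real_mult)
qed

text \<open>Two integrations by parts; the boundary terms vanish because of the limits at infinity.\<close>

lemma fourier_quadratic_decay:
  assumes f: "\<And>x. (f has_vector_derivative f' x) (at x)" "\<And>x. (f' has_vector_derivative f'' x) (at x)"
    and cont: "continuous_on UNIV f''"
    and int: "integrable lborel f" "integrable lborel f'" "integrable lborel f''"
    and lim: "(f \<longlongrightarrow> 0) at_top" "(f \<longlongrightarrow> 0) at_bot" "(f' \<longlongrightarrow> 0) at_top" "(f' \<longlongrightarrow> 0) at_bot"
  shows "\<exists>C. \<forall>\<xi>. cmod (fourier f \<xi>) \<le> C * inverse (1 + \<xi>\<^sup>2)"
proof (intro exI allI)
  fix \<xi> :: real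
  have cf': "continuous_on UNIV f'"
    using f(2) by (meson continuous_at_imp_continuous_on has_vector_derivative_continuous)
  have "fourier f'' \<xi> = - (of_real (\<xi>\<^sup>2) * fourier f \<xi>)"
    using fourier_derivative[OF f(2) cont int(2,3) lim(3,4), of \<xi>] fourier_derivative[OF f(1) cf' int(1,2) lim(1,2), of \<xi>]
    by (simp add: power2_eq_square algebra_simps)
  then have "\<xi>\<^sup>2 * cmod (fourier f \<xi>) = cmod (fourier f'' \<xi>)" by (simp add: norm_mult norm_power)
  then have "(1 + \<xi>\<^sup>2) * cmod (fourier f \<xi>) \<le> (LINT x|lborel. cmod (f x)) + (LINT x|lborel. cmod (f'' x))"
    using norm_fourier_le[OF int(1), of \<xi>] norm_fourier_le[OF int(3), of \<xi>] by (simp add: algebra_simps)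
  then show "cmod (fourier f \<xi>) \<le> ((LINT x|lborel. cmod (f x)) + (LINT x|lborel. cmod (f'' x))) * inverse (1 + \<xi>\<^sup>2)"
    by (simp add: field_simps add_pos_nonneg)
qed

lemma Cc_infinity_integrable: assumes "Cc_infinity f" shows "integrable lborel f"
proof -
  obtain R where R: "\<And>x. \<bar>x\<bar> > R \<Longrightarrow> f x = 0" using assms unfolding Cc_infinity_iff by blast
  have "integrable lborel (\<lambda>x. indicator {-R..R} x *\<^sub>R f x)"
    by (intro borel_integrable_compact continuous_on_subset[OF Cc_infinity_imp_cont[OF assms]]) auto
  moreover have "(\<lambda>x. indicator {-R..R} x *\<^sub>R f x) = f"
    using R by (force simp: indicator_def)
  ultimately show ?thesis by simp
qed

lemma Cc_infinity_tendsto_0: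
  assumes "Cc_infinity f" shows "(f \<longlongrightarrow> 0) at_top" "(f \<longlongrightarrow> 0) at_bot"
proof -
  obtain R where R: "\<And>x. \<bar>x\<bar> > R \<Longrightarrow> f x = 0" using assms unfolding Cc_infinity_iff by blast
  have "f x = 0" if "x > max R 0" for x using R[of x] that by auto
  then show "(f \<longlongrightarrow> 0) at_top"
    by (intro tendsto_eventually eventually_mono[OF eventually_gt_at_top[of "max R 0"]])
  have "f x = 0" if "x < min (- R) 0" for x using R[of x] that by auto
  then show "(f \<longlongrightarrow> 0) at_bot"
    by (intro tendsto_eventually eventually_mono[OF eventually_gt_at_bot[of "min (- R) 0"]])
qed

lemma fourier_measurable [measurable]:
  assumes [measurable]: "f \<in> borel_measurable borel" shows "fourier f \<in> borel_measurable borel"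
  unfolding fourier_def by measurable

lemma inv_fourier_measurable [measurable]:
  assumes [measurable]: "f \<in> borel_measurable borel" shows "inv_fourier f \<in> borel_measurable borel"
  unfolding inv_fourier_def by measurable

lemma fourier_Cc_infinity_integrable:
  assumes f: "Cc_infinity f" shows "integrable lborel (fourier f)"
proof -
  obtain f' where f': "Cc_infinity f'" "\<And>x. (f has_vector_derivative f' x) (at x)"
    using Cc_infinity_step[OF f] by blast
  obtain f'' where f'': "Cc_infinity f''" "\<And>x. (f' has_vector_derivative f'' x) (at x)"
    using Cc_infinity_step[OF f'(1)] by blast
  have "f \<in> borel_measurable borel" using Cc_infinity_integrable[OF f] by auto
  then show ?thesis
    using fourier_quadratic_decay[OF f'(2) f''(2) Cc_infinity_imp_cont[OF f''(1)]
        Cc_infinity_integrable[OF f] Cc_infinity_integrable[OF f'(1)] Cc_infinity_integrable[OF f''(1)]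
        Cc_infinity_tendsto_0[OF f] Cc_infinity_tendsto_0[OF f'(1)]]
    by (auto intro!: integrable_of_quadratic_decay)
qed

lemma std_normal_fourier:
  "(LINT \<xi>|lborel. of_real (std_normal_density \<xi>) * exp (\<i> * of_real (\<xi> * v))) = of_real (exp (- v\<^sup>2 / 2))"
proof -
  have "char std_normal_distribution v = (LINT \<xi>|lborel. std_normal_density \<xi> *\<^sub>R iexp (v * \<xi>))"
    unfolding char_def by (subst integral_density) (auto simp: normal_density_nonneg)
  then show ?thesis
    by (simp add: char_std_normal_distribution scaleR_conv_of_real mult.commute)
qed

text \<open>Inversion is obtained by inserting a Gaussian factor that tends to 1; on the other side this
  factor turns into averaging against a Gaussian that concentrates at the given point.\<close>

theorem fourier_inversion:
  assumes f: "integrable lborel f" "continuous_on UNIV f" "\<And>x. cmod (f x) \<le> B"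
    and ff: "integrable lborel (fourier f)"
  shows "inv_fourier (fourier f) x = f x"
proof -
  have [measurable]: "f \<in> borel_measurable borel" "fourier f \<in> borel_measurable borel"
    using f(1) by auto
  let ?\<phi> = std_normal_density
  have phi_int: "integrable lborel (\<lambda>\<xi>. complex_of_real (?\<phi> \<xi>))"
    by (simp add: integrable_normal_density)
  have phi: "complex_of_real (?\<phi> v) = of_real (exp (- v\<^sup>2 / 2)) / of_real (sqrt (2 * pi))" for v
    by (simp add: std_normal_density_def field_simps)
  define \<epsilon> where "\<epsilon> n = inverse (real (Suc n))" for n
  have eps: "\<epsilon> n > 0" for n by (simp add: \<epsilon>_def)
  have eps0: "\<epsilon> \<longlonglongrightarrow> 0" unfolding \<epsilon>_def by (rule LIMSEQ_inverse_real_of_nat)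
  have key: "(LINT v|lborel. f (x + \<epsilon> n * v) * of_real (?\<phi> v)) =
      (LINT \<eta>|lborel. of_real (?\<phi> (\<epsilon> n * \<eta>)) * (exp (\<i> * of_real (x * \<eta>)) * fourier f \<eta>)) / of_real (sqrt (2 * pi))" for n
  proof -
    have fe: "integrable lborel (\<lambda>v. f (x + \<epsilon> n * v))"
      using eps[of n] by (intro lborel_integrable_real_affine f) auto
    \<comment> \<open>The Gaussian in \<open>v\<close> is written as the transform of a Gaussian in \<open>\<xi>\<close>; after Fubini, the inner
      integral is, up to elementary factors, the Fourier transform of \<open>f\<close> at \<open>- \<xi> / \<epsilon> n\<close>.\<close>
    have "(LINT v|lborel. f (x + \<epsilon> n * v) * of_real (?\<phi> v)) =
      (LINT v|lborel. f (x + \<epsilon> n * v) * (LINT \<xi>|lborel. of_real (?\<phi> \<xi>) * exp (\<i> * of_real (\<xi> * v)))) / of_real (sqrt (2 * pi))"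
    proof -
      have "complex_of_real (?\<phi> v) = (LINT \<xi>|lborel. of_real (?\<phi> \<xi>) * exp (\<i> * of_real (\<xi> * v))) / of_real (sqrt (2 * pi))" for v
        unfolding std_normal_fourier by (rule phi)
      from arg_cong[where f="\<lambda>z. f (x + \<epsilon> n * _) * z", OF this]
      have "(LINT v|lborel. f (x + \<epsilon> n * v) * of_real (?\<phi> v)) =
         (LINT v|lborel. f (x + \<epsilon> n * v) * (LINT \<xi>|lborel. of_real (?\<phi> \<xi>) * exp (\<i> * of_real (\<xi> * v))) / of_real (sqrt (2 * pi)))"
        unfolding times_divide_eq_right[symmetric] by (rule Bochner_Integration.integral_cong[OF refl])
      then show ?thesis by (simp only: integral_divide_zero)
    qed
    also have "(LINT v|lborel. f (x + \<epsilon> n * v) * (LINT \<xi>|lborel. of_real (?\<phi> \<xi>) * exp (\<i> * of_real (\<xi> * v))))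
      = (LINT \<xi>|lborel. of_real (?\<phi> \<xi>) * (LINT v|lborel. f (x + \<epsilon> n * v) * exp (\<i> * of_real (\<xi> * v))))"
      by (intro Fubini_bounded_kernel[where B=1] fe phi_int) auto
    also have "\<dots> = (LINT \<eta>|lborel. \<bar>- \<epsilon> n\<bar> *\<^sub>R (of_real (?\<phi> (0 + (- \<epsilon> n) * \<eta>)) * (LINT v|lborel. f (x + \<epsilon> n * v) * exp (\<i> * of_real ((0 + (- \<epsilon> n) * \<eta>) * v)))))"
      using eps[of n] by (subst lborel_integral_real_affine[where c="- \<epsilon> n" and t=0]) auto
    also have "\<dots> = (LINT \<eta>|lborel. of_real (?\<phi> (\<epsilon> n * \<eta>)) * (exp (\<i> * of_real (x * \<eta>)) * fourier f \<eta>))"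
    proof (rule Bochner_Integration.integral_cong[OF refl])
      fix \<eta>
      have "fourier f \<eta> = \<epsilon> n *\<^sub>R (LINT v|lborel. exp (- \<i> * of_real ((x + \<epsilon> n * v) * \<eta>)) * f (x + \<epsilon> n * v))"
        unfolding fourier_def using eps[of n]
        by (subst lborel_integral_real_affine[where c="\<epsilon> n" and t=x]) auto
      also have "\<dots> = \<epsilon> n *\<^sub>R (LINT v|lborel. exp (- \<i> * of_real (x * \<eta>)) * (f (x + \<epsilon> n * v) * exp (\<i> * of_real ((0 + (- \<epsilon> n) * \<eta>) * v))))"
        by (intro arg_cong[where f="\<lambda>z. \<epsilon> n *\<^sub>R z"] Bochner_Integration.integral_cong refl)
           (simp add: exp_add[symmetric] algebra_simps exp_diff exp_minus divide_inverse)
      also have "\<dots> = \<epsilon> n *\<^sub>R (exp (- \<i> * of_real (x * \<eta>)) * (LINT v|lborel. f (x + \<epsilon> n * v) * exp (\<i> * of_real ((0 + (- \<epsilon> n) * \<eta>) * v))))"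
        by simp
      finally have *: "exp (\<i> * of_real (x * \<eta>)) * fourier f \<eta> = \<epsilon> n *\<^sub>R (LINT v|lborel. f (x + \<epsilon> n * v) * exp (\<i> * of_real ((0 + (- \<epsilon> n) * \<eta>) * v)))"
        by (simp add: exp_minus field_simps)
      show "\<bar>- \<epsilon> n\<bar> *\<^sub>R (of_real (?\<phi> (0 + (- \<epsilon> n) * \<eta>)) * (LINT v|lborel. f (x + \<epsilon> n * v) * exp (\<i> * of_real ((0 + (- \<epsilon> n) * \<eta>) * v))))
         = of_real (?\<phi> (\<epsilon> n * \<eta>)) * (exp (\<i> * of_real (x * \<eta>)) * fourier f \<eta>)"
        unfolding * using eps[of n] by (simp add: std_normal_density_def)
    qed
    finally show ?thesis .
  qed
  have L: "(\<lambda>n. LINT v|lborel. f (x + \<epsilon> n * v) * of_real (?\<phi> v)) \<longlonglongrightarrow> (LINT v|lborel. f x * of_real (?\<phi> v))"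
  proof (rule integral_dominated_convergence[where w="\<lambda>v. B * ?\<phi> v"])
    show "integrable lborel (\<lambda>v. B * ?\<phi> v)" by (simp add: integrable_normal_density)
    have "isCont f x" using f(2) by (simp add: continuous_on_eq_continuous_at)
    moreover have "(\<lambda>n. x + \<epsilon> n * v) \<longlonglongrightarrow> x + 0 * v" for v by (intro tendsto_intros eps0)
    ultimately have "(\<lambda>n. f (x + \<epsilon> n * v)) \<longlonglongrightarrow> f x" for v
      using isCont_tendsto_compose[of x f] by auto
    then show "AE v in lborel. (\<lambda>n. f (x + \<epsilon> n * v) * of_real (?\<phi> v)) \<longlonglongrightarrow> f x * of_real (?\<phi> v)"
      by (auto intro!: tendsto_mult_right)
    show "AE v in lborel. norm (f (x + \<epsilon> n * v) * of_real (?\<phi> v)) \<le> B * ?\<phi> v" for n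
      using f(3) by (auto simp: norm_mult normal_density_nonneg intro!: mult_right_mono)
  qed auto
  have R: "(\<lambda>n. LINT \<eta>|lborel. of_real (?\<phi> (\<epsilon> n * \<eta>)) * (exp (\<i> * of_real (x * \<eta>)) * fourier f \<eta>)) \<longlonglongrightarrow>
       (LINT \<eta>|lborel. of_real (?\<phi> 0) * (exp (\<i> * of_real (x * \<eta>)) * fourier f \<eta>))"
  proof (rule integral_dominated_convergence[where w="\<lambda>\<eta>. cmod (fourier f \<eta>)"])
    show "integrable lborel (\<lambda>\<eta>. cmod (fourier f \<eta>))" using ff by simp
    have "(\<lambda>n. ?\<phi> (\<epsilon> n * \<eta>)) \<longlonglongrightarrow> ?\<phi> (0 * \<eta>)" for \<eta>
      unfolding std_normal_density_def by (intro tendsto_intros eps0) auto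
    then show "AE \<eta> in lborel. (\<lambda>n. of_real (?\<phi> (\<epsilon> n * \<eta>)) * (exp (\<i> * of_real (x * \<eta>)) * fourier f \<eta>)) \<longlonglongrightarrow>
        of_real (?\<phi> 0) * (exp (\<i> * of_real (x * \<eta>)) * fourier f \<eta>)"
      by (intro AE_I2 tendsto_mult_right tendsto_of_real) auto
    have "?\<phi> v \<le> 1" for v
    proof -
      have "1 \<le> sqrt (2 * pi)" using pi_gt3 by simp
      moreover have "exp (- v\<^sup>2 / 2) \<le> 1" by simp
      ultimately have "exp (- v\<^sup>2 / 2) / sqrt (2 * pi) \<le> 1"
        by (subst divide_le_eq_1_pos) linarith+
      then show ?thesis by (simp add: std_normal_density_def)
    qed
    then show "AE \<eta> in lborel. norm (of_real (?\<phi> (\<epsilon> n * \<eta>)) * (exp (\<i> * of_real (x * \<eta>)) * fourier f \<eta>)) \<le> cmod (fourier f \<eta>)" for n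
      by (auto simp: norm_mult normal_density_nonneg intro!: mult_left_le_one_le)
  qed auto
  have "(LINT v|lborel. f x * of_real (?\<phi> v)) =
        (LINT \<eta>|lborel. of_real (?\<phi> 0) * (exp (\<i> * of_real (x * \<eta>)) * fourier f \<eta>)) / of_real (sqrt (2 * pi))"
    by (rule LIMSEQ_unique[OF L]) (simp only: key, intro tendsto_divide R tendsto_const, simp)
  moreover have "(LINT v|lborel. f x * of_real (?\<phi> v)) = f x"
    using integral_normal_density[of 1 0] by simp
  moreover have "complex_of_real (?\<phi> 0) = 1 / of_real (sqrt (2 * pi))"
    by (simp add: std_normal_density_def)
  ultimately have "f x = (LINT \<eta>|lborel. exp (\<i> * of_real (x * \<eta>)) * fourier f \<eta>) /
      (of_real (sqrt (2 * pi)) * of_real (sqrt (2 * pi)))"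
    by simp
  moreover have "complex_of_real (sqrt (2 * pi)) * of_real (sqrt (2 * pi)) = 2 * of_real pi"
    by (subst of_real_mult[symmetric]) simp
  ultimately show ?thesis
    unfolding inv_fourier_def by (simp only:)
qed

section \<open>Continuous functions are determined by their action on Schwartz functions\<close>

lemma schwartz_imp_measurable: "schwartz g \<Longrightarrow> g \<in> borel_measurable borel"
  unfolding schwartz_def
  by (metis borel_measurable_continuous_onI continuous_at_imp_continuous_on has_vector_derivative_continuous)

lemma schwartz_decay:
  assumes "schwartz g" shows "\<exists>C. \<forall>x. cmod (g x) * (1 + x\<^sup>2) \<le> C * inverse (1 + x\<^sup>2)"
proof -
  have b: "bounded (range (\<lambda>x. complex_of_real (x ^ k) * g x))" for k
    using assms unfolding schwartz_def by metis
  obtain C0 C2 C4 where C: "\<And>x. cmod (complex_of_real (x ^ 0) * g x) \<le> C0"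
     "\<And>x. cmod (complex_of_real (x ^ 2) * g x) \<le> C2" "\<And>x. cmod (complex_of_real (x ^ 4) * g x) \<le> C4"
    using b[of 0] b[of 2] b[of 4] unfolding bounded_iff by blast
  have "cmod (g x) * (1 + x\<^sup>2) \<le> (C0 + 2 * C2 + C4) * inverse (1 + x\<^sup>2)" for x
  proof -
    have "cmod (g x) * (1 + x\<^sup>2) * (1 + x\<^sup>2) = cmod (g x) + 2 * (x^2 * cmod (g x)) + x^4 * cmod (g x)"
      by (simp add: algebra_simps power2_eq_square power4_eq_xxxx)
    also have "\<dots> \<le> C0 + 2 * C2 + C4"
      using C[of x] by (simp add: norm_mult norm_power)
    finally show ?thesis by (simp add: field_simps add_pos_nonneg)
  qed
  then show ?thesis by blast
qed

lemma schwartz_integrable: assumes "schwartz g" shows "integrable lborel g"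
proof -
  obtain C where C: "\<And>x. cmod (g x) * (1 + x\<^sup>2) \<le> C * inverse (1 + x\<^sup>2)"
    using schwartz_decay[OF assms] by blast
  have "cmod (g x) \<le> C * inverse (1 + x\<^sup>2)" for x
    by (rule order_trans[OF _ C]) (simp add: mult_le_cancel_left1)
  then show ?thesis
    by (intro integrable_of_quadratic_decay schwartz_imp_measurable assms)
qed

text \<open>This makes the function in \<open>fun_of_distr\<close> unique.  If \<open>w x \<noteq> 0\<close>, then \<open>w\<close> has a nonzero integral against a
  bump so close to \<open>x\<close> that \<open>w\<close> stays in a half-plane around \<open>w x\<close>.\<close>

lemma continuous_eq_0_if_annihilates_schwartz:
  fixes w :: "real \<Rightarrow> complex"
  assumes cont: "continuous_on UNIV w"
    and w: "\<And>g. schwartz g \<Longrightarrow> integrable lborel (\<lambda>x. w x * g x) \<and> (LINT x|lborel. w x * g x) = 0"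
  shows "w x = 0"
proof (rule ccontr)
  assume nz: "w x \<noteq> 0"
  define v where "v y = Re (cnj (w x) * w y)" for y
  have "v x = (cmod (w x))\<^sup>2"
    unfolding v_def by (metis Re_complex_of_real complex_norm_square mult.commute)
  then have "v x > 0" using nz by simp
  moreover have "continuous_on UNIV v" unfolding v_def by (intro continuous_intros cont)
  ultimately have "open {y. v y > 0}" "x \<in> {y. v y > 0}"
    by (auto intro: open_Collect_less continuous_on_const)
  then obtain e where e: "e > 0" "\<And>y. dist x y < e \<Longrightarrow> v y > 0"
    unfolding open_dist by (metis dist_commute mem_Collect_eq)
  define g where "g = (\<lambda>y. bump 0 (x - e) (x + e) y)"
  have s: "schwartz (\<lambda>y. of_real (g y))" unfolding g_def by (intro Cc_infinity_imp_schwartz Cc_infinity_bump)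
  have int': "integrable lborel (\<lambda>y. cnj (w x) * (w y * of_real (g y)))"
    using w[OF s] by (intro integrable_mult_right) auto
  have vg: "v y * g y = Re (cnj (w x) * (w y * of_real (g y)))" for y
    by (simp add: v_def algebra_simps)
  have int: "integrable lborel (\<lambda>y. v y * g y)"
    unfolding vg by (rule integrable_Re[OF int'])
  have "(LINT y|lborel. v y * g y) = Re (LINT y|lborel. cnj (w x) * (w y * of_real (g y)))"
    unfolding vg by (rule integral_Re[OF int'])
  then have "(LINT y|lborel. v y * g y) = 0" using w[OF s] by simp
  moreover have nn: "0 \<le> v y * g y" for y
  proof (cases "y \<in> {x - e<..<x + e}")
    case True
    then have "dist x y < e" by (auto simp: dist_real_def)
    then show ?thesis using e(2)[of y] bump_bounds(1)[of 0 "x - e" "x + e" y] by (simp add: g_def)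
  next
    case False
    then show ?thesis using bump_bounds[of 0 "x - e" "x + e" y] by (simp add: g_def)
  qed
  ultimately have "AE y in lborel. v y * g y = 0"
    using integral_nonneg_eq_0_iff_AE[OF int] by simp
  moreover have "v y * g y \<noteq> 0" if "y \<in> {x - e<..<x + e}" for y
  proof -
    have "dist x y < e" using that by (auto simp: dist_real_def)
    then show ?thesis using e(2)[of y] bump_pos[OF that, of 0] by (simp add: g_def)
  qed
  ultimately have "AE y in lborel. y \<notin> {x - e<..<x + e}" by (auto elim: eventually_mono)
  then have "emeasure lborel {x - e<..<x + e} = 0"
    by (subst (asm) AE_iff_measurable[where N="{x - e<..<x + e}"]) auto
  then show False using e(1) by simp
qed

section \<open>The terms of the operator as convolutions\<close>

lemma weight_pos: "0 < inverse (1 + x\<^sup>2)" for x :: real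
  by (simp add: add_pos_nonneg)

text \<open>The factor depends only on the translation \<open>x\<close>.  Hence functions that are integrable against the
  weight can be integrated against each of its translates.\<close>

lemma weight_shift_le: "inverse (1 + (x - y)\<^sup>2) \<le> 2 * (1 + x\<^sup>2) * inverse (1 + y\<^sup>2)" for x y :: real
proof -
  have "2 * (1 + x\<^sup>2) * (1 + (x - y)\<^sup>2) - (1 + y\<^sup>2) = 1 + (2 * x - y)\<^sup>2 + 2 * x\<^sup>2 * (x - y)\<^sup>2"
    by (simp add: power2_eq_square algebra_simps)
  then have "1 + y\<^sup>2 \<le> 2 * (1 + x\<^sup>2) * (1 + (x - y)\<^sup>2)"
    by (smt (verit) zero_le_power2 mult_nonneg_nonneg)
  then show ?thesis by (simp add: field_simps add_pos_nonneg)
qed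

lemma integral_weight: "(LINT x|lborel. inverse (1 + x\<^sup>2)) = pi"
  using LBINT_inverse_1_plus_square
  by (simp add: interval_lebesgue_integral_def einterval_def set_lebesgue_integral_def)

lemma continuous_fourier: 
  assumes f: "integrable lborel f" shows "continuous_on UNIV (fourier f)"
  unfolding continuous_on_sequentially
proof (intro allI ballI impI, elim conjE)
  fix X :: "nat \<Rightarrow> real" and a assume X: "X \<longlonglongrightarrow> a"
  show "(fourier f \<circ> X) \<longlonglongrightarrow> fourier f a"
    unfolding fourier_def comp_def
  proof (rule integral_dominated_convergence[where w="\<lambda>x. cmod (f x)"])
    show "AE x in lborel. (\<lambda>n. exp (- \<i> * of_real (x * X n)) * f x) \<longlonglongrightarrow> exp (- \<i> * of_real (x * a)) * f x"
      by (intro AE_I2 tendsto_intros X)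
  qed (use f in \<open>auto simp: norm_mult\<close>)
qed

lemma inv_fourier_conv_fourier: "inv_fourier f x = fourier f (- x) / (2 * of_real pi)"
  by (simp add: inv_fourier_def fourier_def mult.commute[of x] mult.commute[of "of_real x"])

lemma continuous_inv_fourier:
  assumes "integrable lborel f" shows "continuous_on UNIV (inv_fourier f)"
  unfolding inv_fourier_conv_fourier
  by (intro continuous_intros continuous_on_compose2[OF continuous_fourier[OF assms]]) auto

definition convolve :: "(real \<Rightarrow> complex) \<Rightarrow> (real \<Rightarrow> complex) \<Rightarrow> real \<Rightarrow> complex" where
  "convolve f k x = (LINT y|lborel. f y * k (x - y))"

definition weighted_norm :: "(real \<Rightarrow> complex) \<Rightarrow> real" where
  "weighted_norm f = (LINT y|lborel. cmod (f y) * inverse (1 + y\<^sup>2))"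

definition weighted_integrable :: "(real \<Rightarrow> complex) \<Rightarrow> bool" where
  "weighted_integrable f \<longleftrightarrow> f \<in> borel_measurable borel \<and> integrable lborel (\<lambda>y. cmod (f y) * inverse (1 + y\<^sup>2))"

lemma integrable_imp_weighted_integrable:
  assumes "integrable lborel f" shows "weighted_integrable f"
proof -
  have "inverse (1 + y\<^sup>2) \<le> 1" for y :: real
    by (simp add: inverse_le_1_iff)
  then have "integrable lborel (\<lambda>y. cmod (f y) * inverse (1 + y\<^sup>2))"
    by (intro Bochner_Integration.integrable_bound[OF assms])
       (use assms in \<open>auto intro!: mult_right_le_one_le AE_I2\<close>)
  then show ?thesis unfolding weighted_integrable_def using assms by auto
qed

text \<open>A kernel that decays like \<open>1 / (1 + x\<^sup>2)\<close> can be convolved with every function which is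
  integrable against this weight; all \<open>L\<^sup>p\<close> functions are of this kind.\<close>

locale decaying_kernel =
  fixes k :: "real \<Rightarrow> complex" and A :: real
  assumes cont: "continuous_on UNIV k" and decay: "\<And>x. cmod (k x) \<le> A * inverse (1 + x\<^sup>2)"
begin

lemma A_nonneg: "A \<ge> 0"
  using order_trans[OF norm_ge_zero decay[of 0]] by simp

lemma measurable_kernel [measurable]: "k \<in> borel_measurable borel"
  using cont by (rule borel_measurable_continuous_onI)

lemma norm_integrand_le: "cmod (f y * k (x - y)) \<le> 2 * A * (1 + x\<^sup>2) * (cmod (f y) * inverse (1 + y\<^sup>2))"
proof -
  have "cmod (k (x - y)) \<le> A * (2 * (1 + x\<^sup>2) * inverse (1 + y\<^sup>2))"
    by (intro order_trans[OF decay] mult_left_mono weight_shift_le A_nonneg)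
  then have "cmod (f y) * cmod (k (x - y)) \<le> cmod (f y) * (A * (2 * (1 + x\<^sup>2) * inverse (1 + y\<^sup>2)))"
    by (intro mult_left_mono) auto
  then show ?thesis by (simp add: norm_mult mult_ac)
qed

lemma integrable_convolution:
  assumes "weighted_integrable f" shows "integrable lborel (\<lambda>y. f y * k (x - y))"
proof (rule Bochner_Integration.integrable_bound)
  have [measurable]: "f \<in> borel_measurable borel" using assms by (simp add: weighted_integrable_def)
  show "integrable lborel (\<lambda>y. 2 * A * (1 + x\<^sup>2) * (cmod (f y) * inverse (1 + y\<^sup>2)))"
    using assms unfolding weighted_integrable_def by (intro integrable_mult_right) auto
  show "AE y in lborel. norm (f y * k (x - y)) \<le> norm (2 * A * (1 + x\<^sup>2) * (cmod (f y) * inverse (1 + y\<^sup>2)))"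
    by (intro AE_I2) (simp only: real_norm_def, rule order_trans[OF norm_integrand_le abs_ge_self])
  show "(\<lambda>y. f y * k (x - y)) \<in> borel_measurable lborel" by measurable
qed

lemma norm_convolution_le:
  assumes "weighted_integrable f"
  shows "cmod (convolve f k x) \<le> 2 * A * (1 + x\<^sup>2) * weighted_norm f"
proof -
  have "cmod (convolve f k x) \<le> (LINT y|lborel. cmod (f y * k (x - y)))"
    unfolding convolve_def by (rule integral_norm_bound)
  also have "\<dots> \<le> (LINT y|lborel. 2 * A * (1 + x\<^sup>2) * (cmod (f y) * inverse (1 + y\<^sup>2)))"
    using assms unfolding weighted_integrable_def
    by (intro integral_mono integrable_norm integrable_convolution[OF assms] integrable_mult_right norm_integrand_le) auto
  finally show ?thesis by (simp add: weighted_norm_def)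
qed

lemma continuous_convolution:
  assumes f: "weighted_integrable f" shows "continuous_on UNIV (convolve f k)"
  unfolding continuous_on_sequentially
proof (intro allI ballI impI, elim conjE)
  fix X :: "nat \<Rightarrow> real" and a assume X: "X \<longlonglongrightarrow> a"
  have [measurable]: "f \<in> borel_measurable borel" using f by (simp add: weighted_integrable_def)
  have "Bseq X" using X by (meson convergentI convergent_imp_Bseq)
  then obtain R where R: "\<And>n. \<bar>X n\<bar> \<le> R"
    unfolding Bseq_def by auto
  show "(convolve f k \<circ> X) \<longlonglongrightarrow> convolve f k a"
    unfolding convolve_def comp_def
  proof (rule integral_dominated_convergence[where w="\<lambda>y. 2 * A * (1 + R\<^sup>2) * (cmod (f y) * inverse (1 + y\<^sup>2))"])
    show "integrable lborel (\<lambda>y. 2 * A * (1 + R\<^sup>2) * (cmod (f y) * inverse (1 + y\<^sup>2)))"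
      using f unfolding weighted_integrable_def by (intro integrable_mult_right) auto
    have "isCont k x" for x using cont by (simp add: continuous_on_eq_continuous_at)
    then have "(\<lambda>n. k (X n - y)) \<longlonglongrightarrow> k (a - y)" for y
      by (rule isCont_tendsto_compose) (intro tendsto_intros X)
    then show "AE y in lborel. (\<lambda>n. f y * k (X n - y)) \<longlonglongrightarrow> f y * k (a - y)"
      by (intro AE_I2 tendsto_mult_left)
    have "2 * A * (1 + (X n)\<^sup>2) * (cmod (f y) * inverse (1 + y\<^sup>2)) \<le> 2 * A * (1 + R\<^sup>2) * (cmod (f y) * inverse (1 + y\<^sup>2))" for n y
      using R[of n] A_nonneg weight_pos[of y]
      by (intro mult_right_mono mult_left_mono) (auto simp: abs_le_square_iff[symmetric])
    then show "AE y in lborel. norm (f y * k (X n - y)) \<le> 2 * A * (1 + R\<^sup>2) * (cmod (f y) * inverse (1 + y\<^sup>2))" for n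
      using order_trans[OF norm_integrand_le] by (intro AE_I2) blast
  qed auto
qed

lemma convolution_schwartz_integrable:
  assumes f: "weighted_integrable f" and g: "schwartz g"
  shows "integrable lborel (\<lambda>x. convolve f k x * g x)"
proof -
  obtain C where C: "\<And>x. cmod (g x) * (1 + x\<^sup>2) \<le> C * inverse (1 + x\<^sup>2)"
    using schwartz_decay[OF g] by blast
  have "cmod (convolve f k x * g x) \<le> (2 * A * weighted_norm f * C) * inverse (1 + x\<^sup>2)" for x
  proof -
    have w: "0 \<le> weighted_norm f" unfolding weighted_norm_def
      by (intro Bochner_Integration.integral_nonneg mult_nonneg_nonneg order_less_imp_le[OF weight_pos]) auto
    have "cmod (convolve f k x * g x) \<le> (2 * A * (1 + x\<^sup>2) * weighted_norm f) * cmod (g x)"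
      unfolding norm_mult by (intro mult_right_mono norm_convolution_le f) auto
    also have "\<dots> = (2 * A * weighted_norm f) * (cmod (g x) * (1 + x\<^sup>2))" by (simp add: mult_ac)
    also have "\<dots> \<le> (2 * A * weighted_norm f) * (C * inverse (1 + x\<^sup>2))"
      using A_nonneg w by (intro mult_left_mono C) auto
    finally show ?thesis by (simp add: mult_ac)
  qed
  moreover have "(\<lambda>x. convolve f k x * g x) \<in> borel_measurable borel"
    using schwartz_imp_measurable[OF g] borel_measurable_continuous_onI[OF continuous_convolution[OF f]]
    by measurable
  ultimately show ?thesis by (intro integrable_of_quadratic_decay)
qed

lemma convolution_diff:
  assumes "weighted_integrable f" "weighted_integrable g"
  shows "convolve (\<lambda>y. f y - g y) k x = convolve f k x - convolve g k x"
  unfolding convolve_def using integrable_convolution[OF assms(1)] integrable_convolution[OF assms(2)]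
  by (simp add: left_diff_distrib)

text \<open>The two variables are given weights that make the double integral converge absolutely and leave a
  bounded kernel.\<close>

lemma Fubini_convolution:
  assumes f: "weighted_integrable f" and g: "schwartz g"
  shows "(LINT x|lborel. convolve f k x * g x) = (LINT y|lborel. f y * (LINT x|lborel. g x * k (x - y)))"
proof -
  have [measurable]: "f \<in> borel_measurable borel" "g \<in> borel_measurable borel"
    using f schwartz_imp_measurable[OF g] by (auto simp: weighted_integrable_def)
  let ?f = "\<lambda>y. f y * of_real (inverse (1 + y\<^sup>2))" and ?g = "\<lambda>x. g x * of_real (1 + x\<^sup>2)"
  let ?K = "\<lambda>x y. k (x - y) * of_real ((1 + y\<^sup>2) * inverse (1 + x\<^sup>2))"
  have nz: "complex_of_real (1 + y\<^sup>2) \<noteq> 0" for y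
    using weight_pos[of y] by (metis inverse_zero less_irrefl of_real_eq_0_iff)
  have cancel: "g * X * (k * (Y * inverse X)) = Y * (g * k)" "g * inverse X * (k * (X * inverse Y)) = inverse Y * (g * k)"
    "g * inverse X * (X * k) = g * k" "g * X * (inverse X * k) = k * g" if "X \<noteq> 0" for g k X Y :: complex
    using that by (simp_all add: field_simps)
  have int_f: "integrable lborel ?f"
  proof -
    have "integrable lborel (\<lambda>y. cmod (?f y))"
      using f by (simp add: weighted_integrable_def norm_mult norm_inverse del: of_real_inverse)
    then show ?thesis by (rule integrable_norm_cancel) simp
  qed
  have int_g: "integrable lborel ?g"
  proof -
    obtain C where C: "\<And>x. cmod (g x) * (1 + x\<^sup>2) \<le> C * inverse (1 + x\<^sup>2)"
      using schwartz_decay[OF g] by blast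
    have "cmod (?g x) \<le> C * inverse (1 + x\<^sup>2)" for x
      unfolding norm_mult norm_of_real using C[of x] by simp
    then show ?thesis by (intro integrable_of_quadratic_decay[where C=C]) auto
  qed
  have bound: "cmod (?K x y) \<le> 2 * A" for x y
  proof -
    have "cmod (k (x - y)) \<le> A * (2 * (1 + x\<^sup>2) * inverse (1 + y\<^sup>2))"
      by (intro order_trans[OF decay] mult_left_mono weight_shift_le A_nonneg)
    then have "cmod (k (x - y)) * ((1 + y\<^sup>2) * inverse (1 + x\<^sup>2)) \<le>
        A * (2 * (1 + x\<^sup>2) * inverse (1 + y\<^sup>2)) * ((1 + y\<^sup>2) * inverse (1 + x\<^sup>2))"
      by (intro mult_right_mono) (auto simp: add_pos_nonneg)
    also have "\<dots> = 2 * A"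
    proof -
      have "A * (2 * X * inverse Y) * (Y * inverse X) = 2 * A" if "X \<noteq> 0" "Y \<noteq> 0" for X Y :: real
        using that by (simp add: field_simps)
      moreover have "1 + x\<^sup>2 \<noteq> 0" "1 + y\<^sup>2 \<noteq> 0" using weight_pos[of x] weight_pos[of y] by auto
      ultimately show ?thesis by blast
    qed
    finally show ?thesis by (simp add: norm_mult norm_inverse del: of_real_mult of_real_add) 
  qed
  have "(LINT y|lborel. ?f y * (LINT x|lborel. ?g x * ?K x y)) = (LINT x|lborel. ?g x * (LINT y|lborel. ?f y * ?K x y))"
    by (rule Fubini_bounded_kernel[where B="2 * A", OF int_f int_g _ bound]) measurable
  moreover have "(LINT x|lborel. ?g x * ?K x y) = of_real (1 + y\<^sup>2) * (LINT x|lborel. g x * k (x - y))" for y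
    unfolding integral_mult_right_zero[symmetric] of_real_mult of_real_inverse
    by (intro Bochner_Integration.integral_cong[OF refl] cancel nz)
  moreover have "(LINT y|lborel. ?f y * ?K x y) = of_real (inverse (1 + x\<^sup>2)) * convolve f k x" for x
    unfolding convolve_def integral_mult_right_zero[symmetric] of_real_mult of_real_inverse
    by (intro Bochner_Integration.integral_cong[OF refl] cancel nz)
  moreover have "?f y * (of_real (1 + y\<^sup>2) * z) = f y * z" for y z
    unfolding of_real_inverse by (intro cancel nz)
  moreover have "?g x * (of_real (inverse (1 + x\<^sup>2)) * z) = z * g x" for x z
    unfolding of_real_inverse by (intro cancel nz)
  ultimately show ?thesis by (simp only:)
qed

end

text \<open>In the distributional definition all transforms act on the test function \<open>g\<close>.  Fubini's theorem turns the
  transform of \<open>m \<cdot> inv_fourier g\<close> into an integral of \<open>g\<close> against translates of the kernel.\<close>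

lemma multiplier_distribution_eq_convolution:
  assumes m: "integrable lborel m" and k: "decaying_kernel (inv_fourier m) A"
    and f: "weighted_integrable f"
  shows "fun_of_distr (inv_fourier_distr (mult_distr m (fourier_distr (distr_of f)))) = convolve f (inv_fourier m)"
proof -
  interpret decaying_kernel "inv_fourier m" A by fact
  let ?T = "inv_fourier_distr (mult_distr m (fourier_distr (distr_of f)))"
  have [measurable]: "m \<in> borel_measurable borel" using m by auto
  have T: "?T g = distr_of (convolve f (inv_fourier m)) g" if g: "schwartz g" for g
  proof -
    have "fourier (\<lambda>\<xi>. m \<xi> * inv_fourier g \<xi>) y = (LINT x|lborel. g x * inv_fourier m (x - y))" for y
    proof -
      have "fourier (\<lambda>\<xi>. m \<xi> * inv_fourier g \<xi>) y =
          (LINT \<xi>|lborel. (exp (- \<i> * of_real (\<xi> * y)) * m \<xi>) * (LINT x|lborel. g x * exp (\<i> * of_real (\<xi> * x)))) / (2 * of_real pi)"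
        unfolding fourier_def inv_fourier_def
        by (subst integral_divide_zero[symmetric], rule Bochner_Integration.integral_cong[OF refl]) (simp add: mult_ac)
      also have "(LINT \<xi>|lborel. (exp (- \<i> * of_real (\<xi> * y)) * m \<xi>) * (LINT x|lborel. g x * exp (\<i> * of_real (\<xi> * x))))
        = (LINT x|lborel. g x * (LINT \<xi>|lborel. (exp (- \<i> * of_real (\<xi> * y)) * m \<xi>) * exp (\<i> * of_real (\<xi> * x))))"
        by (rule Fubini_bounded_kernel[where B=1, OF fourier_integrand_integrable[OF m] schwartz_integrable[OF g]]) auto
      also have "\<dots> = (LINT x|lborel. g x * (2 * of_real pi * inv_fourier m (x - y)))"
      proof (intro Bochner_Integration.integral_cong[OF refl] arg_cong2[where f="(*)"])
        fix x
        have "(LINT \<xi>|lborel. (exp (- \<i> * of_real (\<xi> * y)) * m \<xi>) * exp (\<i> * of_real (\<xi> * x))) = (LINT \<xi>|lborel. exp (\<i> * of_real ((x - y) * \<xi>)) * m \<xi>)"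
          by (rule Bochner_Integration.integral_cong[OF refl]) (simp add: algebra_simps exp_diff exp_minus divide_inverse)
        then show "(LINT \<xi>|lborel. (exp (- \<i> * of_real (\<xi> * y)) * m \<xi>) * exp (\<i> * of_real (\<xi> * x))) = 2 * of_real pi * inv_fourier m (x - y)"
          by (simp add: inv_fourier_def)
      qed simp
      also have "(LINT x|lborel. g x * (2 * of_real pi * inv_fourier m (x - y))) = 2 * of_real pi * (LINT x|lborel. g x * inv_fourier m (x - y))"
        unfolding integral_mult_right_zero[symmetric] by (simp only: mult_ac)
      finally show ?thesis by simp
    qed
    then show ?thesis
      unfolding inv_fourier_distr_def mult_distr_def fourier_distr_def distr_of_def
      by (simp add: Fubini_convolution[OF f g])
  qed
  show ?thesis
    unfolding fun_of_distr_def
  proof (rule the_equality, intro conjI allI impI)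
    show "continuous_on UNIV (convolve f (inv_fourier m))" by (rule continuous_convolution[OF f])
    fix g assume g: "schwartz g"
    show "integrable lborel (\<lambda>x. convolve f (inv_fourier m) x * g x)"
      by (rule convolution_schwartz_integrable[OF f g])
    show "distr_of (convolve f (inv_fourier m)) g = ?T g" by (simp add: T[OF g])
  next
    fix u assume u: "continuous_on UNIV u \<and> (\<forall>g. schwartz g \<longrightarrow> integrable lborel (\<lambda>x. u x * g x) \<and> distr_of u g = ?T g)"
    show "u = convolve f (inv_fourier m)"
    proof
      fix x
      have "u x - convolve f (inv_fourier m) x = 0"
      proof (rule continuous_eq_0_if_annihilates_schwartz[where w="\<lambda>x. u x - convolve f (inv_fourier m) x"])
        show "continuous_on UNIV (\<lambda>x. u x - convolve f (inv_fourier m) x)"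
          using u by (intro continuous_on_diff continuous_convolution[OF f]) auto
        fix g assume g: "schwartz g"
        have "integrable lborel (\<lambda>x. u x * g x)" using u g by auto
        moreover note convolution_schwartz_integrable[OF f g]
        moreover have "distr_of u g = distr_of (convolve f (inv_fourier m)) g" using u g T by simp
        ultimately show "integrable lborel (\<lambda>x. (u x - convolve f (inv_fourier m) x) * g x) \<and>
            (LINT x|lborel. (u x - convolve f (inv_fourier m) x) * g x) = 0"
          by (simp add: left_diff_distrib distr_of_def)
      qed
      then show "u x = convolve f (inv_fourier m) x" by simp
    qed
  qed
qed

text \<open>For integrable functions the convolution can be computed on the Fourier side, which is the form in which
  limits of multipliers are taken.\<close>

lemma convolution_inv_fourier:
  assumes m: "integrable lborel m" and f: "integrable lborel f"
  shows "convolve f (inv_fourier m) x = inv_fourier (\<lambda>\<xi>. m \<xi> * fourier f \<xi>) x"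
proof -
  have [measurable]: "m \<in> borel_measurable borel" using m by auto
  have k: "inv_fourier m (x - y) = (LINT \<xi>|lborel. (exp (\<i> * of_real (x * \<xi>)) * m \<xi>) * exp (- \<i> * of_real (y * \<xi>))) / (2 * of_real pi)" for y
    unfolding inv_fourier_def
    by (intro arg_cong[where f="\<lambda>z. z / _"] Bochner_Integration.integral_cong[OF refl])
       (simp add: algebra_simps exp_diff exp_minus divide_inverse)
  have "convolve f (inv_fourier m) x = (LINT y|lborel. f y * (LINT \<xi>|lborel. (exp (\<i> * of_real (x * \<xi>)) * m \<xi>) * exp (- \<i> * of_real (y * \<xi>)))) / (2 * of_real pi)"
    unfolding convolve_def k times_divide_eq_right by (rule integral_divide_zero)
  also have "(LINT y|lborel. f y * (LINT \<xi>|lborel. (exp (\<i> * of_real (x * \<xi>)) * m \<xi>) * exp (- \<i> * of_real (y * \<xi>))))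
    = (LINT \<xi>|lborel. (exp (\<i> * of_real (x * \<xi>)) * m \<xi>) * (LINT y|lborel. f y * exp (- \<i> * of_real (y * \<xi>))))"
    using fourier_integrand_integrable[OF m, of "- x"]
    by (intro Fubini_bounded_kernel[where B=1] f) (auto simp: mult.commute)
  finally show ?thesis
    unfolding inv_fourier_def[of "\<lambda>\<xi>. m \<xi> * fourier f \<xi>"] by (simp add: fourier_def mult_ac)
qed

section \<open>The multipliers\<close>

text \<open>For \<open>a = b\<close> this is the smooth step \<open>1 / (1 + exp (2 b w))\<close>, which goes from 1 at \<open>- \<infinity>\<close> to 0 at \<open>\<infinity>\<close>; for
  \<open>\<bar>a\<bar> < b\<close> it decays exponentially in both directions.\<close>

definition damped_exp :: "real \<Rightarrow> real \<Rightarrow> real \<Rightarrow> real" where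
  "damped_exp a b w = exp (- a * w) / (2 * cosh (b * w))"

lemma S_multiplier_eq:
  "S_multiplier \<beta> j y s \<xi> =
     damped_exp (\<beta> - pi / 2 + s) (2 * \<beta> - pi) (\<xi> - of_int j / 2) * damped_exp (pi / 2 - s + y) pi \<xi>"
  by (simp add: S_multiplier_def damped_exp_def)

lemma damped_exp_pos: "0 < damped_exp a b w"
  by (simp add: damped_exp_def cosh_real_pos)

lemma damped_exp_le: assumes "b \<ge> 0" shows "damped_exp a b w \<le> exp (- (b - \<bar>a\<bar>) * \<bar>w\<bar>)"
proof -
  have "exp (- a * w) \<le> exp (\<bar>a\<bar> * \<bar>w\<bar>)" by (simp add: abs_mult[symmetric])
  moreover have "exp (b * \<bar>w\<bar>) \<le> 2 * cosh (b * w)"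
    by (cases "w \<ge> 0") (auto simp: cosh_field_def)
  ultimately have "damped_exp a b w \<le> exp (\<bar>a\<bar> * \<bar>w\<bar>) / exp (b * \<bar>w\<bar>)"
    unfolding damped_exp_def by (intro frac_le) auto
  then show ?thesis by (simp add: exp_diff[symmetric] algebra_simps)
qed

lemma damped_exp_le_1: assumes "\<bar>a\<bar> \<le> b" shows "damped_exp a b w \<le> 1"
proof -
  have "0 \<le> (b - \<bar>a\<bar>) * \<bar>w\<bar>" using assms by (intro mult_nonneg_nonneg) auto
  then have "exp (- (b - \<bar>a\<bar>) * \<bar>w\<bar>) \<le> 1"
    by (simp del: minus_diff_eq)
  then show ?thesis using damped_exp_le[of b a w] assms by linarith
qed

lemma damped_exp_derivative:
  "(damped_exp a b has_real_derivative - (a + b * tanh (b * w)) * damped_exp a b w) (at w)"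
  unfolding damped_exp_def
  by (rule derivative_eq_intros refl | simp)+ 
     (simp add: tanh_def cosh_real_nonzero field_simps power2_eq_square)

lemma exp_le_weight:
  fixes \<kappa> x :: real
  assumes "\<kappa> > 0" shows "exp (- \<kappa> * \<bar>x\<bar>) \<le> (1 + 2 / \<kappa>\<^sup>2) * inverse (1 + x\<^sup>2)"
proof -
  have "1 + \<kappa> * \<bar>x\<bar> + (\<kappa> * \<bar>x\<bar>)\<^sup>2 / 2 \<le> exp (\<kappa> * \<bar>x\<bar>)"
    using assms by (intro exp_lower_Taylor_quadratic mult_nonneg_nonneg) auto
  moreover have "0 \<le> \<kappa> * \<bar>x\<bar>" using assms by simp
  ultimately have e: "1 + \<kappa>\<^sup>2 * x\<^sup>2 / 2 \<le> exp (\<kappa> * \<bar>x\<bar>)"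
    unfolding power_mult_distrib power2_abs by linarith
  have "(1 + 2 / \<kappa>\<^sup>2) * (1 + \<kappa>\<^sup>2 * x\<^sup>2 / 2) = 1 + x\<^sup>2 + \<kappa>\<^sup>2 * x\<^sup>2 / 2 + 2 / \<kappa>\<^sup>2"
    using assms by (simp add: field_simps power2_eq_square)
  then have "1 + x\<^sup>2 \<le> (1 + 2 / \<kappa>\<^sup>2) * (1 + \<kappa>\<^sup>2 * x\<^sup>2 / 2)" by simp
  also have "\<dots> \<le> (1 + 2 / \<kappa>\<^sup>2) * exp (\<kappa> * \<bar>x\<bar>)"
    by (intro mult_left_mono e) simp
  finally show ?thesis by (simp add: exp_minus field_simps add_pos_nonneg)
qed

lemma tendsto_0_of_quadratic_decay:
  fixes f :: "real \<Rightarrow> complex"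
  assumes "\<And>x. cmod (f x) \<le> C * inverse (1 + x\<^sup>2)"
  shows "(f \<longlongrightarrow> 0) at_top" "(f \<longlongrightarrow> 0) at_bot"
proof -
  have t: "((\<lambda>x::real. C * inverse (1 + x\<^sup>2)) \<longlongrightarrow> 0) at_top" "((\<lambda>x::real. C * inverse (1 + x\<^sup>2)) \<longlongrightarrow> 0) at_bot"
    by real_asymp+
  show "(f \<longlongrightarrow> 0) at_top" by (rule Lim_null_comparison[OF _ t(1)]) (simp add: assms)
  show "(f \<longlongrightarrow> 0) at_bot" by (rule Lim_null_comparison[OF _ t(2)]) (simp add: assms)
qed

text \<open>The derivatives of the multiplier are bounded multiples of it, because the logarithmic
  derivative of each factor is \<open>- a - b tanh (b w)\<close>.  Two of them give the kernel its decay.\<close>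

lemma S_kernel_decay:
  fixes j :: int
  assumes s: "\<bar>s\<bar> < \<beta> - pi / 2" and y: "\<bar>y - s\<bar> < pi / 2"
  defines "m \<equiv> \<lambda>\<xi>. complex_of_real (S_multiplier \<beta> j y s \<xi>)"
  shows "integrable lborel m" "\<exists>A. decaying_kernel (inv_fourier m) A"
proof -
  \<comment> \<open>The tilts \<open>a1\<close>, \<open>a2\<close> are strictly smaller than the widths \<open>b1\<close>, \<open>\<pi>\<close> exactly because the point is in the domain.\<close>
  define a1 a2 b1 where "a1 = \<beta> - pi / 2 + s" and "a2 = pi / 2 - s + y" and "b1 = 2 * \<beta> - pi"
  have ab: "\<bar>a1\<bar> < b1" "\<bar>a2\<bar> < pi" 
    using s y unfolding a1_def a2_def b1_def abs_less_iff by linarith+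
  define M where "M \<xi> = damped_exp a1 b1 (\<xi> - of_int j / 2) * damped_exp a2 pi \<xi>" for \<xi>
  define t1 t2 where "t1 \<xi> = tanh (b1 * (\<xi> - of_int j / 2))" and "t2 \<xi> = tanh (pi * \<xi>)" for \<xi>
  define P where "P \<xi> = - (a1 + b1 * t1 \<xi>) - (a2 + pi * t2 \<xi>)" for \<xi>
  define P' where "P' \<xi> = - b1\<^sup>2 * (1 - (t1 \<xi>)\<^sup>2) - pi\<^sup>2 * (1 - (t2 \<xi>)\<^sup>2)" for \<xi>
  have m: "m = (\<lambda>\<xi>. of_real (M \<xi>))"
    by (simp add: m_def M_def S_multiplier_eq a1_def a2_def b1_def)
  have dM: "(M has_real_derivative P \<xi> * M \<xi>) (at \<xi>)" for \<xi>
  proof -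
    have "((\<lambda>\<xi>. damped_exp a1 b1 (\<xi> - of_int j / 2)) has_real_derivative
        (- (a1 + b1 * t1 \<xi>) * damped_exp a1 b1 (\<xi> - of_int j / 2)) * 1) (at \<xi>)"
      unfolding t1_def by (rule DERIV_chain2[OF damped_exp_derivative]) (auto intro!: derivative_eq_intros)
    then show ?thesis
      using damped_exp_derivative[of a2 pi \<xi>] unfolding M_def P_def t2_def
      by (auto intro!: derivative_eq_intros simp: algebra_simps)
  qed
  have dP: "(P has_real_derivative P' \<xi>) (at \<xi>)" for \<xi>
    unfolding P_def P'_def t1_def t2_def
    by (auto intro!: derivative_eq_intros simp: algebra_simps power2_eq_square cosh_real_nonzero)
  have dPM: "((\<lambda>\<xi>. P \<xi> * M \<xi>) has_real_derivative (P' \<xi> + (P \<xi>)\<^sup>2) * M \<xi>) (at \<xi>)" for \<xi>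
    using DERIV_mult[OF dP dM, of \<xi>] by (simp add: algebra_simps power2_eq_square)
  have t: "\<bar>t1 \<xi>\<bar> \<le> 1" "\<bar>t2 \<xi>\<bar> \<le> 1" for \<xi>
    unfolding t1_def t2_def by (simp_all add: abs_le_iff less_imp_le tanh_real_lt_1 tanh_real_gt_neg1 order_less_imp_le[of _ 1] minus_le_iff)
  define Q where "Q = 2 * b1 + 2 * pi"
  have P: "\<bar>P \<xi>\<bar> \<le> Q" for \<xi>
  proof -
    have "\<bar>b1 * t1 \<xi>\<bar> \<le> b1 * 1" "\<bar>pi * t2 \<xi>\<bar> \<le> pi * 1"
      unfolding abs_mult using t[of \<xi>] ab by (intro mult_mono; force)+
    then show ?thesis using ab unfolding P_def Q_def by linarith
  qed
  have P': "\<bar>P' \<xi> + (P \<xi>)\<^sup>2\<bar> \<le> b1\<^sup>2 + pi\<^sup>2 + Q\<^sup>2" for \<xi>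
  proof -
    have "(t1 \<xi>)\<^sup>2 \<le> 1" "(t2 \<xi>)\<^sup>2 \<le> 1" using t[of \<xi>] by (simp_all add: abs_square_le_1)
    then have "\<bar>b1\<^sup>2 * (1 - (t1 \<xi>)\<^sup>2)\<bar> \<le> b1\<^sup>2 * 1" "\<bar>pi\<^sup>2 * (1 - (t2 \<xi>)\<^sup>2)\<bar> \<le> pi\<^sup>2 * 1"
      unfolding abs_mult by (intro mult_mono; simp)+
    moreover have "(P \<xi>)\<^sup>2 \<le> Q\<^sup>2" using P[of \<xi>] by (simp add: abs_le_square_iff[symmetric])
    ultimately show ?thesis unfolding P'_def using zero_le_power2[of "P \<xi>"] by linarith
  qed
  define C where "C = 1 + 2 / (pi - \<bar>a2\<bar>)\<^sup>2"
  have M: "\<bar>M \<xi>\<bar> \<le> C * inverse (1 + \<xi>\<^sup>2)" for \<xi>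
  proof -
    have "\<bar>M \<xi>\<bar> \<le> 1 * exp (- (pi - \<bar>a2\<bar>) * \<bar>\<xi>\<bar>)"
      unfolding M_def abs_mult abs_of_pos[OF damped_exp_pos]
      using ab by (intro mult_mono damped_exp_le_1 damped_exp_le less_imp_le[OF damped_exp_pos]) auto
    also have "\<dots> \<le> C * inverse (1 + \<xi>\<^sup>2)"
      using exp_le_weight[of "pi - \<bar>a2\<bar>" \<xi>] ab by (simp add: C_def)
    finally show ?thesis .
  qed
  have QM: "\<bar>q * M \<xi>\<bar> \<le> (B * C) * inverse (1 + \<xi>\<^sup>2)" if "\<bar>q\<bar> \<le> B" for q B \<xi>
    unfolding abs_mult mult.assoc using M that by (intro mult_mono) auto
  have cont: "continuous_on UNIV M" "continuous_on UNIV P" "continuous_on UNIV P'"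
  proof -
    show "continuous_on UNIV M" using dM by (meson DERIV_isCont continuous_at_imp_continuous_on)
    show "continuous_on UNIV P" using dP by (meson DERIV_isCont continuous_at_imp_continuous_on)
    show "continuous_on UNIV P'" unfolding P'_def t1_def t2_def
      by (intro continuous_intros) (auto simp: cosh_real_nonzero)
  qed
  define m' m'' where "m' = (\<lambda>\<xi>. complex_of_real (P \<xi> * M \<xi>))" and "m'' = (\<lambda>\<xi>. complex_of_real ((P' \<xi> + (P \<xi>)\<^sup>2) * M \<xi>))"
  have d: "(m has_vector_derivative m' \<xi>) (at \<xi>)" "(m' has_vector_derivative m'' \<xi>) (at \<xi>)" for \<xi>
    unfolding m m'_def m''_def using dM dPM
    by (intro has_vector_derivative_of_real; simp only: has_real_derivative_iff_has_vector_derivative)+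
  have cm: "continuous_on UNIV m" "continuous_on UNIV m'" "continuous_on UNIV m''"
    unfolding m m'_def m''_def by (intro continuous_intros cont)+
  have dec: "cmod (m \<xi>) \<le> C * inverse (1 + \<xi>\<^sup>2)" "cmod (m' \<xi>) \<le> (Q * C) * inverse (1 + \<xi>\<^sup>2)"
    "cmod (m'' \<xi>) \<le> ((b1\<^sup>2 + pi\<^sup>2 + Q\<^sup>2) * C) * inverse (1 + \<xi>\<^sup>2)" for \<xi>
    unfolding m m'_def m''_def norm_of_real by (rule M QM[OF P] QM[OF P'])+
  have int: "integrable lborel m" "integrable lborel m'" "integrable lborel m''"
    by (rule integrable_of_quadratic_decay[OF borel_measurable_continuous_onI[OF cm(1)] dec(1)]
             integrable_of_quadratic_decay[OF borel_measurable_continuous_onI[OF cm(2)] dec(2)]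
             integrable_of_quadratic_decay[OF borel_measurable_continuous_onI[OF cm(3)] dec(3)])+
  show "integrable lborel m" by fact
  obtain K where K: "\<And>\<xi>. cmod (fourier m \<xi>) \<le> K * inverse (1 + \<xi>\<^sup>2)"
    using fourier_quadratic_decay[OF d cm(3) int tendsto_0_of_quadratic_decay[OF dec(1)] tendsto_0_of_quadratic_decay[OF dec(2)]]
    by blast
  have "decaying_kernel (inv_fourier m) (K / (2 * pi))"
  proof
    show "continuous_on UNIV (inv_fourier m)" by (rule continuous_inv_fourier[OF int(1)])
    show "cmod (inv_fourier m x) \<le> K / (2 * pi) * inverse (1 + x\<^sup>2)" for x
      using K[of "- x"] by (simp add: inv_fourier_conv_fourier norm_divide norm_mult divide_right_mono)
  qed
  then show "\<exists>A. decaying_kernel (inv_fourier m) A" by blast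
qed

definition S_kernel :: "real \<Rightarrow> int \<Rightarrow> real \<Rightarrow> real \<Rightarrow> real \<Rightarrow> complex" where
  "S_kernel \<beta> j y s = inv_fourier (\<lambda>\<xi>. of_real (S_multiplier \<beta> j y s \<xi>))"

text \<open>The branch of the argument is irrelevant since \<open>j\<close> is an integer.\<close>

lemma exp_Arg_eq:
  fixes j :: int and \<theta> r :: real
  assumes "z = of_real r * exp (2 * of_real pi * \<i> * of_real \<theta>)" "r > 0"
  shows "exp (2 * of_real pi * \<i> * of_int j * of_real (Arg z / (2 * pi))) = exp (2 * of_real pi * \<i> * of_int j * of_real \<theta>)"
proof -
  have z: "z \<noteq> 0" using assms by simp
  have "z = of_real (cmod z) * cis (Arg z)" using Arg_eq[OF z] by (simp add: cis_conv_exp)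
  moreover have "cmod z = r" using assms by (simp add: norm_mult)
  moreover have "z = of_real r * cis (2 * pi * \<theta>)" using assms by (simp add: cis_conv_exp mult_ac)
  ultimately have "cis (Arg z) = cis (2 * pi * \<theta>)"
    using \<open>r > 0\<close> by (metis mult_cancel_left of_real_eq_0_iff less_irrefl)
  then have "cis (of_int j * Arg z) = cis (of_int j * (2 * pi * \<theta>))"
    by (metis cis_power_int)
  then show ?thesis by (simp add: cis_conv_exp mult_ac)
qed

lemma S_term_eq:
  fixes \<theta> x :: real
  assumes s: "\<bar>s\<bar> < \<beta> - pi / 2" and y: "\<bar>y - s\<bar> < pi / 2" and f: "weighted_integrable (fourier_coeff \<phi>1 j)"
  shows "S_term \<beta> \<phi>1 j (Complex x y, of_real (exp (s / 2)) * exp (2 * of_real pi * \<i> * of_real \<theta>)) =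
     exp (2 * of_real pi * \<i> * of_int j * of_real \<theta>) * convolve (fourier_coeff \<phi>1 j) (S_kernel \<beta> j y s) x"
proof -
  let ?z = "of_real (exp (s / 2)) * exp (2 * of_real pi * \<i> * of_real \<theta>)"
  have "(cmod ?z)\<^sup>2 = exp s" by (simp add: norm_mult exp_double[symmetric])
  then have "ln ((cmod ?z)\<^sup>2) = s" by simp
  moreover obtain A where "decaying_kernel (S_kernel \<beta> j y s) A"
    using S_kernel_decay(2)[OF s y, of j] unfolding S_kernel_def by blast
  ultimately show ?thesis
    using exp_Arg_eq[OF refl, where r="exp (s / 2)" and \<theta>=\<theta> and j=j]
      multiplier_distribution_eq_convolution[OF S_kernel_decay(1)[OF s y] _ f, of j A]
    by (simp add: S_term_def Let_def S_kernel_def)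
qed

section \<open>Density of the test functions\<close>

definition torus_exp :: "int \<Rightarrow> real \<Rightarrow> complex" where
  "torus_exp j \<theta> = exp (2 * of_real pi * \<i> * of_int j * of_real \<theta>)"

lemma norm_torus_exp [simp]: "cmod (torus_exp j \<theta>) = 1"
  by (simp add: torus_exp_def)

lemma torus_exp_add: "torus_exp (i + j) \<theta> = torus_exp i \<theta> * torus_exp j \<theta>"
  by (simp add: torus_exp_def algebra_simps exp_add)

lemma torus_exp_0 [simp]: "torus_exp 0 \<theta> = 1"
  by (simp add: torus_exp_def)

lemma torus_exp_measurable [measurable]: "torus_exp j \<in> borel_measurable borel"
  unfolding torus_exp_def by measurable

lemma continuous_torus_exp: "continuous_on A (torus_exp j)"
  unfolding torus_exp_def by (intro continuous_intros)

lemma torus_exp_scale: "torus_exp j (of_int n * \<theta>) = torus_exp (n * j) \<theta>"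
  by (simp add: torus_exp_def mult_ac)

text \<open>The \<open>p\<close>-th power of the norm.  The inequality \<open>\<bar>a + b\<bar>\<^sup>p \<le> 2\<^sup>p (\<bar>a\<bar>\<^sup>p + \<bar>b\<bar>\<^sup>p)\<close> takes
  the place of Minkowski's inequality throughout.\<close>

definition Lp_mass :: "real \<Rightarrow> (real \<times> real \<Rightarrow> complex) \<Rightarrow> ennreal" where
  "Lp_mass p f = (\<integral>\<^sup>+w. ennreal (cmod (f w) powr p) \<partial>cylinder)"

lemma space_cylinder: "space cylinder = UNIV \<times> {0..<1}"
  by (simp add: cylinder_def space_restrict_space)

lemma strip_borel [measurable]: "UNIV \<times> {0..<1::real} \<in> sets (borel :: (real \<times> real) measure)"
  by (simp add: borel_prod[symmetric])

lemma borel_imp_cylinder: "f \<in> borel_measurable borel \<Longrightarrow> f \<in> borel_measurable cylinder"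
  unfolding cylinder_def by (intro measurable_restrict_space1) simp

lemma cylinder_measurable_iff:
  fixes f :: "real \<times> real \<Rightarrow> complex"
  shows "f \<in> borel_measurable cylinder \<longleftrightarrow> (\<lambda>w. indicator (UNIV \<times> {0..<1}) w *\<^sub>R f w) \<in> borel_measurable borel"
  unfolding cylinder_def by (subst borel_measurable_restrict_space_iff) auto

lemma nn_integral_cylinder: "(\<integral>\<^sup>+w. f w \<partial>cylinder) = (\<integral>\<^sup>+w. f w * indicator (UNIV \<times> {0..<1}) w \<partial>lborel)"
  unfolding cylinder_def by (rule nn_integral_restrict_space) simp

lemma nn_integral_cylinder_iterated:
  fixes f :: "real \<times> real \<Rightarrow> ennreal"
  assumes "f \<in> borel_measurable cylinder"
  shows "(\<integral>\<^sup>+w. f w \<partial>cylinder) = (\<integral>\<^sup>+x. \<integral>\<^sup>+\<theta>. f (x, \<theta>) * indicator {0..<1} \<theta> \<partial>lborel \<partial>lborel)"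
proof -
  have [measurable]: "(\<lambda>w. f w * indicator (UNIV \<times> {0..<1}) w) \<in> borel_measurable borel"
    using assms unfolding cylinder_def by (subst (asm) borel_measurable_restrict_space_iff_ennreal) auto
  have "(\<integral>\<^sup>+w. f w * indicator (UNIV \<times> {0..<1}) w \<partial>lborel) =
      (\<integral>\<^sup>+x. \<integral>\<^sup>+\<theta>. f (x, \<theta>) * indicator (UNIV \<times> {0..<1}) (x, \<theta>) \<partial>lborel \<partial>lborel)"
    unfolding lborel_prod[symmetric] by (subst lborel.nn_integral_fst[symmetric]) (auto simp: lborel_prod)
  then show ?thesis by (simp add: nn_integral_cylinder indicator_def)
qed

lemma cmod_add_powr_le:
  assumes "p > 0" shows "cmod (a + b) powr p \<le> 2 powr p * (cmod a powr p + cmod b powr p)"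
proof -
  have "cmod (a + b) \<le> 2 * max (cmod a) (cmod b)"
    using norm_triangle_ineq[of a b] by linarith
  then have "cmod (a + b) powr p \<le> (2 * max (cmod a) (cmod b)) powr p"
    using assms by (intro powr_mono2) auto
  also have "\<dots> = 2 powr p * (max (cmod a) (cmod b)) powr p" by (simp add: powr_mult)
  also have "(max (cmod a) (cmod b)) powr p \<le> cmod a powr p + cmod b powr p"
    by (simp add: max_def)
  finally show ?thesis by simp
qed

lemma Lp_mass_add:
  assumes "p > 0" and [measurable]: "f \<in> borel_measurable cylinder" "g \<in> borel_measurable cylinder"
  shows "Lp_mass p (\<lambda>w. f w + g w) \<le> ennreal (2 powr p) * (Lp_mass p f + Lp_mass p g)"
proof -
  have "Lp_mass p (\<lambda>w. f w + g w) \<le> (\<integral>\<^sup>+w. ennreal (2 powr p) * (ennreal (cmod (f w) powr p) + ennreal (cmod (g w) powr p)) \<partial>cylinder)"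
    unfolding Lp_mass_def
    by (intro nn_integral_mono)
       (simp add: ennreal_mult[symmetric] cmod_add_powr_le[OF assms(1)] flip: ennreal_plus)
  also have "\<dots> = ennreal (2 powr p) * (Lp_mass p f + Lp_mass p g)"
    unfolding Lp_mass_def by (subst nn_integral_cmult, measurable) (subst nn_integral_add, auto)
  finally show ?thesis .
qed

lemma Lp_mass_cmult:
  assumes [measurable]: "f \<in> borel_measurable cylinder"
  shows "Lp_mass p (\<lambda>w. c * f w) = ennreal (cmod c powr p) * Lp_mass p f"
  unfolding Lp_mass_def
  by (subst nn_integral_cmult[symmetric]) (auto simp: norm_mult powr_mult ennreal_mult)

lemma Lp_mass_mono:
  assumes "p > 0" "\<And>w. w \<in> space cylinder \<Longrightarrow> cmod (f w) \<le> cmod (g w)"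
  shows "Lp_mass p f \<le> Lp_mass p g"
  unfolding Lp_mass_def using assms by (intro nn_integral_mono ennreal_leI powr_mono2) auto

lemma Lp_mass_minus: "Lp_mass p (\<lambda>w. - f w) = Lp_mass p f"
  by (simp add: Lp_mass_def)

lemma Lp_mass_diff:
  assumes "p > 0" and "f \<in> borel_measurable cylinder" "g \<in> borel_measurable cylinder"
  shows "Lp_mass p (\<lambda>w. f w - g w) \<le> ennreal (2 powr p) * (Lp_mass p f + Lp_mass p g)"
  using Lp_mass_add[of p f "\<lambda>w. - g w"] assms by (simp add: Lp_mass_minus)

lemma Lp_mass_dominated:
  assumes p: "p > 0" and f [measurable]: "\<And>n. F n \<in> borel_measurable cylinder" "f \<in> borel_measurable cylinder"
    and d [measurable]: "d \<in> borel_measurable cylinder" "Lp_mass p d < \<infinity>"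
    and bound: "\<And>n w. w \<in> space cylinder \<Longrightarrow> cmod (F n w) \<le> cmod (d w)"
    and lim: "AE w in cylinder. (\<lambda>n. F n w) \<longlonglongrightarrow> f w"
  shows "(\<lambda>n. Lp_mass p (\<lambda>w. f w - F n w)) \<longlonglongrightarrow> 0"
proof -
  have "(\<lambda>n. \<integral>\<^sup>+w. ennreal (cmod (f w - F n w) powr p) \<partial>cylinder) \<longlonglongrightarrow> (\<integral>\<^sup>+w. 0 \<partial>cylinder)"
  proof (rule nn_integral_dominated_convergence[where w="\<lambda>w. ennreal (2 powr p) * ennreal (cmod (d w) powr p)"])
    show "AE w in cylinder. (\<lambda>n. ennreal (cmod (f w - F n w) powr p)) \<longlonglongrightarrow> 0"
      using lim
    proof eventually_elim
      case (elim w)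
      have "(\<lambda>n. cmod (f w - F n w)) \<longlonglongrightarrow> cmod (f w - f w)" by (intro tendsto_intros elim)
      then have "(\<lambda>n. cmod (f w - F n w) powr p) \<longlonglongrightarrow> 0 powr p"
        using p by (intro tendsto_powr2 tendsto_const) auto
      then have "(\<lambda>n. ennreal (cmod (f w - F n w) powr p)) \<longlonglongrightarrow> ennreal 0"
        by (intro tendsto_ennrealI) simp
      then show ?case by simp
    qed
    have "AE w in cylinder. ennreal (cmod (f w - F j w) powr p) \<le> ennreal (2 powr p) * ennreal (cmod (d w) powr p)" for j
      using lim AE_space
    proof eventually_elim
      case (elim w)
      have "cmod (f w) \<le> cmod (d w)"
        by (rule LIMSEQ_le_const2[OF tendsto_norm[OF elim(1)]]) (use bound elim in auto)
      then have "cmod (f w - F j w) \<le> 2 * cmod (d w)"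
        using bound[OF elim(2), of j] norm_triangle_ineq4[of "f w" "F j w"] by linarith
      then have "cmod (f w - F j w) powr p \<le> (2 * cmod (d w)) powr p"
        using p by (intro powr_mono2) auto
      then show ?case by (simp add: powr_mult ennreal_mult[symmetric] ennreal_leI)
    qed
    then show "\<And>j. AE w in cylinder. ennreal (cmod (f w - F j w) powr p) \<le> ennreal (2 powr p) * ennreal (cmod (d w) powr p)" .
    show "(\<integral>\<^sup>+w. ennreal (2 powr p) * ennreal (cmod (d w) powr p) \<partial>cylinder) < \<infinity>"
      using d(2) unfolding Lp_mass_def by (subst nn_integral_cmult) (auto simp: ennreal_mult_less_top)
  qed auto
  then show ?thesis by (simp add: Lp_mass_def)
qed

lemma test_fun_add: assumes "test_fun f" "test_fun g" shows "test_fun (\<lambda>w. f w + g w)"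
proof -
  obtain N c where f: "\<forall>j. Cc_infinity (c j)"
     "\<And>x \<gamma>. f (x, \<gamma>) = (\<Sum>j | \<bar>j\<bar> < int N. c j x * torus_exp j \<gamma>)"
    using assms(1) unfolding test_fun_def torus_exp_def by blast
  obtain M d where g: "\<forall>j. Cc_infinity (d j)"
     "\<And>x \<gamma>. g (x, \<gamma>) = (\<Sum>j | \<bar>j\<bar> < int M. d j x * torus_exp j \<gamma>)"
    using assms(2) unfolding test_fun_def torus_exp_def by blast
  define e where "e j = (\<lambda>x. (if \<bar>j\<bar> < int N then c j else (\<lambda>x. 0)) x + (if \<bar>j\<bar> < int M then d j else (\<lambda>x. 0)) x)" for j
  have fin: "finite {j::int. \<bar>j\<bar> < int K}" for K
    by (rule finite_subset[of _ "{- int K..int K}"]) auto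
  have ext: "(\<Sum>j | \<bar>j\<bar> < int K. h j * torus_exp j \<gamma>) =
        (\<Sum>j | \<bar>j\<bar> < int (max N M). (if \<bar>j\<bar> < int K then h j else 0) * torus_exp j \<gamma>)"
    if "K \<le> max N M" for h :: "int \<Rightarrow> complex" and K \<gamma>
    using that by (intro sum.mono_neutral_cong_left fin) auto
  have "f (x, \<gamma>) + g (x, \<gamma>) = (\<Sum>j | \<bar>j\<bar> < int (max N M). e j x * torus_exp j \<gamma>)" for x \<gamma>
    unfolding f g e_def
    by (subst ext[of N], simp, subst ext[of M], simp)
       (auto simp: sum.distrib[symmetric] distrib_right intro!: sum.cong)
  moreover have "Cc_infinity (e j)" for j
    unfolding e_def using f(1) g(1) by (intro Cc_infinity_add) (auto intro: Cc_infinity_0)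
  ultimately show ?thesis unfolding test_fun_def torus_exp_def by blast
qed

lemma test_fun_cmult: assumes "test_fun f" shows "test_fun (\<lambda>w. a * f w)"
proof -
  obtain N c where f: "\<forall>j. Cc_infinity (c j)"
     "\<And>x \<gamma>. f (x, \<gamma>) = (\<Sum>j | \<bar>j\<bar> < int N. c j x * torus_exp j \<gamma>)"
    using assms(1) unfolding test_fun_def torus_exp_def by blast
  have "a * f (x, \<gamma>) = (\<Sum>j | \<bar>j\<bar> < int N. (\<lambda>x. a * c j x) x * torus_exp j \<gamma>)" for x \<gamma>
    unfolding f by (simp add: sum_distrib_left mult_ac)
  moreover have "Cc_infinity (\<lambda>x. a * c j x)" for j using f(1) by (simp add: Cc_infinity_cmult)
  ultimately show ?thesis unfolding test_fun_def torus_exp_def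
    by (intro exI[of _ N] exI[of _ "\<lambda>j x. a * c j x"]) auto
qed

lemma test_fun_mode: assumes "Cc_infinity c" shows "test_fun (\<lambda>(x, \<theta>). c x * torus_exp j \<theta>)"
proof -
  define d where "d i = (if i = j then c else (\<lambda>x. 0))" for i
  have "c x * torus_exp j \<theta> = (\<Sum>i | \<bar>i\<bar> < int (nat \<bar>j\<bar> + 1). d i x * torus_exp i \<theta>)" for x \<theta>
  proof -
    have "finite {i::int. \<bar>i\<bar> < int (nat \<bar>j\<bar> + 1)}"
      by (rule finite_subset[of _ "{- \<bar>j\<bar> - 1..\<bar>j\<bar> + 1}"]) auto
    moreover have "(\<Sum>i | \<bar>i\<bar> < int (nat \<bar>j\<bar> + 1). d i x * torus_exp i \<theta>) =
        (\<Sum>i | \<bar>i\<bar> < int (nat \<bar>j\<bar> + 1). if i = j then c x * torus_exp j \<theta> else 0)"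
      by (intro sum.cong refl) (auto simp: d_def)
    ultimately show ?thesis by (simp add: sum.delta)
  qed
  moreover have "Cc_infinity (d i)" for i using assms by (simp add: d_def Cc_infinity_0)
  ultimately show ?thesis unfolding test_fun_def torus_exp_def
    by (intro exI[of _ "nat \<bar>j\<bar> + 1"] exI[of _ d]) auto
qed

lemma test_fun_continuous: assumes "test_fun f" shows "continuous_on UNIV f"
proof -
  obtain N c where c: "\<forall>j. Cc_infinity (c j)"
     and f: "\<And>x \<gamma>. f (x, \<gamma>) = (\<Sum>j | \<bar>j\<bar> < int N. c j x * torus_exp j \<gamma>)"
    using assms(1) unfolding test_fun_def torus_exp_def by blast
  have "f = (\<lambda>w. \<Sum>j | \<bar>j\<bar> < int N. c j (fst w) * torus_exp j (snd w))"
    using f by auto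
  moreover have "continuous_on UNIV (\<lambda>w. \<Sum>j | \<bar>j\<bar> < int N. c j (fst w) * torus_exp j (snd w))"
    using c by (intro continuous_intros continuous_on_compose2[OF Cc_infinity_imp_cont]
        continuous_on_compose2[OF continuous_torus_exp[of UNIV]]) auto
  ultimately show ?thesis by simp
qed

lemma test_fun_measurable: "test_fun f \<Longrightarrow> f \<in> borel_measurable cylinder"
  by (intro borel_imp_cylinder borel_measurable_continuous_onI test_fun_continuous)

text \<open>The closure of the test functions in \<open>L\<^sup>p\<close>.  It is a linear space that is closed under dominated limits,
  so it contains all functions that are obtained from indicators of rectangles by such limits.\<close>

definition approximable :: "real \<Rightarrow> (real \<times> real \<Rightarrow> complex) \<Rightarrow> bool" where
  "approximable p f \<longleftrightarrow> f \<in> borel_measurable cylinder \<and>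
     (\<forall>e>0. \<exists>\<psi>. test_fun \<psi> \<and> Lp_mass p (\<lambda>w. f w - \<psi> w) \<le> ennreal e)"

lemma approximable_measurable: "approximable p f \<Longrightarrow> f \<in> borel_measurable cylinder"
  by (simp add: approximable_def)

lemma approximable_test_fun: "test_fun f \<Longrightarrow> approximable p f"
  unfolding approximable_def by (auto intro!: exI[of _ f] test_fun_measurable simp: Lp_mass_def)

lemma approximable_closed:
  assumes p: "p > 0" and f [measurable]: "f \<in> borel_measurable cylinder"
    and *: "\<And>e. e > 0 \<Longrightarrow> \<exists>g. approximable p g \<and> Lp_mass p (\<lambda>w. f w - g w) \<le> ennreal e"
  shows "approximable p f"
  unfolding approximable_def
proof (intro conjI allI impI f)
  fix e :: real assume e: "e > 0"
  define e' where "e' = e / (2 * 2 powr p)"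
  have e': "e' > 0" using e by (simp add: e'_def)
  obtain g where g: "approximable p g" "Lp_mass p (\<lambda>w. f w - g w) \<le> ennreal e'" using *[OF e'] by blast
  obtain \<psi> where \<psi>: "test_fun \<psi>" "Lp_mass p (\<lambda>w. g w - \<psi> w) \<le> ennreal e'"
    using g(1) e' unfolding approximable_def by blast
  have [measurable]: "g \<in> borel_measurable cylinder" "\<psi> \<in> borel_measurable cylinder"
    using g(1) \<psi>(1) by (auto intro: approximable_measurable test_fun_measurable)
  have "Lp_mass p (\<lambda>w. f w - \<psi> w) \<le> ennreal (2 powr p) * (Lp_mass p (\<lambda>w. f w - g w) + Lp_mass p (\<lambda>w. g w - \<psi> w))"
    using Lp_mass_add[OF p, of "\<lambda>w. f w - g w" "\<lambda>w. g w - \<psi> w"] by simp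
  also have "\<dots> \<le> ennreal (2 powr p) * (ennreal e' + ennreal e')"
    by (intro mult_left_mono add_mono g \<psi>) auto
  also have "\<dots> = ennreal e"
    using e' e by (simp add: e'_def ennreal_mult[symmetric] flip: ennreal_plus)
  finally show "\<exists>\<psi>. test_fun \<psi> \<and> Lp_mass p (\<lambda>w. f w - \<psi> w) \<le> ennreal e" using \<psi>(1) by blast
qed

lemma approximable_add:
  assumes p: "p > 0" and f: "approximable p f" and g: "approximable p g"
  shows "approximable p (\<lambda>w. f w + g w)"
  unfolding approximable_def
proof (intro conjI allI impI)
  have [measurable]: "f \<in> borel_measurable cylinder" "g \<in> borel_measurable cylinder"
    using f g by (auto intro: approximable_measurable)
  show "(\<lambda>w. f w + g w) \<in> borel_measurable cylinder" by measurable
  fix e :: real assume e: "e > 0"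
  define e' where "e' = e / (2 * 2 powr p)"
  have e': "e' > 0" using e by (simp add: e'_def)
  obtain \<psi> where \<psi>: "test_fun \<psi>" "Lp_mass p (\<lambda>w. f w - \<psi> w) \<le> ennreal e'"
    using f e' unfolding approximable_def by blast
  obtain \<psi>' where \<psi>': "test_fun \<psi>'" "Lp_mass p (\<lambda>w. g w - \<psi>' w) \<le> ennreal e'"
    using g e' unfolding approximable_def by blast
  have [measurable]: "\<psi>' \<in> borel_measurable cylinder" "\<psi> \<in> borel_measurable cylinder"
    using \<psi>'(1) \<psi>(1) by (auto intro: test_fun_measurable)
  have "Lp_mass p (\<lambda>w. (f w + g w) - (\<psi> w + \<psi>' w)) \<le> ennreal (2 powr p) * (Lp_mass p (\<lambda>w. f w - \<psi> w) + Lp_mass p (\<lambda>w. g w - \<psi>' w))"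
    using Lp_mass_add[OF p, of "\<lambda>w. f w - \<psi> w" "\<lambda>w. g w - \<psi>' w"] by (simp add: algebra_simps)
  also have "\<dots> \<le> ennreal (2 powr p) * (ennreal e' + ennreal e')"
    by (intro mult_left_mono add_mono \<psi>' \<psi>) auto
  also have "\<dots> = ennreal e"
    using e' e by (simp add: e'_def ennreal_mult[symmetric] flip: ennreal_plus)
  finally show "\<exists>\<psi>. test_fun \<psi> \<and> Lp_mass p (\<lambda>w. (f w + g w) - \<psi> w) \<le> ennreal e"
    using test_fun_add[OF \<psi>(1) \<psi>'(1)] by blast
qed

lemma approximable_cmult:
  assumes p: "p > 0" and f: "approximable p f" shows "approximable p (\<lambda>w. a * f w)"
  unfolding approximable_def
proof (intro conjI allI impI)
  have [measurable]: "f \<in> borel_measurable cylinder"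
    using f by (auto intro: approximable_measurable)
  show "(\<lambda>w. a * f w) \<in> borel_measurable cylinder" by measurable
  fix e :: real assume e: "e > 0"
  define e' where "e' = e / (cmod a powr p + 1)"
  have pos: "cmod a powr p + 1 > 0" by (simp add: add_nonneg_pos)
  have e': "e' > 0" using e pos by (simp add: e'_def)
  obtain \<psi> where \<psi>: "test_fun \<psi>" "Lp_mass p (\<lambda>w. f w - \<psi> w) \<le> ennreal e'"
    using f e' unfolding approximable_def by blast
  have [measurable]: "\<psi> \<in> borel_measurable cylinder" using \<psi>(1) by (rule test_fun_measurable)
  have "Lp_mass p (\<lambda>w. a * f w - a * \<psi> w) = ennreal (cmod a powr p) * Lp_mass p (\<lambda>w. f w - \<psi> w)"
    using Lp_mass_cmult[of "\<lambda>w. f w - \<psi> w" p a] by (simp add: algebra_simps)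
  also have "\<dots> \<le> ennreal (cmod a powr p) * ennreal e'" by (intro mult_left_mono \<psi>) auto
  also have "\<dots> \<le> ennreal e"
    using e pos by (simp add: ennreal_mult[symmetric] e'_def field_simps ennreal_leI)
  finally show "\<exists>\<psi>. test_fun \<psi> \<and> Lp_mass p (\<lambda>w. a * f w - \<psi> w) \<le> ennreal e"
    using test_fun_cmult[OF \<psi>(1)] by blast
qed

lemma approximable_dominated:
  assumes p: "p > 0" and F: "\<And>n. approximable p (F n)" and f: "f \<in> borel_measurable cylinder"
    and d: "d \<in> borel_measurable cylinder" "Lp_mass p d < \<infinity>"
    and bound: "\<And>n w. w \<in> space cylinder \<Longrightarrow> cmod (F n w) \<le> cmod (d w)"
    and lim: "AE w in cylinder. (\<lambda>n. F n w) \<longlonglongrightarrow> f w"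
  shows "approximable p f"
proof (rule approximable_closed[OF p f])
  fix e :: real assume "e > 0"
  have "(\<lambda>n. Lp_mass p (\<lambda>w. f w - F n w)) \<longlonglongrightarrow> 0"
    by (rule Lp_mass_dominated[OF p approximable_measurable[OF F] f d bound lim])
  then have "eventually (\<lambda>n. Lp_mass p (\<lambda>w. f w - F n w) < ennreal e) sequentially"
    using \<open>e > 0\<close> by (intro order_tendstoD) auto
  then show "\<exists>g. approximable p g \<and> Lp_mass p (\<lambda>w. f w - g w) \<le> ennreal e"
    using F by (meson eventually_sequentially order_less_imp_le order_refl)
qed

lemma Lp_mass_box_finite:
  assumes "p > 0" shows "Lp_mass p (\<lambda>w. of_real (C * indicator ({a..b} \<times> UNIV) w)) < \<infinity>"
proof -
  have "Lp_mass p (\<lambda>w. of_real (C * indicator ({a..b} \<times> UNIV) w)) =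
     (\<integral>\<^sup>+w. ennreal (\<bar>C\<bar> powr p) * indicator ({a..b} \<times> {0..<1::real}) w \<partial>lborel)"
    unfolding Lp_mass_def nn_integral_cylinder
    by (intro nn_integral_cong) (auto simp: indicator_def)
  also have "\<dots> = ennreal (\<bar>C\<bar> powr p) * emeasure lborel ({a..b} \<times> {0..<1::real})"
    by (subst nn_integral_cmult_indicator) (auto simp: borel_prod[symmetric])
  also have "emeasure lborel ({a..b} \<times> {0..<1::real}) = emeasure lborel {a..b} * emeasure lborel {0..<1::real}"
    unfolding lborel_prod[symmetric] by (rule lborel.emeasure_pair_measure_Times) auto
  finally show ?thesis
    by (simp only:) (simp add: ennreal_mult_less_top emeasure_lborel_Icc_eq)
qed

inductive_set trig_polynomials :: "(real \<Rightarrow> complex) set" where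
  mode: "torus_exp j \<in> trig_polynomials"
| add: "q \<in> trig_polynomials \<Longrightarrow> r \<in> trig_polynomials \<Longrightarrow> (\<lambda>\<theta>. q \<theta> + r \<theta>) \<in> trig_polynomials"
| cmult: "q \<in> trig_polynomials \<Longrightarrow> (\<lambda>\<theta>. a * q \<theta>) \<in> trig_polynomials"

lemma trig_polynomials_mult:
  assumes "q \<in> trig_polynomials" "r \<in> trig_polynomials"
  shows "(\<lambda>\<theta>. q \<theta> * r \<theta>) \<in> trig_polynomials"
  using assms(1)
proof induction
  case (mode i)
  show ?case using assms(2)
  proof induction
    case (mode j)
    have "torus_exp (i + j) \<in> trig_polynomials" by (rule trig_polynomials.mode)
    then show ?case by (simp add: torus_exp_add[abs_def])
  next
    case (add q r)
    then show ?case using trig_polynomials.add[OF add.IH] by (simp add: distrib_left)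
  next
    case (cmult q a)
    then show ?case using trig_polynomials.cmult[OF cmult.IH, of a] by (simp add: mult_ac)
  qed
next
  case (add q r)
  then show ?case using trig_polynomials.add[OF add.IH] by (simp add: distrib_right)
next
  case (cmult q a)
  then show ?case using trig_polynomials.cmult[OF cmult.IH, of a] by (simp add: mult_ac)
qed

lemma trig_polynomials_const: "(\<lambda>\<theta>. a) \<in> trig_polynomials"
proof -
  have "(\<lambda>\<theta>. a * torus_exp 0 \<theta>) \<in> trig_polynomials"
    by (rule trig_polynomials.cmult[OF trig_polynomials.mode])
  then show ?thesis by simp
qed

lemma test_fun_tensor:
  assumes "q \<in> trig_polynomials" "Cc_infinity c" shows "test_fun (\<lambda>(x, \<theta>). c x * q \<theta>)"
  using assms(1)
proof induction
  case (mode j) then show ?case by (rule test_fun_mode[OF assms(2)])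
next
  case (add q r) then show ?case
    using test_fun_add[OF add.IH] by (simp add: case_prod_unfold distrib_left)
next
  case (cmult q a) then show ?case
    using test_fun_cmult[OF cmult.IH, of a] by (simp add: case_prod_unfold mult_ac)
qed

text \<open>A polynomial in the real coordinates of the plane restricts to a trigonometric polynomial on
  the circle, so the Stone--Weierstrass theorem applies.\<close>

lemma polynomial_on_circle:
  assumes "real_polynomial_function (h :: complex \<Rightarrow> real)"
  shows "(\<lambda>\<theta>. complex_of_real (h (torus_exp 1 \<theta>))) \<in> trig_polynomials"
  using assms
proof induction
  case (linear f)
  have f: "f z = (f 1 - \<i> * f \<i>) / 2 * z + (f 1 + \<i> * f \<i>) / 2 * cnj z" for z
  proof -
    have "z = Re z *\<^sub>R 1 + Im z *\<^sub>R \<i>" by (simp add: complex_eq_iff)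
    then have "f z = f (Re z *\<^sub>R 1 + Im z *\<^sub>R \<i>)" by (rule arg_cong)
    also have "\<dots> = Re z * f 1 + Im z * f \<i>"
      using bounded_linear.linear[OF linear] by (simp only: linear_add linear_scale real_scaleR_def)
    finally have "f z = Re z * f 1 + Im z * f \<i>" .
    then show ?thesis by (simp add: complex_eq_iff field_simps)
  qed
  have cnj: "cnj (torus_exp 1 \<theta>) = torus_exp (- 1) \<theta>" for \<theta>
    by (simp add: torus_exp_def exp_cnj)
  have "(\<lambda>\<theta>. (f 1 - \<i> * f \<i>) / 2 * torus_exp 1 \<theta> + (f 1 + \<i> * f \<i>) / 2 * torus_exp (- 1) \<theta>) \<in> trig_polynomials"
    by (intro trig_polynomials.intros)
  then show ?case by (subst f) (simp only: cnj)
next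
  case (const c) then show ?case by (rule trig_polynomials_const)
next
  case (add f g) then show ?case using trig_polynomials.add[OF add.IH] by simp
next
  case (mult f g) then show ?case using trig_polynomials_mult[OF mult.IH] by simp
qed

lemma bump_abs_le: "\<bar>bump n a b x\<bar> \<le> indicator ({a..b} \<times> (UNIV::real set)) (x, \<theta>)"
proof -
  have "\<bar>bump n a b x\<bar> \<le> indicator {a<..<b} x" using bump_bounds[of n a b x] by simp
  also have "\<dots> \<le> indicator ({a..b} \<times> (UNIV::real set)) (x, \<theta>)" by (auto simp: indicator_def)
  finally show ?thesis .
qed

lemma approximable_circle_function:
  assumes p: "p > 0" and h: "continuous_on UNIV (h :: complex \<Rightarrow> real)"
  shows "approximable p (\<lambda>(x, \<theta>). of_real (bump n a b x * h (torus_exp 1 \<theta>)))"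
proof -
  have "\<exists>q. real_polynomial_function q \<and> (\<forall>z\<in>sphere 0 1. \<bar>h z - q z\<bar> < inverse (real (Suc k)))" for k
  proof -
    have c: "compact (sphere (0::complex) 1)" "continuous_on (sphere 0 1) h"
      using continuous_on_subset[OF h] by auto
    obtain q where "real_polynomial_function q" "\<And>z. z \<in> sphere 0 1 \<Longrightarrow> \<bar>h z - q z\<bar> < inverse (real (Suc k))"
      by (rule Stone_Weierstrass_real_polynomial_function[OF c, of "inverse (real (Suc k))"]) auto
    then show ?thesis by blast
  qed
  then obtain q where q: "\<And>k. real_polynomial_function (q k)"
      "\<And>k z. z \<in> sphere 0 1 \<Longrightarrow> \<bar>h z - q k z\<bar> < inverse (real (Suc k))"
    by metis
  have on_circle: "torus_exp 1 \<theta> \<in> sphere 0 1" for \<theta> by simp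
  obtain H where H: "\<And>z. z \<in> sphere 0 1 \<Longrightarrow> \<bar>h z\<bar> \<le> H"
  proof -
    have "compact (h ` sphere 0 1)"
      by (intro compact_continuous_image continuous_on_subset[OF h]) auto
    then obtain H where "\<forall>y\<in>h ` sphere 0 1. norm y \<le> H" using compact_imp_bounded bounded_iff by blast
    then show ?thesis by (intro that[of H]) auto
  qed
  have hb: "h \<in> borel_measurable borel" using h by (rule borel_measurable_continuous_onI)
  show ?thesis
  proof (rule approximable_dominated[OF p, where F="\<lambda>k (x, \<theta>). of_real (bump n a b x) * of_real (q k (torus_exp 1 \<theta>))"
        and d="\<lambda>w. of_real ((H + 1) * indicator ({a..b} \<times> UNIV) w)"])
    show "approximable p (\<lambda>(x, \<theta>). of_real (bump n a b x) * of_real (q k (torus_exp 1 \<theta>)))" for k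
      by (intro approximable_test_fun test_fun_tensor polynomial_on_circle q Cc_infinity_bump)
    have "(\<lambda>x. complex_of_real (bump n a b x)) \<in> borel_measurable borel"
      by (intro borel_measurable_continuous_onI Cc_infinity_imp_cont Cc_infinity_bump)
    then have [measurable]: "(\<lambda>x. Re (of_real (bump n a b x))) \<in> borel_measurable borel" by measurable
    have [measurable]: "(\<lambda>x. bump n a b x) \<in> borel_measurable borel"
      using \<open>(\<lambda>x. Re (of_real (bump n a b x))) \<in> borel_measurable borel\<close> by simp
    show "(\<lambda>(x, \<theta>). complex_of_real (bump n a b x * h (torus_exp 1 \<theta>))) \<in> borel_measurable cylinder"
      using hb by (intro borel_imp_cylinder) (simp add: borel_prod[symmetric])
    show "(\<lambda>w. complex_of_real ((H + 1) * indicator ({a..b} \<times> UNIV) w)) \<in> borel_measurable cylinder"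
      by (intro borel_imp_cylinder) (simp add: borel_prod[symmetric])
    show "Lp_mass p (\<lambda>w. of_real ((H + 1) * indicator ({a..b} \<times> UNIV) w)) < \<infinity>"
      by (rule Lp_mass_box_finite[OF p])
    show "cmod ((\<lambda>(x, \<theta>). of_real (bump n a b x) * of_real (q k (torus_exp 1 \<theta>))) w) \<le> cmod (of_real ((H + 1) * indicator ({a..b} \<times> UNIV) w))" for k w
    proof -
      obtain x \<theta> where w: "w = (x, \<theta>)" by force
      have "inverse (real (Suc k)) \<le> 1" by (simp add: field_simps)
      then have qb: "\<bar>q k (torus_exp 1 \<theta>)\<bar> \<le> H + 1"
        using q(2)[OF on_circle, of \<theta> k] H[OF on_circle[of \<theta>]] by linarith
      have "\<bar>bump n a b x\<bar> \<le> indicator ({a..b} \<times> (UNIV::real set)) (x, \<theta>)"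
        by (rule bump_abs_le)
      then have "\<bar>q k (torus_exp 1 \<theta>)\<bar> * \<bar>bump n a b x\<bar> \<le> \<bar>H + 1\<bar> * indicator ({a..b} \<times> (UNIV::real set)) (x, \<theta>)"
        using qb by (intro mult_mono) auto
      then show ?thesis unfolding w by (simp add: norm_mult abs_mult mult.commute)
    qed
    have "(\<lambda>k. q k (torus_exp 1 \<theta>)) \<longlonglongrightarrow> h (torus_exp 1 \<theta>)" for \<theta>
    proof (rule metric_LIMSEQ_I)
      fix r :: real assume "r > 0"
      then obtain K where K: "inverse (real (Suc K)) < r" using reals_Archimedean by blast
      have "dist (q k (torus_exp 1 \<theta>)) (h (torus_exp 1 \<theta>)) < r" if "k \<ge> K" for k
      proof -
        have "inverse (real (Suc k)) \<le> inverse (real (Suc K))" using that by (simp add: field_simps)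
        then show ?thesis using q(2)[OF on_circle, of \<theta> k] K unfolding dist_real_def by linarith
      qed
      then show "\<exists>K. \<forall>k\<ge>K. dist (q k (torus_exp 1 \<theta>)) (h (torus_exp 1 \<theta>)) < r" by blast
    qed
    then show "AE w in cylinder. (\<lambda>k. (\<lambda>(x, \<theta>). of_real (bump n a b x) * of_real (q k (torus_exp 1 \<theta>))) w) \<longlonglongrightarrow>
        (\<lambda>(x, \<theta>). complex_of_real (bump n a b x * h (torus_exp 1 \<theta>))) w"
      by (auto intro!: AE_I2 tendsto_mult_left tendsto_of_real)
  qed
qed

lemma cos_gt_cos_iff:
  assumes "0 \<le> w" "w \<le> pi" "0 \<le> v" "v \<le> 2 * pi - w" shows "cos w < cos v \<longleftrightarrow> v < w"
proof (cases "v \<le> pi")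
  case True then show ?thesis using assms by (simp add: cos_mono_less_eq)
next
  case False
  have "cos v = cos (2 * pi - v)" by (simp add: cos_diff)
  also have "\<dots> \<le> cos w" using False assms by (intro cos_monotone_0_pi_le) auto
  finally show ?thesis using False assms by auto
qed

text \<open>An arc of the circle is the part of the circle in a half-plane.  This turns the indicator of an
  interval in \<open>\<theta>\<close> into a limit of continuous functions on the circle.\<close>

lemma arc_half_plane:
  assumes "0 \<le> c" "c < d" "d \<le> 1" "\<theta> \<in> {0..<1}"
  shows "cos (pi * (d - c)) < Re (torus_exp 1 \<theta> * cis (- pi * (c + d))) \<longleftrightarrow> \<theta> \<in> {c<..<d}"
proof -
  have "torus_exp 1 \<theta> * cis (- pi * (c + d)) = cis (2 * pi * \<theta> - pi * (c + d))"
    by (simp add: torus_exp_def cis_conv_exp exp_add[symmetric] algebra_simps)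
  then have "Re (torus_exp 1 \<theta> * cis (- pi * (c + d))) = cos \<bar>2 * pi * \<theta> - pi * (c + d)\<bar>" by simp
  also have "\<bar>2 * pi * \<theta> - pi * (c + d)\<bar> = pi * \<bar>2 * \<theta> - (c + d)\<bar>"
  proof -
    have "2 * pi * \<theta> - pi * (c + d) = pi * (2 * \<theta> - (c + d))" by (simp add: algebra_simps)
    then show ?thesis by (simp only: abs_mult abs_of_pos[OF pi_gt_zero])
  qed
  finally have 1: "Re (torus_exp 1 \<theta> * cis (- pi * (c + d))) = cos (pi * \<bar>2 * \<theta> - (c + d)\<bar>)" .
  have "cos (pi * (d - c)) < cos (pi * \<bar>2 * \<theta> - (c + d)\<bar>) \<longleftrightarrow> pi * \<bar>2 * \<theta> - (c + d)\<bar> < pi * (d - c)"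
  proof (rule cos_gt_cos_iff)
    have "\<bar>2 * \<theta> - (c + d)\<bar> \<le> 2 - (d - c)" using assms by auto
    then have "pi * \<bar>2 * \<theta> - (c + d)\<bar> \<le> pi * (2 - (d - c))" by (intro mult_left_mono) auto
    then show "pi * \<bar>2 * \<theta> - (c + d)\<bar> \<le> 2 * pi - pi * (d - c)" by (simp add: algebra_simps)
    have "pi * (d - c) \<le> pi * 1" using assms by (intro mult_left_mono) auto
    then show "pi * (d - c) \<le> pi" by simp
  qed (use assms in auto)
  also have "\<dots> \<longleftrightarrow> \<theta> \<in> {c<..<d}" by (auto simp: abs_less_iff)
  finally show ?thesis unfolding 1 .
qed

lemma clip_tendsto: "(\<lambda>n. max 0 (min 1 (real n * t))) \<longlonglongrightarrow> indicator {0<..} t" for t :: real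
proof (cases "t > 0")
  case True
  obtain K :: nat where K: "1 / t < real K" using reals_Archimedean2 by blast
  have "max 0 (min 1 (real n * t)) = 1" if "n \<ge> K" for n
  proof -
    have "1 < real K * t" using K True by (simp add: field_simps)
    also have "\<dots> \<le> real n * t" using that True by (intro mult_right_mono) auto
    finally show ?thesis by simp
  qed
  then have "eventually (\<lambda>n. max 0 (min 1 (real n * t)) = 1) sequentially"
    by (auto simp: eventually_sequentially)
  then show ?thesis using True by (auto intro: tendsto_eventually)
next
  case False
  then have "real n * t \<le> 0" for n by (simp add: mult_nonneg_nonpos)
  then have "max 0 (min 1 (real n * t)) = 0" for n by (metis max.absorb1 min.coboundedI2)
  then show ?thesis using False by simp
qed

lemma approximable_0: "approximable p (\<lambda>w. 0)"
  using test_fun_tensor[OF trig_polynomials_const Cc_infinity_0]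
  by (simp add: case_prod_unfold approximable_test_fun)

lemma approximable_rectangle:
  assumes p: "p > 0" and cd: "0 \<le> c" "d \<le> 1"
  shows "approximable p (indicator ({a<..<b} \<times> {c<..<d}))"
proof (cases "c < d")
  case False
  then have "{a<..<b} \<times> {c<..<d} = {}" by simp
  then have "indicator ({a<..<b} \<times> {c<..<d}) = (\<lambda>w. 0::complex)" by (auto simp: fun_eq_iff)
  then show ?thesis by (simp add: approximable_0)
next
  case True
  define h where "h n z = max 0 (min 1 (real n * (Re (z * cis (- pi * (c + d))) - cos (pi * (d - c)))))" for n :: nat and z
  have h: "continuous_on UNIV (h n)" for n unfolding h_def by (intro continuous_intros)
  have hb: "0 \<le> h n z" "h n z \<le> 1" for n z by (auto simp: h_def)
  show ?thesis
  proof (rule approximable_dominated[OF p, where F="\<lambda>n (x, \<theta>). of_real (bump n a b x * h n (torus_exp 1 \<theta>))"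
        and d="\<lambda>w. of_real (1 * indicator ({a..b} \<times> UNIV) w)"])
    show "approximable p (\<lambda>(x, \<theta>). complex_of_real (bump n a b x * h n (torus_exp 1 \<theta>)))" for n
      by (rule approximable_circle_function[OF p h])
    show "indicator ({a<..<b} \<times> {c<..<d}) \<in> borel_measurable cylinder"
      by (intro borel_imp_cylinder) (simp add: borel_prod[symmetric])
    show "(\<lambda>w. complex_of_real (1 * indicator ({a..b} \<times> UNIV) w)) \<in> borel_measurable cylinder"
      by (intro borel_imp_cylinder) (simp add: borel_prod[symmetric])
    show "Lp_mass p (\<lambda>w. of_real (1 * indicator ({a..b} \<times> UNIV) w)) < \<infinity>"
      by (rule Lp_mass_box_finite[OF p])
    show "cmod ((\<lambda>(x, \<theta>). complex_of_real (bump n a b x * h n (torus_exp 1 \<theta>))) w) \<le> cmod (of_real (1 * indicator ({a..b} \<times> UNIV) w))" for n w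
    proof -
      obtain x \<theta> where w: "w = (x, \<theta>)" by force
      have "\<bar>bump n a b x\<bar> * \<bar>h n (torus_exp 1 \<theta>)\<bar> \<le> indicator ({a..b} \<times> (UNIV::real set)) (x, \<theta>) * 1"
        using hb[of n "torus_exp 1 \<theta>"] by (intro mult_mono bump_abs_le) auto
      then show ?thesis unfolding w by (simp add: norm_mult)
    qed
    show "AE w in cylinder. (\<lambda>n. (\<lambda>(x, \<theta>). complex_of_real (bump n a b x * h n (torus_exp 1 \<theta>))) w) \<longlonglongrightarrow> indicator ({a<..<b} \<times> {c<..<d}) w"
    proof (rule AE_I2)
      fix w assume "w \<in> space cylinder"
      then obtain x \<theta> where w: "w = (x, \<theta>)" "\<theta> \<in> {0..<1}" by (auto simp: space_cylinder)
      have "(\<lambda>n. h n (torus_exp 1 \<theta>)) \<longlonglongrightarrow> indicator {0<..} (Re (torus_exp 1 \<theta> * cis (- pi * (c + d))) - cos (pi * (d - c)))"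
        unfolding h_def by (rule clip_tendsto)
      moreover have "indicator {0<..} (Re (torus_exp 1 \<theta> * cis (- pi * (c + d))) - cos (pi * (d - c))) = (indicator {c<..<d} \<theta> :: real)"
        using arc_half_plane[OF cd(1) True cd(2) w(2)] by (simp only: indicator_def greaterThan_iff diff_gt_0_iff_gt)
      ultimately have "(\<lambda>n. h n (torus_exp 1 \<theta>)) \<longlonglongrightarrow> indicator {c<..<d} \<theta>" by simp
      then have "(\<lambda>n. complex_of_real (bump n a b x * h n (torus_exp 1 \<theta>))) \<longlonglongrightarrow> of_real (indicator {a<..<b} x * indicator {c<..<d} \<theta>)"
        by (intro tendsto_of_real tendsto_mult bump_tendsto)
      moreover have "complex_of_real (indicator {a<..<b} x * indicator {c<..<d} \<theta>) = indicator ({a<..<b} \<times> {c<..<d}) (x, \<theta>)"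
        by (simp add: indicator_def)
      ultimately show "(\<lambda>n. (\<lambda>(x, \<theta>). complex_of_real (bump n a b x * h n (torus_exp 1 \<theta>))) w) \<longlonglongrightarrow> indicator ({a<..<b} \<times> {c<..<d}) w"
        unfolding w by simp
    qed
  qed
qed

lemma box_Times: "box (a, c) (b, d) = {a<..<b} \<times> {c<..<d}" for a b c d :: real
  by (auto simp: mem_box Basis_prod_def)

text \<open>Dynkin's \<open>\<pi>\<close>-\<open>\<lambda>\<close> argument with the boxes as generator.  All sets are cut to a bounded rectangle,
  which keeps complements in \<open>L\<^sup>p\<close>; the rectangle is open at \<open>\<theta> = 0\<close> because the arcs above are open.\<close>

lemma approximable_borel_set:
  assumes p: "p > 0" and A: "A \<in> sets borel"
  shows "approximable p (indicator (A \<inter> ({- R<..<R} \<times> {0<..<1})))"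
proof -
  let ?Q = "{- R<..<R} \<times> {0<..<1::real}"
  let ?G = "range (\<lambda>(a, b). box a b :: (real \<times> real) set)"
  have Q: "?Q \<in> sets borel" by (simp add: borel_prod[symmetric])
  have box: "box a b \<inter> box c d \<in> ?G" for a b c d :: "real \<times> real"
  proof -
    have "box x y \<in> ?G" for x y by (rule image_eqI[of _ _ "(x, y)"]) auto
    then show ?thesis unfolding box_Int_box .
  qed
  have sets: "B \<in> sets borel" if "B \<in> sigma_sets UNIV ?G" for B :: "(real \<times> real) set"
    using that by (simp add: borel_eq_box[where 'a="real \<times> real"])
  have dom: "(\<lambda>w. complex_of_real (1 * indicator ({- R..R} \<times> UNIV) w)) \<in> borel_measurable cylinder"
    by (intro borel_imp_cylinder) (simp add: borel_prod[symmetric])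
  have "Int_stable ?G" unfolding Int_stable_def using box by auto
  moreover have "?G \<subseteq> Pow UNIV" by simp
  moreover have "A \<in> sigma_sets UNIV ?G" using A by (simp add: borel_eq_box[where 'a="real \<times> real"])
  ultimately show ?thesis
  proof (induction rule: sigma_sets_induct_disjoint)
    case (basic A)
    then obtain a c b d where "A = box (a, c) (b, d)" by auto
    then have "A \<inter> ?Q = {max a (- R)<..<min b R} \<times> {max c 0<..<min d 1}"
      unfolding box_Times by auto
    then show ?case using approximable_rectangle[OF p, of "max c 0" "min d 1"] by simp
  next
    case empty
    show ?case by (simp add: approximable_0 indicator_def[abs_def])
  next
    case (compl A)
    have "indicator ((UNIV - A) \<inter> ?Q) = (\<lambda>w. indicator ?Q w + (- 1) * indicator (A \<inter> ?Q) w :: complex)"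
      by (auto simp: indicator_def fun_eq_iff)
    then show ?case
      using approximable_add[OF p approximable_rectangle[OF p, of 0 1 "- R" R] approximable_cmult[OF p compl.IH, of "- 1"]]
      by simp
  next
    case (union A)
    have fin: "approximable p (indicator ((\<Union>i<n. A i) \<inter> ?Q))" for n
    proof (induction n)
      case 0
      show ?case by (simp add: approximable_0 indicator_def[abs_def])
    next
      case (Suc n)
      have "(\<Union>i<n. A i) \<inter> A n = {}"
      proof -
        have "A i \<inter> A n = {}" if "i < n" for i
          using union(1) that unfolding disjoint_family_on_def by simp
        then show ?thesis by auto
      qed
      then have "indicator ((\<Union>i<Suc n. A i) \<inter> ?Q) = (\<lambda>w. indicator ((\<Union>i<n. A i) \<inter> ?Q) w + indicator (A n \<inter> ?Q) w :: complex)"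
        by (auto simp: indicator_def fun_eq_iff lessThan_Suc)
      then show ?case using approximable_add[OF p Suc union(3)[of n]] by simp
    qed
    have UA: "(\<Union>i. A i) \<in> sets borel" using union(2) sets by (intro sets.countable_UN) auto
    show ?case
    proof (rule approximable_dominated[OF p fin _ dom Lp_mass_box_finite[OF p]])
      show "indicator ((\<Union>i. A i) \<inter> ?Q) \<in> borel_measurable cylinder"
        using UA Q by (intro borel_imp_cylinder) simp
      show "cmod (indicator ((\<Union>i<n. A i) \<inter> ?Q) w) \<le> cmod (complex_of_real (1 * indicator ({- R..R} \<times> UNIV) w))" for n w
        by (auto simp: indicator_def)
      have "(\<lambda>n. indicator (\<Union>i<n. A i) w * indicator ?Q w) \<longlonglongrightarrow> (indicator (\<Union>i. A i) w * indicator ?Q w :: complex)" for w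
        by (intro tendsto_mult_right LIMSEQ_indicator_UN)
      then show "AE w in cylinder. (\<lambda>n. indicator ((\<Union>i<n. A i) \<inter> ?Q) w) \<longlonglongrightarrow> (indicator ((\<Union>i. A i) \<inter> ?Q) w :: complex)"
        by (simp add: indicator_inter_arith)
    qed
  qed
qed

lemma approximable_nonneg:
  assumes p: "p > 0" and u: "u \<in> borel_measurable borel" "\<And>w. 0 \<le> u w"
    and "Lp_mass p (\<lambda>w. of_real (u w)) < \<infinity>"
  shows "approximable p (\<lambda>w. of_real (u w) * indicator ({- R<..<R} \<times> {0<..<1}) w)"
  using u assms(4)
proof (induction rule: borel_measurable_induct_real)
  case (set A)
  have "(\<lambda>w. complex_of_real (indicator A w) * indicator ({- R<..<R} \<times> {0<..<1}) w) = indicator (A \<inter> ({- R<..<R} \<times> {0<..<1}))"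
    by (auto simp: indicator_def fun_eq_iff)
  then show ?case using approximable_borel_set[OF p set(1), of R] by simp
next
  case (mult u c)
  show ?case
  proof (cases "c = 0")
    case True
    then show ?thesis by (simp add: approximable_0)
  next
    case False
    have "(\<lambda>w. complex_of_real (u w)) \<in> borel_measurable cylinder" using mult(2) by (intro borel_imp_cylinder) simp
    from Lp_mass_cmult[OF this, of p "of_real c"]
    have "Lp_mass p (\<lambda>w. of_real (u w)) < \<infinity>"
      using mult.prems False by (auto simp: ennreal_mult_less_top)
    from approximable_cmult[OF p mult.IH[OF this], of "of_real c"] show ?thesis by (simp add: mult_ac)
  qed
next
  case (add u v)
  have "Lp_mass p (\<lambda>w. of_real (u w)) \<le> Lp_mass p (\<lambda>w. of_real (v w + u w))"
       "Lp_mass p (\<lambda>w. of_real (v w)) \<le> Lp_mass p (\<lambda>w. of_real (v w + u w))"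
    using add by (auto intro!: Lp_mass_mono p simp del: of_real_add)
  then have "Lp_mass p (\<lambda>w. of_real (u w)) < \<infinity>" "Lp_mass p (\<lambda>w. of_real (v w)) < \<infinity>"
    using add.prems by (auto intro: le_less_trans)
  from approximable_add[OF p add.IH(2)[OF this(2)] add.IH(1)[OF this(1)]]
  show ?case by (simp add: distrib_right)
next
  case (seq U)
  have le: "U i w \<le> u w" for i w
  proof (rule incseq_le[of "\<lambda>i. U i w"])
    show "incseq (\<lambda>i. U i w)" using \<open>incseq U\<close> by (cases w) (simp add: incseq_def le_fun_def)
    show "(\<lambda>i. U i w) \<longlonglongrightarrow> u w" by (rule seq) simp
  qed
  have mass: "Lp_mass p (\<lambda>w. of_real (U i w)) < \<infinity>" for i
    by (rule le_less_trans[OF Lp_mass_mono[OF p] seq.prems]) (use le seq u in auto)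
  show ?case
  proof (rule approximable_dominated[OF p seq.IH[OF mass]])
    show "(\<lambda>w. complex_of_real (u w)) \<in> borel_measurable cylinder" "Lp_mass p (\<lambda>w. of_real (u w)) < \<infinity>"
      using u(1) seq.prems by (auto intro!: borel_imp_cylinder)
    have "{- R<..<R} \<times> {0<..<1::real} \<in> sets borel" by (simp add: borel_prod[symmetric])
    then show "(\<lambda>w. complex_of_real (u w) * indicator ({- R<..<R} \<times> {0<..<1}) w) \<in> borel_measurable cylinder"
      using u(1) by (intro borel_imp_cylinder) simp
    show "cmod (of_real (U n w) * indicator ({- R<..<R} \<times> {0<..<1}) w) \<le> cmod (of_real (u w))" for n w
      using le[of n w] seq(2)[of n w] u(2)[of w] by (auto simp: indicator_def)
    show "AE w in cylinder. (\<lambda>n. complex_of_real (U n w) * indicator ({- R<..<R} \<times> {0<..<1}) w) \<longlonglongrightarrow>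
       of_real (u w) * indicator ({- R<..<R} \<times> {0<..<1}) w"
      using seq by (auto intro!: AE_I2 tendsto_mult_right tendsto_of_real)
  qed
qed

lemma AE_cylinder_snd_nonzero: "AE w in cylinder. snd w \<noteq> 0"
proof -
  have "emeasure lborel ((UNIV :: real set) \<times> {0::real}) = emeasure lborel (UNIV :: real set) * emeasure lborel {0::real}"
    unfolding lborel_prod[symmetric] by (rule lborel.emeasure_pair_measure_Times) auto
  then have "emeasure lborel ((UNIV :: real set) \<times> {0::real}) = 0" by simp
  moreover have "(UNIV :: real set) \<times> {0::real} \<in> sets borel" by (simp add: borel_prod[symmetric])
  ultimately have "AE w in lborel. w \<notin> (UNIV :: real set) \<times> {0::real}"
    by (intro AE_not_in) (simp add: null_sets_def)
  then show ?thesis unfolding cylinder_def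
    by (subst AE_restrict_space_iff) (auto elim!: eventually_mono)
qed

theorem test_functions_dense:
  assumes p: "p > 0" and f: "f \<in> borel_measurable cylinder" "Lp_mass p f < \<infinity>"
  shows "approximable p f"
proof -
  define g where "g w = indicator (UNIV \<times> {0..<1}) w *\<^sub>R f w" for w
  have g [measurable]: "g \<in> borel_measurable borel"
    using f(1) unfolding cylinder_measurable_iff g_def .
  have gf: "g w = f w" if "w \<in> space cylinder" for w using that by (simp add: g_def space_cylinder)
  let ?I = "\<lambda>R. indicator ({- R<..<R} \<times> {0<..<1::real})"
  have part: "approximable p (\<lambda>w. of_real (max 0 (u w)) * ?I R w)"
    if "u \<in> borel_measurable borel" "\<And>w. \<bar>u w\<bar> \<le> cmod (g w)" for u :: "real \<times> real \<Rightarrow> real" and R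
  proof (rule approximable_nonneg[OF p])
    have "Lp_mass p (\<lambda>w. of_real (max 0 (u w))) \<le> Lp_mass p f"
    proof (rule Lp_mass_mono[OF p])
      fix w assume "w \<in> space cylinder"
      then show "cmod (of_real (max 0 (u w))) \<le> cmod (f w)" using that(2)[of w] gf[of w] by simp
    qed
    then show "Lp_mass p (\<lambda>w. of_real (max 0 (u w))) < \<infinity>" using f(2) by (rule le_less_trans)
  qed (use that in auto)
  have gR: "approximable p (\<lambda>w. g w * ?I R w)" for R
  proof -
    have "approximable p (\<lambda>w. of_real (max 0 (Re (g w))) * ?I R w)" "approximable p (\<lambda>w. of_real (max 0 (- Re (g w))) * ?I R w)"
      "approximable p (\<lambda>w. of_real (max 0 (Im (g w))) * ?I R w)" "approximable p (\<lambda>w. of_real (max 0 (- Im (g w))) * ?I R w)"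
      by (intro part; simp add: abs_Re_le_cmod abs_Im_le_cmod)+
    then have "approximable p (\<lambda>w. (of_real (max 0 (Re (g w))) * ?I R w + (- 1) * (of_real (max 0 (- Re (g w))) * ?I R w))
       + (\<i> * (of_real (max 0 (Im (g w))) * ?I R w) + (- \<i>) * (of_real (max 0 (- Im (g w))) * ?I R w)))"
      by (intro approximable_add[OF p] approximable_cmult[OF p])
    moreover have "(of_real (max 0 (Re z)) * c + (- 1) * (of_real (max 0 (- Re z)) * c))
       + (\<i> * (of_real (max 0 (Im z)) * c) + (- \<i>) * (of_real (max 0 (- Im z)) * c)) = z * c" for z c
    proof -
      have "z = of_real (max 0 (Re z)) - of_real (max 0 (- Re z)) + \<i> * (of_real (max 0 (Im z)) - of_real (max 0 (- Im z)))"
        by (auto simp: complex_eq_iff max_def)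
      moreover have "(a * c + (- 1) * (b * c)) + (\<i> * (d * c) + (- \<i>) * (e * c)) = (a - b + \<i> * (d - e)) * c" for a b d e :: complex
        by (simp add: algebra_simps)
      ultimately show ?thesis by metis
    qed
    ultimately show ?thesis by simp
  qed
  show ?thesis
  proof (rule approximable_dominated[OF p gR[of "real n" for n] f(1) f])
    show "cmod (g w * ?I (real n) w) \<le> cmod (f w)" if "w \<in> space cylinder" for n w
      using gf[OF that] by (simp add: indicator_def)
    \<comment> \<open>The rectangles exhaust the cylinder except for the null set \<open>\<theta> = 0\<close>.\<close>
    show "AE w in cylinder. (\<lambda>n. g w * ?I (real n) w) \<longlonglongrightarrow> f w"
      using AE_cylinder_snd_nonzero AE_space
    proof eventually_elim
      case (elim w)
      obtain K :: nat where K: "\<bar>fst w\<bar> < real K" using reals_Archimedean2 by blast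
      have "g w * ?I (real n) w = f w" if "n \<ge> K" for n
      proof -
        have "\<bar>fst w\<bar> < real n" using K that by linarith
        then show ?thesis using elim gf[of w] by (cases w) (auto simp: indicator_def space_cylinder abs_less_iff)
      qed
      then show ?case by (intro tendsto_eventually) (auto simp: eventually_sequentially)
    qed
  qed
qed

section \<open>Fourier coefficients on the cylinder\<close>

lemma integral_torus_exp: "(LINT \<gamma>:{0..<1}|lborel. torus_exp j \<gamma>) = (if j = 0 then 1 else 0)"
proof -
  have "(LINT \<gamma>:{0..<1}|lborel. torus_exp j \<gamma>) = (LINT \<gamma>|lborel. indicator {0..1} \<gamma> *\<^sub>R torus_exp j \<gamma>)"
    unfolding set_lebesgue_integral_def
  proof (rule integral_cong_AE)
    show "AE \<gamma> in lborel. indicator {0..<1} \<gamma> *\<^sub>R torus_exp j \<gamma> = indicator {0..1} \<gamma> *\<^sub>R torus_exp j \<gamma>"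
      using AE_lborel_singleton[of "1::real"] by eventually_elim (auto simp: indicator_def)
  qed auto
  also have "\<dots> = (if j = 0 then 1 else 0)"
  proof (cases "j = 0")
    case True
    then show ?thesis by simp
  next
    case False
    define a where "a = 2 * of_real pi * \<i> * of_int j"
    have a: "a \<noteq> 0" using False by (simp add: a_def)
    have "(LINT \<gamma>|lborel. indicator {0..1} \<gamma> *\<^sub>R torus_exp j \<gamma>) = exp (a * of_real 1) / a - exp (a * of_real 0) / a"
    proof (rule integral_FTC_atLeastAtMost)
      show "((\<lambda>\<gamma>. exp (a * of_real \<gamma>) / a) has_vector_derivative torus_exp j \<gamma>) (at \<gamma> within {0..1})" for \<gamma>
        using a by (auto intro!: derivative_eq_intros has_vector_derivative_real_field simp: torus_exp_def a_def)
    qed (auto intro: continuous_torus_exp)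
    moreover have "exp a = 1"
      unfolding a_def using exp_integer_2pi[of "of_int j"] by (simp add: mult_ac)
    ultimately show ?thesis using False by simp
  qed
  finally show ?thesis .
qed

text \<open>The extension by zero turns functions on the cylinder into Borel functions on the plane, to which
  Fubini's theorem for Lebesgue measure applies.\<close>

definition strip_ext :: "(real \<times> real \<Rightarrow> complex) \<Rightarrow> real \<times> real \<Rightarrow> complex" where
  "strip_ext \<phi> w = indicator (UNIV \<times> {0..<1}) w *\<^sub>R \<phi> w"

lemma strip_ext_measurable: "\<phi> \<in> borel_measurable cylinder \<Longrightarrow> strip_ext \<phi> \<in> borel_measurable borel"
  unfolding cylinder_measurable_iff strip_ext_def[abs_def] .

lemma fourier_coeff_eq:
  "fourier_coeff \<phi> j x = (LINT \<gamma>|lborel. torus_exp (- j) \<gamma> * strip_ext \<phi> (x, \<gamma>))"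
  unfolding fourier_coeff_def set_lebesgue_integral_def strip_ext_def torus_exp_def
  by (intro Bochner_Integration.integral_cong refl) (simp add: indicator_def)

lemma fourier_coeff_measurable [measurable]:
  assumes "\<phi> \<in> borel_measurable cylinder" shows "fourier_coeff \<phi> j \<in> borel_measurable borel"
proof -
  have [measurable]: "strip_ext \<phi> \<in> borel_measurable (borel \<Otimes>\<^sub>M borel)"
    using strip_ext_measurable[OF assms] by (simp add: borel_prod)
  show ?thesis unfolding fourier_coeff_eq[abs_def] by measurable
qed

lemma norm_integral_le_nn_integral:
  fixes f :: "'a \<Rightarrow> complex"
  shows "ennreal (cmod (integral\<^sup>L M f)) \<le> (\<integral>\<^sup>+x. ennreal (cmod (f x)) \<partial>M)"
proof (cases "integrable M f")
  case True then show ?thesis by (rule integral_norm_bound_ennreal)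
next
  case False then show ?thesis by (simp add: not_integrable_integral_eq)
qed

lemma norm_fourier_coeff_le:
  "ennreal (cmod (fourier_coeff \<phi> j x)) \<le> (\<integral>\<^sup>+\<gamma>. ennreal (cmod (strip_ext \<phi> (x, \<gamma>))) \<partial>lborel)"
  unfolding fourier_coeff_eq
  by (rule order_trans[OF norm_integral_le_nn_integral]) (simp add: norm_mult)

lemma nn_integral_strip_ext:
  fixes g :: "real \<Rightarrow> ennreal" and h :: "real \<Rightarrow> real"
  assumes \<phi> [measurable]: "\<phi> \<in> borel_measurable cylinder" and [measurable]: "g \<in> borel_measurable borel" and g0: "g 0 = 0"
    and [measurable]: "h \<in> borel_measurable borel"
  shows "(\<integral>\<^sup>+x. \<integral>\<^sup>+\<gamma>. g (cmod (strip_ext \<phi> (x, \<gamma>))) * ennreal (h x) \<partial>lborel \<partial>lborel) =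
     (\<integral>\<^sup>+w. g (cmod (\<phi> w)) * ennreal (h (fst w)) \<partial>cylinder)"
proof -
  have "(\<lambda>w::real \<times> real. h (fst w)) \<in> borel_measurable cylinder"
    by (intro borel_imp_cylinder) (simp add: borel_prod[symmetric])
  then have "(\<lambda>w. g (cmod (\<phi> w)) * ennreal (h (fst w))) \<in> borel_measurable cylinder" by measurable
  from nn_integral_cylinder_iterated[OF this] show ?thesis
    using g0 by (auto simp: strip_ext_def indicator_def intro!: nn_integral_cong)
qed

text \<open>This quantity dominates the weighted norms of all Fourier coefficients at once.\<close>

definition weighted_mass :: "(real \<times> real \<Rightarrow> complex) \<Rightarrow> ennreal" where
  "weighted_mass \<phi> = (\<integral>\<^sup>+w. ennreal (cmod (\<phi> w)) * ennreal (inverse (1 + (fst w)\<^sup>2)) \<partial>cylinder)"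

text \<open>A substitute for Hoelder's inequality: the free level \<open>l\<close> makes the first term small uniformly in \<open>a\<close>, and
  the second is controlled by the \<open>L\<^sup>p\<close> norm.\<close>

lemma le_level_plus_powr:
  fixes a l p :: real
  assumes "a \<ge> 0" "l > 0" "p > 1" shows "a \<le> l + l powr (1 - p) * a powr p"
proof (cases "a \<le> l")
  case True then show ?thesis by (simp add: add_increasing2)
next
  case False
  have "a = a powr (1 - p) * a powr p" using False assms by (simp add: powr_add[symmetric])
  also have "\<dots> \<le> l powr (1 - p) * a powr p"
    using False assms by (intro mult_right_mono powr_mono2') auto
  finally show ?thesis using assms by linarith
qed

lemma weighted_mass_le:
  assumes \<phi> [measurable]: "\<phi> \<in> borel_measurable cylinder" and l: "l > 0" and p: "p > 1"
  shows "weighted_mass \<phi> \<le> ennreal (l * pi) + ennreal (l powr (1 - p)) * Lp_mass p \<phi>"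
proof -
  have [measurable]: "(\<lambda>w::real\<times>real. inverse (1 + (fst w)\<^sup>2)) \<in> borel_measurable cylinder"
    by (intro borel_imp_cylinder) (simp add: borel_prod[symmetric])
  have "weighted_mass \<phi> \<le> (\<integral>\<^sup>+w. ennreal l * ennreal (inverse (1 + (fst w)\<^sup>2)) + ennreal (l powr (1 - p)) * ennreal (cmod (\<phi> w) powr p) \<partial>cylinder)"
    unfolding weighted_mass_def
  proof (rule nn_integral_mono)
    fix w :: "real \<times> real"
    let ?v = "inverse (1 + (fst w)\<^sup>2)"
    have v: "0 \<le> ?v" "?v \<le> 1" using weight_pos[of "fst w"] by (auto simp: inverse_le_1_iff)
    have "cmod (\<phi> w) * ?v \<le> (l + l powr (1 - p) * cmod (\<phi> w) powr p) * ?v"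
      using v by (intro mult_right_mono le_level_plus_powr l p) auto
    also have "\<dots> \<le> l * ?v + l powr (1 - p) * cmod (\<phi> w) powr p"
      using v by (simp add: distrib_right mult_left_le)
    finally show "ennreal (cmod (\<phi> w)) * ennreal ?v \<le> ennreal l * ennreal ?v + ennreal (l powr (1 - p)) * ennreal (cmod (\<phi> w) powr p)"
      using v l by (simp add: ennreal_mult[symmetric] ennreal_leI flip: ennreal_plus)
  qed
  also have "\<dots> = ennreal l * (\<integral>\<^sup>+w. ennreal (inverse (1 + (fst w)\<^sup>2)) \<partial>cylinder) + ennreal (l powr (1 - p)) * Lp_mass p \<phi>"
    unfolding Lp_mass_def by (simp add: nn_integral_add nn_integral_cmult)
  also have "(\<integral>\<^sup>+w. ennreal (inverse (1 + (fst w)\<^sup>2)) \<partial>cylinder) = ennreal pi"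
  proof -
    have "(\<integral>\<^sup>+w. ennreal (inverse (1 + (fst w)\<^sup>2)) \<partial>cylinder) = (\<integral>\<^sup>+x. ennreal (inverse (1 + (x::real)\<^sup>2)) \<partial>lborel)"
      by (subst nn_integral_cylinder_iterated) (auto simp: nn_integral_cmult)
    also have "\<dots> = ennreal (LINT x|lborel. inverse (1 + x\<^sup>2))"
      by (rule nn_integral_eq_integral[OF integrable_weight]) (auto intro: less_imp_le[OF weight_pos])
    finally show ?thesis by (simp add: integral_weight)
  qed
  finally show ?thesis using l by (simp add: ennreal_mult)
qed

lemma weighted_mass_finite:
  assumes "\<phi> \<in> borel_measurable cylinder" "p > 1" "Lp_mass p \<phi> < \<infinity>"
  shows "weighted_mass \<phi> < \<infinity>"
  using weighted_mass_le[OF assms(1) _ assms(2), of 1] assms(3)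
  by (auto simp: less_top[symmetric] top_unique)

lemma weighted_mass_tendsto_0:
  assumes \<phi>: "\<And>n. \<phi> n \<in> borel_measurable cylinder" and p: "p > 1"
    and lim: "(\<lambda>n. Lp_mass p (\<phi> n)) \<longlonglongrightarrow> 0"
  shows "(\<lambda>n. weighted_mass (\<phi> n)) \<longlonglongrightarrow> 0"
proof (rule order_tendstoI)
  fix a :: ennreal assume "0 < a"
  then obtain z where z: "0 < z" "z < a" using dense by blast
  then obtain e where e: "z = ennreal e" "e > 0" by (cases z) auto
  define l where "l = e / (2 * pi)"
  have l: "l > 0" "l * pi = e / 2" using e by (auto simp: l_def)
  define d where "d = e / 2 / l powr (1 - p)"
  have d: "d > 0" "l powr (1 - p) * d = e / 2" using e l by (auto simp: d_def)
  have "eventually (\<lambda>n. Lp_mass p (\<phi> n) < ennreal d) sequentially"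
    using lim d(1) by (intro order_tendstoD) auto
  then show "eventually (\<lambda>n. weighted_mass (\<phi> n) < a) sequentially"
  proof eventually_elim
    case (elim n)
    have "weighted_mass (\<phi> n) \<le> ennreal (l * pi) + ennreal (l powr (1 - p)) * Lp_mass p (\<phi> n)"
      by (rule weighted_mass_le[OF \<phi> l(1) p])
    also have "\<dots> \<le> ennreal (e / 2) + ennreal (l powr (1 - p)) * ennreal d"
      unfolding l(2) using elim by (intro add_left_mono mult_left_mono) auto
    also have "\<dots> = ennreal e"
      using d e(2) by (simp add: ennreal_mult[symmetric] flip: ennreal_plus)
    finally show ?case using z e by simp
  qed
qed auto

lemma strip_ext_integrable_AE:
  assumes \<phi>: "\<phi> \<in> borel_measurable cylinder" and fin: "weighted_mass \<phi> < \<infinity>"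
  shows "AE x in lborel. integrable lborel (\<lambda>\<gamma>. strip_ext \<phi> (x, \<gamma>))"
proof -
  have [measurable]: "strip_ext \<phi> \<in> borel_measurable (borel \<Otimes>\<^sub>M borel)"
    using strip_ext_measurable[OF \<phi>] by (simp add: borel_prod)
  have "(\<integral>\<^sup>+x. \<integral>\<^sup>+\<gamma>. ennreal (cmod (strip_ext \<phi> (x, \<gamma>))) * ennreal (inverse (1 + x\<^sup>2)) \<partial>lborel \<partial>lborel) = weighted_mass \<phi>"
    unfolding weighted_mass_def by (rule nn_integral_strip_ext[OF \<phi>, of "\<lambda>r. ennreal r"]) auto
  then have "AE x in lborel. (\<integral>\<^sup>+\<gamma>. ennreal (cmod (strip_ext \<phi> (x, \<gamma>))) * ennreal (inverse (1 + x\<^sup>2)) \<partial>lborel) \<noteq> \<infinity>"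
    using fin by (intro nn_integral_PInf_AE) auto
  then show ?thesis
  proof eventually_elim
    case (elim x)
    then have "(\<integral>\<^sup>+\<gamma>. ennreal (cmod (strip_ext \<phi> (x, \<gamma>))) \<partial>lborel) * ennreal (inverse (1 + x\<^sup>2)) \<noteq> \<infinity>"
      by (subst (asm) nn_integral_multc) auto
    then have "(\<integral>\<^sup>+\<gamma>. ennreal (cmod (strip_ext \<phi> (x, \<gamma>))) \<partial>lborel) < \<infinity>"
      using weight_pos[of x] by (auto simp: ennreal_mult_eq_top_iff less_top)
    then show ?case by (intro integrableI_bounded) auto
  qed
qed

text \<open>Additivity can fail on a null set of \<open>x\<close>, where the integral that defines the coefficient diverges.\<close>

lemma fourier_coeff_diff_AE:
  assumes \<phi>: "\<phi> \<in> borel_measurable cylinder" "weighted_mass \<phi> < \<infinity>"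
    and \<psi>: "\<psi> \<in> borel_measurable cylinder" "weighted_mass \<psi> < \<infinity>"
  shows "AE x in lborel. \<forall>j. fourier_coeff (\<lambda>w. \<phi> w - \<psi> w) j x = fourier_coeff \<phi> j x - fourier_coeff \<psi> j x"
  using strip_ext_integrable_AE[OF \<phi>] strip_ext_integrable_AE[OF \<psi>]
proof eventually_elim
  case (elim x)
  have i: "integrable lborel (\<lambda>\<gamma>. torus_exp j \<gamma> * f \<gamma>)" if "integrable lborel f" for j and f :: "real \<Rightarrow> complex"
    by (rule Bochner_Integration.integrable_bound[OF that]) (use that in \<open>auto simp: norm_mult\<close>)
  show ?case
  proof
    fix j
    have "fourier_coeff (\<lambda>w. \<phi> w - \<psi> w) j x = (LINT \<gamma>|lborel. torus_exp (- j) \<gamma> * strip_ext \<phi> (x, \<gamma>) - torus_exp (- j) \<gamma> * strip_ext \<psi> (x, \<gamma>))"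
      unfolding fourier_coeff_eq by (intro Bochner_Integration.integral_cong refl) (simp add: strip_ext_def algebra_simps)
    then show "fourier_coeff (\<lambda>w. \<phi> w - \<psi> w) j x = fourier_coeff \<phi> j x - fourier_coeff \<psi> j x"
      using i[OF elim(1)] i[OF elim(2)] by (simp add: fourier_coeff_eq)
  qed
qed

lemma fourier_coeff_weighted:
  assumes \<phi>: "\<phi> \<in> borel_measurable cylinder" and fin: "weighted_mass \<phi> < \<infinity>"
  shows "weighted_integrable (fourier_coeff \<phi> j)" "ennreal (weighted_norm (fourier_coeff \<phi> j)) \<le> weighted_mass \<phi>"
proof -
  have [measurable]: "strip_ext \<phi> \<in> borel_measurable (borel \<Otimes>\<^sub>M borel)" "fourier_coeff \<phi> j \<in> borel_measurable borel"
    using strip_ext_measurable[OF \<phi>] fourier_coeff_measurable[OF \<phi>] by (simp_all add: borel_prod)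
  have "(\<integral>\<^sup>+x. ennreal (cmod (fourier_coeff \<phi> j x) * inverse (1 + x\<^sup>2)) \<partial>lborel) \<le>
     (\<integral>\<^sup>+x. \<integral>\<^sup>+\<gamma>. ennreal (cmod (strip_ext \<phi> (x, \<gamma>))) * ennreal (inverse (1 + x\<^sup>2)) \<partial>lborel \<partial>lborel)"
  proof (rule nn_integral_mono)
    fix x :: real
    have "ennreal (cmod (fourier_coeff \<phi> j x) * inverse (1 + x\<^sup>2)) = ennreal (cmod (fourier_coeff \<phi> j x)) * ennreal (inverse (1 + x\<^sup>2))"
      using weight_pos[of x] by (simp add: ennreal_mult)
    also have "\<dots> \<le> (\<integral>\<^sup>+\<gamma>. ennreal (cmod (strip_ext \<phi> (x, \<gamma>))) \<partial>lborel) * ennreal (inverse (1 + x\<^sup>2))"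
      by (intro mult_right_mono norm_fourier_coeff_le) auto
    also have "\<dots> = (\<integral>\<^sup>+\<gamma>. ennreal (cmod (strip_ext \<phi> (x, \<gamma>))) * ennreal (inverse (1 + x\<^sup>2)) \<partial>lborel)"
      by (subst nn_integral_multc) auto
    finally show "ennreal (cmod (fourier_coeff \<phi> j x) * inverse (1 + x\<^sup>2)) \<le> \<dots>" .
  qed
  also have "\<dots> = weighted_mass \<phi>"
    unfolding weighted_mass_def by (rule nn_integral_strip_ext[OF \<phi>, of "\<lambda>r. ennreal r"]) auto
  finally have le: "(\<integral>\<^sup>+x. ennreal (cmod (fourier_coeff \<phi> j x) * inverse (1 + x\<^sup>2)) \<partial>lborel) \<le> weighted_mass \<phi>" .
  have nn: "0 \<le> cmod (fourier_coeff \<phi> j x) * inverse (1 + x\<^sup>2)" for x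
    using weight_pos[of x] by (intro mult_nonneg_nonneg) auto
  have int: "integrable lborel (\<lambda>x. cmod (fourier_coeff \<phi> j x) * inverse (1 + x\<^sup>2))"
    using le_less_trans[OF le fin] nn by (intro integrableI_nonneg) auto
  then show "weighted_integrable (fourier_coeff \<phi> j)" by (simp add: weighted_integrable_def)
  show "ennreal (weighted_norm (fourier_coeff \<phi> j)) \<le> weighted_mass \<phi>"
    using le nn_integral_eq_integral[OF int] nn by (simp add: weighted_norm_def)
qed

lemma powr_above_tangent:
  fixes a m :: real
  assumes "p > 1" "a \<ge> 0" "m > 0" shows "m powr p + p * m powr (p - 1) * (a - m) \<le> a powr p"
proof (cases "a = 0")
  case True
  have "m powr p = m powr (p - 1) * m" using assms by (simp add: powr_diff)
  then have "m powr p + p * m powr (p - 1) * (0 - m) = (1 - p) * m powr p" by (simp add: algebra_simps)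
  also have "\<dots> \<le> 0" using assms by (simp add: mult_nonpos_nonneg)
  finally show ?thesis using True assms by simp
next
  case False
  have "p * m powr (p - 1) * (a - m) \<le> a powr p - m powr p"
  proof (rule convex_on_imp_above_tangent[of "{0<..}"])
    show "convex_on {0<..} (\<lambda>x. x powr p)" using assms by (intro powr_convex) auto
    show "((\<lambda>x. x powr p) has_field_derivative p * m powr (p - 1)) (at m within {0<..})"
      using assms by (auto intro!: derivative_eq_intros)
  qed (use False assms in \<open>auto simp: interior_open\<close>)
  then show ?thesis by simp
qed

text \<open>Jensen's inequality on the circle, obtained by integrating the tangent of \<open>t\<^sup>p\<close> at the modulus of the
  coefficient.\<close>

lemma norm_fourier_coeff_powr_le:
  assumes p: "p > 1" and meas [measurable]: "(\<lambda>\<gamma>. strip_ext \<phi> (x, \<gamma>)) \<in> borel_measurable borel"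
  shows "ennreal (cmod (fourier_coeff \<phi> j x) powr p) \<le> (\<integral>\<^sup>+\<gamma>. ennreal (cmod (strip_ext \<phi> (x, \<gamma>)) powr p) \<partial>lborel)"
proof (cases "fourier_coeff \<phi> j x = 0 \<or> (\<integral>\<^sup>+\<gamma>. ennreal (cmod (strip_ext \<phi> (x, \<gamma>)) powr p) \<partial>lborel) = \<infinity>")
  case True
  then show ?thesis using p by auto
next
  case False
  define h where "h \<gamma> = strip_ext \<phi> (x, \<gamma>)" for \<gamma>
  have [measurable]: "h \<in> borel_measurable borel" unfolding h_def by measurable
  define m where "m = cmod (fourier_coeff \<phi> j x)"
  have m: "m > 0" using False by (simp add: m_def)
  have int_p: "integrable lborel (\<lambda>\<gamma>. cmod (h \<gamma>) powr p)"
    using False by (intro integrableI_nonneg) (auto simp: h_def less_top)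
  have ind: "integrable lborel (indicator {0..<1} :: real \<Rightarrow> real)" "(LINT \<gamma>|lborel. indicator {0..<1::real} \<gamma>) = (1::real)"
    by auto
  have sup: "h \<gamma> = 0" if "\<gamma> \<notin> {0..<1}" for \<gamma> using that by (simp add: h_def strip_ext_def)
  have int_h: "integrable lborel (\<lambda>\<gamma>. cmod (h \<gamma>))"
  proof (rule Bochner_Integration.integrable_bound[OF Bochner_Integration.integrable_add[OF ind(1) int_p]])
    have "cmod (h \<gamma>) \<le> indicator {0..<1} \<gamma> + cmod (h \<gamma>) powr p" for \<gamma>
      using le_level_plus_powr[of "cmod (h \<gamma>)" 1 p] p sup[of \<gamma>] by (cases "\<gamma> \<in> {0..<1}") auto
    then show "AE \<gamma> in lborel. norm (cmod (h \<gamma>)) \<le> norm (indicator {0..<1} \<gamma> + cmod (h \<gamma>) powr p)"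
      by auto
  qed measurable
  have "m \<le> (LINT \<gamma>|lborel. cmod (h \<gamma>))"
    unfolding m_def fourier_coeff_eq h_def by (rule order_trans[OF integral_norm_bound]) (simp add: norm_mult)
  then have "m powr p \<le> m powr p + p * m powr (p - 1) * ((LINT \<gamma>|lborel. cmod (h \<gamma>)) - m)"
    using p by (auto intro!: mult_nonneg_nonneg)
  also have "\<dots> = (LINT \<gamma>|lborel. (m powr p - p * m powr (p - 1) * m) * indicator {0..<1} \<gamma> + (p * m powr (p - 1)) * cmod (h \<gamma>))"
    using int_h ind by (subst Bochner_Integration.integral_add) (auto simp: algebra_simps)
  also have "\<dots> \<le> (LINT \<gamma>|lborel. cmod (h \<gamma>) powr p)"
  proof (rule integral_mono[OF _ int_p])
    show "integrable lborel (\<lambda>\<gamma>. (m powr p - p * m powr (p - 1) * m) * indicator {0..<1} \<gamma> + (p * m powr (p - 1)) * cmod (h \<gamma>))"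
      using int_h ind(1) by (intro Bochner_Integration.integrable_add integrable_mult_right)
    show "(m powr p - p * m powr (p - 1) * m) * indicator {0..<1} \<gamma> + (p * m powr (p - 1)) * cmod (h \<gamma>) \<le> cmod (h \<gamma>) powr p" for \<gamma>
      using powr_above_tangent[OF p norm_ge_zero m, of "h \<gamma>"] sup[of \<gamma>]
      by (cases "\<gamma> \<in> {0..<1}") (auto simp: algebra_simps)
  qed
  finally have "ennreal (m powr p) \<le> ennreal (LINT \<gamma>|lborel. cmod (h \<gamma>) powr p)" by (rule ennreal_leI)
  also have "\<dots> = (\<integral>\<^sup>+\<gamma>. ennreal (cmod (h \<gamma>) powr p) \<partial>lborel)"
    by (rule nn_integral_eq_integral[OF int_p, symmetric]) auto
  finally show ?thesis by (simp add: m_def h_def)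
qed

definition mode :: "(real \<Rightarrow> complex) \<Rightarrow> int \<Rightarrow> real \<times> real \<Rightarrow> complex" where
  "mode c j w = c (fst w) * torus_exp j (snd w)"

definition trig_sum :: "int set \<Rightarrow> (int \<Rightarrow> real \<Rightarrow> complex) \<Rightarrow> real \<times> real \<Rightarrow> complex" where
  "trig_sum J c w = (\<Sum>j\<in>J. mode (c j) j w)"

lemma mode_measurable: "c \<in> borel_measurable borel \<Longrightarrow> mode c j \<in> borel_measurable cylinder"
  unfolding mode_def[abs_def] by (intro borel_imp_cylinder) (simp add: borel_prod[symmetric])

lemma trig_sum_measurable: "(\<And>j. j \<in> J \<Longrightarrow> c j \<in> borel_measurable borel) \<Longrightarrow> trig_sum J c \<in> borel_measurable cylinder"
  unfolding trig_sum_def[abs_def] by (intro borel_measurable_sum mode_measurable)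

lemma Lp_mass_mode:
  assumes [measurable]: "c \<in> borel_measurable borel"
  shows "Lp_mass p (mode c j) = (\<integral>\<^sup>+x. ennreal (cmod (c x) powr p) \<partial>lborel)"
proof -
  have [measurable]: "mode c j \<in> borel_measurable cylinder" by (intro mode_measurable) simp
  have "Lp_mass p (mode c j) = (\<integral>\<^sup>+x. \<integral>\<^sup>+\<theta>. ennreal (cmod (mode c j (x, \<theta>)) powr p) * indicator {0..<1} \<theta> \<partial>lborel \<partial>lborel)"
    unfolding Lp_mass_def by (rule nn_integral_cylinder_iterated) measurable
  also have "\<dots> = (\<integral>\<^sup>+x. ennreal (cmod (c x) powr p) \<partial>lborel)"
    by (simp add: mode_def norm_mult nn_integral_cmult)
  finally show ?thesis .
qed

lemma Lp_mass_fourier_mode_le: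
  assumes p: "p > 1" and \<phi>: "\<phi> \<in> borel_measurable cylinder"
  shows "Lp_mass p (mode (fourier_coeff \<phi> j) j) \<le> Lp_mass p \<phi>"
proof -
  have [measurable]: "strip_ext \<phi> \<in> borel_measurable (borel \<Otimes>\<^sub>M borel)"
    using strip_ext_measurable[OF \<phi>] by (simp add: borel_prod)
  have "Lp_mass p (mode (fourier_coeff \<phi> j) j) = (\<integral>\<^sup>+x. ennreal (cmod (fourier_coeff \<phi> j x) powr p) \<partial>lborel)"
    by (rule Lp_mass_mode[OF fourier_coeff_measurable[OF \<phi>]])
  also have "\<dots> \<le> (\<integral>\<^sup>+x. \<integral>\<^sup>+\<gamma>. ennreal (cmod (strip_ext \<phi> (x, \<gamma>)) powr p) \<partial>lborel \<partial>lborel)"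
    by (intro nn_integral_mono norm_fourier_coeff_powr_le[OF p]) measurable
  also have "\<dots> = Lp_mass p \<phi>"
    using nn_integral_strip_ext[OF \<phi>, of "\<lambda>r. ennreal (r powr p)" "\<lambda>x. 1"] p by (simp add: Lp_mass_def)
  finally show ?thesis .
qed

lemma Lp_mass_sum_le:
  assumes p: "p > 0" and "finite J"
  shows "\<exists>K\<ge>0. \<forall>f M. (\<forall>j\<in>J. f j \<in> borel_measurable cylinder \<and> Lp_mass p (f j) \<le> M) \<longrightarrow>
     Lp_mass p (\<lambda>w. \<Sum>j\<in>J. f j w) \<le> ennreal K * M"
  using assms(2)
proof induction
  case empty
  show ?case using p by (intro exI[of _ 0]) (auto simp: Lp_mass_def)
next
  case (insert i J)
  then obtain K where K: "K \<ge> 0" "\<And>f M. (\<forall>j\<in>J. f j \<in> borel_measurable cylinder \<and> Lp_mass p (f j) \<le> M) \<Longrightarrow>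
     Lp_mass p (\<lambda>w. \<Sum>j\<in>J. f j w) \<le> ennreal K * M" by blast
  show ?case
  proof (intro exI[of _ "2 powr p * (1 + K)"] conjI allI impI)
    show "0 \<le> 2 powr p * (1 + K)" using K(1) by simp
    fix f M assume f: "\<forall>j\<in>insert i J. f j \<in> borel_measurable cylinder \<and> Lp_mass p (f j) \<le> M"
    have "Lp_mass p (\<lambda>w. \<Sum>j\<in>insert i J. f j w) = Lp_mass p (\<lambda>w. f i w + (\<Sum>j\<in>J. f j w))"
      using insert by simp
    also have "\<dots> \<le> ennreal (2 powr p) * (Lp_mass p (f i) + Lp_mass p (\<lambda>w. \<Sum>j\<in>J. f j w))"
      using f by (intro Lp_mass_add[OF p] borel_measurable_sum) auto
    also have "\<dots> \<le> ennreal (2 powr p) * (M + ennreal K * M)"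
      using f K(2)[of f M] by (intro mult_left_mono add_mono) auto
    also have "\<dots> = ennreal (2 powr p * (1 + K)) * M"
      using K(1) by (simp add: ennreal_mult ennreal_plus distrib_right mult.assoc del: ennreal_plus[symmetric])
    finally show "Lp_mass p (\<lambda>w. \<Sum>j\<in>insert i J. f j w) \<le> ennreal (2 powr p * (1 + K)) * M" .
  qed
qed

abbreviation truncation :: "int set \<Rightarrow> (real \<times> real \<Rightarrow> complex) \<Rightarrow> real \<times> real \<Rightarrow> complex" where
  "truncation J \<phi> \<equiv> trig_sum J (fourier_coeff \<phi>)"

lemma truncation_measurable: "\<phi> \<in> borel_measurable cylinder \<Longrightarrow> truncation J \<phi> \<in> borel_measurable cylinder"
  by (intro trig_sum_measurable fourier_coeff_measurable)

text \<open>This bound is not uniform in \<open>J\<close>; it serves to pass to limits of functions for a fixed set of modes.\<close>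

lemma truncation_bounded:
  assumes p: "p > 1" and J: "finite J"
  shows "\<exists>K\<ge>0. \<forall>\<phi>. \<phi> \<in> borel_measurable cylinder \<longrightarrow> Lp_mass p (truncation J \<phi>) \<le> ennreal K * Lp_mass p \<phi>"
proof -
  obtain K where K: "K \<ge> 0" "\<And>f M. (\<forall>j\<in>J. f j \<in> borel_measurable cylinder \<and> Lp_mass p (f j) \<le> M) \<Longrightarrow>
     Lp_mass p (\<lambda>w. \<Sum>j\<in>J. f j w) \<le> ennreal K * M"
    using Lp_mass_sum_le[of p J] p J by auto
  have "Lp_mass p (truncation J \<phi>) \<le> ennreal K * Lp_mass p \<phi>" if "\<phi> \<in> borel_measurable cylinder" for \<phi>
    unfolding trig_sum_def[abs_def]
    using that by (intro K(2) ballI conjI mode_measurable fourier_coeff_measurable Lp_mass_fourier_mode_le[OF p])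
  then show ?thesis using K(1) by blast
qed

lemma AE_cylinder_fst: assumes "AE x in lborel. P x" shows "AE w in cylinder. P (fst w)"
proof -
  obtain N where N: "N \<in> null_sets lborel" "{x. \<not> P x} \<subseteq> N"
    using assms unfolding eventually_ae_filter by auto
  have "emeasure lborel (N \<times> (UNIV :: real set)) = emeasure lborel N * emeasure lborel (UNIV :: real set)"
    unfolding lborel_prod[symmetric] using N by (intro lborel.emeasure_pair_measure_Times) auto
  then have "N \<times> (UNIV :: real set) \<in> null_sets lborel"
    using N by (auto simp: null_sets_def borel_prod[symmetric])
  then have "AE w in lborel. w \<notin> N \<times> (UNIV :: real set)" by (rule AE_not_in)
  then have "AE w in (lborel :: (real \<times> real) measure). P (fst w)"
    by eventually_elim (use N in auto)
  then show ?thesis unfolding cylinder_def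
    by (subst AE_restrict_space_iff) (auto elim!: eventually_mono)
qed

lemma truncation_diff_mass:
  assumes \<phi>: "\<phi> \<in> borel_measurable cylinder" "weighted_mass \<phi> < \<infinity>"
    and \<psi>: "\<psi> \<in> borel_measurable cylinder" "weighted_mass \<psi> < \<infinity>"
  shows "Lp_mass p (\<lambda>w. truncation J \<phi> w - truncation J \<psi> w) = Lp_mass p (truncation J (\<lambda>w. \<phi> w - \<psi> w))"
  unfolding Lp_mass_def
proof (rule nn_integral_cong_AE)
  show "AE w in cylinder. ennreal (cmod (truncation J \<phi> w - truncation J \<psi> w) powr p) = ennreal (cmod (truncation J (\<lambda>w. \<phi> w - \<psi> w) w) powr p)"
    using AE_cylinder_fst[OF fourier_coeff_diff_AE[OF assms]]
    by eventually_elim (simp add: trig_sum_def mode_def sum_subtractf left_diff_distrib)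
qed

lemma fourier_coeff_trig_sum:
  assumes "finite J"
  shows "fourier_coeff (trig_sum J c) i = (if i \<in> J then c i else (\<lambda>x. 0))"
proof
  fix x
  have int: "set_integrable lborel {0..<1::real} (\<lambda>\<gamma>. c j x * torus_exp (j - i) \<gamma>)" for j
  proof -
    have "set_integrable lborel {0..1} (torus_exp (j - i))"
      unfolding set_integrable_def by (intro borel_integrable_compact continuous_torus_exp) auto
    then have "set_integrable lborel {0..<1::real} (torus_exp (j - i))"
      by (rule set_integrable_subset) auto
    then show ?thesis by (rule set_integrable_mult_right)
  qed
  have "fourier_coeff (trig_sum J c) i x = (LINT \<gamma>:{0..<1}|lborel. (\<Sum>j\<in>J. c j x * torus_exp (j - i) \<gamma>))"
    unfolding fourier_coeff_def trig_sum_def mode_def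
    by (intro set_lebesgue_integral_cong)
       (auto simp: sum_distrib_left torus_exp_def algebra_simps exp_diff exp_minus divide_inverse intro!: sum.cong)
  also have "\<dots> = (\<Sum>j\<in>J. LINT \<gamma>:{0..<1}|lborel. c j x * torus_exp (j - i) \<gamma>)"
    using int unfolding set_lebesgue_integral_def set_integrable_def scaleR_sum_right
    by (rule Bochner_Integration.integral_sum)
  also have "\<dots> = (\<Sum>j\<in>J. if j = i then c i x else 0)"
    by (intro sum.cong refl) (auto simp: integral_torus_exp)
  also have "\<dots> = (if i \<in> J then c i else (\<lambda>x. 0)) x" using assms by simp
  finally show "fourier_coeff (trig_sum J c) i x = (if i \<in> J then c i else (\<lambda>x. 0)) x" .
qed

lemma test_fun_imp_trig_sum:
  assumes "test_fun \<psi>"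
  shows "\<exists>J c. finite J \<and> (\<forall>j. Cc_infinity (c j)) \<and> \<psi> = trig_sum J c"
proof -
  obtain N c where c: "\<forall>j. Cc_infinity (c j)"
     and f: "\<And>x \<gamma>. \<psi> (x, \<gamma>) = (\<Sum>j | \<bar>j\<bar> < int N. c j x * torus_exp j \<gamma>)"
    using assms(1) unfolding test_fun_def torus_exp_def by blast
  have "finite {j::int. \<bar>j\<bar> < int N}"
    by (rule finite_subset[of _ "{- int N..int N}"]) auto
  moreover have "\<psi> = trig_sum {j. \<bar>j\<bar> < int N} c" using f by (auto simp: trig_sum_def mode_def)
  ultimately show ?thesis using c by blast
qed

lemma trig_sum_restrict:
  assumes "finite J" "finite I" shows "truncation I (trig_sum J c) = trig_sum (I \<inter> J) c"
  using assms(2) unfolding fourier_coeff_trig_sum[OF assms(1)] trig_sum_def fun_eq_iff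
  by (intro allI sum.mono_neutral_cong_right) (auto simp: mode_def)

lemma test_fun_Lp:
  assumes p: "p > 0" and "test_fun \<psi>" shows "Lp_mass p \<psi> < \<infinity>"
proof -
  obtain J c where J: "finite J" "\<And>j. Cc_infinity (c j)" "\<psi> = trig_sum J c"
    using test_fun_imp_trig_sum[OF assms(2)] by blast
  have cm: "c j \<in> borel_measurable borel" for j
    using Cc_infinity_imp_cont[OF J(2)] by (rule borel_measurable_continuous_onI)
  have "Lp_mass p (mode (c j) j) < \<infinity>" for j
  proof -
    obtain B where B: "B \<ge> 0" "\<And>x. cmod (c j x) \<le> B" using Cc_infinity_bounded[OF J(2)[of j]] by blast
    obtain R where R: "\<And>x. \<bar>x\<bar> > R \<Longrightarrow> c j x = 0" using J(2)[of j] unfolding Cc_infinity_iff by blast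
    have "Lp_mass p (mode (c j) j) \<le> Lp_mass p (\<lambda>w. of_real (B * indicator ({- R..R} \<times> UNIV) w))"
    proof (rule Lp_mass_mono[OF p])
      fix w :: "real \<times> real"
      show "cmod (mode (c j) j w) \<le> cmod (of_real (B * indicator ({- R..R} \<times> UNIV) w))"
        using B R[of "fst w"] by (cases w) (auto simp: mode_def norm_mult indicator_def abs_le_iff not_less)
    qed
    also have "\<dots> < \<infinity>" by (rule Lp_mass_box_finite[OF p])
    finally show ?thesis .
  qed
  then have fin: "(\<Sum>j\<in>J. Lp_mass p (mode (c j) j)) < \<infinity>" using J(1) by simp
  obtain K where K: "K \<ge> 0" "\<And>f M. (\<forall>j\<in>J. f j \<in> borel_measurable cylinder \<and> Lp_mass p (f j) \<le> M) \<Longrightarrow>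
     Lp_mass p (\<lambda>w. \<Sum>j\<in>J. f j w) \<le> ennreal K * M"
    using Lp_mass_sum_le[OF p J(1)] by auto
  have "Lp_mass p \<psi> \<le> ennreal K * (\<Sum>j\<in>J. Lp_mass p (mode (c j) j))"
    unfolding J(3) trig_sum_def[abs_def]
    by (intro K(2) ballI conjI mode_measurable cm member_le_sum J(1)) auto
  also have "\<dots> < \<infinity>" using fin by (simp add: ennreal_mult_less_top)
  finally show ?thesis .
qed

section \<open>Restrictions of the operator to tori in the domain\<close>

definition trace_fun :: "real \<Rightarrow> real \<Rightarrow> (complex \<times> complex \<Rightarrow> complex) \<Rightarrow> real \<times> real \<Rightarrow> complex" where
  "trace_fun y s F w = F (Complex (fst w) y, of_real (exp (s / 2)) * exp (2 * of_real pi * \<i> * of_real (snd w)))"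

lemma trace_point_in_worm:
  assumes "\<bar>s\<bar> < \<beta> - pi / 2" "\<bar>y - s\<bar> < pi / 2"
  shows "(Complex x y, of_real (exp (s / 2)) * exp (2 * of_real pi * \<i> * of_real \<theta>)) \<in> worm \<beta>"
proof -
  let ?z = "of_real (exp (s / 2)) * exp (2 * of_real pi * \<i> * of_real \<theta>)"
  have "(cmod ?z)\<^sup>2 = exp s" by (simp add: norm_mult exp_double[symmetric])
  then have "ln ((cmod ?z)\<^sup>2) = s" by simp
  then show ?thesis using assms by (simp add: worm_def)
qed

lemma holomorphic2_imp_continuous: "holomorphic2_on F D \<Longrightarrow> continuous_on D F"
  unfolding holomorphic2_on_def continuous_on_eq_continuous_within
  by (meson has_derivative_continuous)

lemma continuous_trace:
  assumes "continuous_on (worm \<beta>) F" "\<bar>s\<bar> < \<beta> - pi / 2" "\<bar>y - s\<bar> < pi / 2"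
  shows "continuous_on UNIV (trace_fun y s F)"
proof -
  have "trace_fun y s F = (\<lambda>w. F (of_real (fst w) + \<i> * of_real y, of_real (exp (s / 2)) * exp (2 * of_real pi * \<i> * of_real (snd w))))"
    by (simp add: trace_fun_def fun_eq_iff Complex_eq)
  moreover have "continuous_on UNIV (\<lambda>w. F (of_real (fst w) + \<i> * of_real y, of_real (exp (s / 2)) * exp (2 * of_real pi * \<i> * of_real (snd w))))"
    using trace_point_in_worm[OF assms(2,3)] unfolding Complex_eq
    by (intro continuous_on_compose2[OF assms(1)] continuous_intros) auto
  ultimately show ?thesis by simp
qed

lemma line_integral_eq_Lp_mass:
  assumes [measurable]: "trace_fun y s F \<in> borel_measurable cylinder"
  shows "line_integral p F y s = Lp_mass p (trace_fun y s F)"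
proof -
  have "Lp_mass p (trace_fun y s F) = (\<integral>\<^sup>+x. \<integral>\<^sup>+\<theta>. ennreal (cmod (trace_fun y s F (x, \<theta>)) powr p) * indicator {0..<1} \<theta> \<partial>lborel \<partial>lborel)"
    unfolding Lp_mass_def by (rule nn_integral_cylinder_iterated) measurable
  also have "\<dots> = (\<integral>\<^sup>+x. \<integral>\<^sup>+\<theta>. ennreal (cmod (trace_fun y s F (x, \<theta>)) powr p) * indicator {0..1} \<theta> \<partial>lborel \<partial>lborel)"
  proof (rule nn_integral_cong)
    fix x
    have "AE \<theta> in lborel. ennreal (cmod (trace_fun y s F (x, \<theta>)) powr p) * indicator {0..<1} \<theta> =
        ennreal (cmod (trace_fun y s F (x, \<theta>)) powr p) * indicator {0..1} \<theta>"
      using AE_lborel_singleton[of "1::real"] by eventually_elim (auto simp: indicator_def)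
    then show "(\<integral>\<^sup>+\<theta>. ennreal (cmod (trace_fun y s F (x, \<theta>)) powr p) * indicator {0..<1} \<theta> \<partial>lborel) =
       (\<integral>\<^sup>+\<theta>. ennreal (cmod (trace_fun y s F (x, \<theta>)) powr p) * indicator {0..1} \<theta> \<partial>lborel)"
      by (rule nn_integral_cong_AE)
  qed
  finally show ?thesis by (simp add: line_integral_def trace_fun_def)
qed

text \<open>The four sign combinations in the definition of the Hardy norm reach every torus in the domain.\<close>

lemma line_integral_le_Hp_norm_pow:
  assumes "\<bar>s\<bar> < \<beta> - pi / 2" "\<bar>y - s\<bar> < pi / 2"
  shows "line_integral p F y s \<le> Hp_norm_pow \<beta> p F"
proof -
  have "line_integral p F y s \<le> L_functional p F \<bar>y - s\<bar> \<bar>s\<bar>"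
  proof -
    consider "y = \<bar>s\<bar> + \<bar>y - s\<bar> \<and> s = \<bar>s\<bar>" | "y = - (\<bar>s\<bar> + \<bar>y - s\<bar>) \<and> s = - \<bar>s\<bar>"
      | "y = \<bar>s\<bar> - \<bar>y - s\<bar> \<and> s = \<bar>s\<bar>" | "y = - (\<bar>s\<bar> - \<bar>y - s\<bar>) \<and> s = - \<bar>s\<bar>"
      by linarith
    then show ?thesis
      unfolding L_functional_def by cases (metis add_increasing2 add_increasing order_refl zero_le)+
  qed
  also have "\<dots> \<le> Hp_norm_pow \<beta> p F"
    unfolding Hp_norm_pow_def
    by (rule SUP_upper2[of "(\<bar>y - s\<bar>, \<bar>s\<bar>)"]) (use assms in auto)
  finally show ?thesis .
qed

lemma Lp_mass_Fatou:
  assumes p: "p > 0" and F [measurable]: "\<And>n. F n \<in> borel_measurable cylinder"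
    and lim: "\<And>w. w \<in> space cylinder \<Longrightarrow> (\<lambda>n. F n w) \<longlonglongrightarrow> f w"
    and bound: "eventually (\<lambda>n. Lp_mass p (F n) \<le> M) sequentially"
  shows "Lp_mass p f \<le> M"
proof -
  have "Lp_mass p f = (\<integral>\<^sup>+w. liminf (\<lambda>n. ennreal (cmod (F n w) powr p)) \<partial>cylinder)"
    unfolding Lp_mass_def
  proof (rule nn_integral_cong)
    fix w assume "w \<in> space cylinder"
    then have "(\<lambda>n. cmod (F n w)) \<longlonglongrightarrow> cmod (f w)" by (intro tendsto_norm lim)
    then have "(\<lambda>n. ennreal (cmod (F n w) powr p)) \<longlonglongrightarrow> ennreal (cmod (f w) powr p)"
      using p by (intro tendsto_ennrealI tendsto_powr2 tendsto_const) auto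
    then show "ennreal (cmod (f w) powr p) = liminf (\<lambda>n. ennreal (cmod (F n w) powr p))"
      by (rule lim_imp_Liminf[OF trivial_limit_sequentially, symmetric])
  qed
  also have "\<dots> \<le> liminf (\<lambda>n. Lp_mass p (F n))"
    unfolding Lp_mass_def by (rule nn_integral_liminf) measurable
  also have "\<dots> \<le> limsup (\<lambda>n. Lp_mass p (F n))" by (rule Liminf_le_Limsup) simp
  also have "\<dots> \<le> M" using bound by (rule Limsup_bounded)
  finally show ?thesis .
qed

lemma nn_integral_periodic_dilation:
  fixes h :: "real \<Rightarrow> ennreal"
  assumes [measurable]: "h \<in> borel_measurable borel" and per: "\<And>\<theta>. h (\<theta> + 1) = h \<theta>" and N: "N > 0"
  shows "(\<integral>\<^sup>+\<theta>. h (real N * \<theta>) * indicator {0..<1} \<theta> \<partial>lborel) = (\<integral>\<^sup>+\<theta>. h \<theta> * indicator {0..<1} \<theta> \<partial>lborel)"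
    (is "?X = ?Y")
proof -
  have per': "h (real k + \<theta>) = h \<theta>" for k \<theta>
  proof (induction k)
    case (Suc k)
    have "h (real (Suc k) + \<theta>) = h ((real k + \<theta>) + 1)" by (simp add: algebra_simps)
    then show ?case using per Suc by simp
  qed simp
  have I: "(\<integral>\<^sup>+u. h u * indicator {0..<real k} u \<partial>lborel) = of_nat k * ?Y" for k
  proof (induction k)
    case (Suc k)
    have ind: "h u * indicator {0..<real (Suc k)} u = h u * indicator {0..<real k} u + h u * indicator {real k..<real k + 1} u" for u
      by (auto simp: indicator_def)
    have "(\<integral>\<^sup>+u. h u * indicator {0..<real (Suc k)} u \<partial>lborel) =
      (\<integral>\<^sup>+u. h u * indicator {0..<real k} u \<partial>lborel) + (\<integral>\<^sup>+u. h u * indicator {real k..<real k + 1} u \<partial>lborel)"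
      unfolding ind by (rule nn_integral_add) auto
    also have "(\<integral>\<^sup>+u. h u * indicator {real k..<real k + 1} u \<partial>lborel) =
        (\<integral>\<^sup>+u. h (real k + 1 * u) * indicator {real k..<real k + 1} (real k + 1 * u) \<partial>lborel)"
      by (subst nn_integral_real_affine[where c=1 and t="real k"]) auto
    also have "\<dots> = ?Y"
      by (intro nn_integral_cong) (simp add: per' indicator_def)
    finally show ?case using Suc by (simp add: distrib_right add.commute)
  qed simp
  have "of_nat N * ?Y = (\<integral>\<^sup>+u. h u * indicator {0..<real N} u \<partial>lborel)" by (rule I[symmetric])
  also have "\<dots> = ennreal \<bar>real N\<bar> * (\<integral>\<^sup>+u. h (0 + real N * u) * indicator {0..<real N} (0 + real N * u) \<partial>lborel)"
    using N by (subst nn_integral_real_affine[where c="real N" and t=0]) auto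
  also have "(\<integral>\<^sup>+u. h (0 + real N * u) * indicator {0..<real N} (0 + real N * u) \<partial>lborel) = ?X"
    using N by (intro nn_integral_cong) (auto simp: indicator_def zero_le_mult_iff)
  finally have "ennreal (real N) * ?Y = ennreal (real N) * ?X" by (simp add: ennreal_of_nat_eq_real_of_nat)
  then show ?thesis using N by (simp add: ennreal_mult_cancel_left)
qed

text \<open>Up to a factor of modulus 1, multiplying all frequencies by \<open>N\<close> is the substitution \<open>\<theta> \<mapsto> N \<theta>\<close>, which
  preserves the integrals of periodic functions.\<close>

lemma Lp_mass_dilated:
  assumes N: "N > 0" and a [measurable]: "\<And>j. j \<in> J \<Longrightarrow> a j \<in> borel_measurable borel"
    and u [measurable]: "u \<in> borel_measurable borel" "\<And>x. cmod (u x) = 1"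
  shows "Lp_mass p (\<lambda>w. \<Sum>j\<in>J. mode (\<lambda>x. u x * a j x) (int N * j + d) w) = Lp_mass p (trig_sum J a)"
proof -
  let ?f = "\<lambda>w. \<Sum>j\<in>J. mode (\<lambda>x. u x * a j x) (int N * j + d) w"
  have abs: "cmod (?f (x, \<theta>)) = cmod (trig_sum J a (x, real N * \<theta>))" for x \<theta>
  proof -
    have "?f (x, \<theta>) = u x * torus_exp d \<theta> * trig_sum J a (x, real N * \<theta>)"
      using torus_exp_scale[of _ "int N" \<theta>]
      by (simp add: trig_sum_def mode_def sum_distrib_left torus_exp_add mult_ac)
    then show ?thesis by (simp add: norm_mult u(2))
  qed
  have per: "trig_sum J a (x, \<theta> + 1) = trig_sum J a (x, \<theta>)" for x \<theta>
  proof -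
    have "torus_exp j (\<theta> + 1) = torus_exp j \<theta>" for j
    proof -
      have "torus_exp j (\<theta> + 1) = exp (2 * of_real pi * \<i> * of_int j * of_real \<theta> + (2 * of_int j * of_real pi) * \<i>)"
        by (simp add: torus_exp_def algebra_simps)
      also have "\<dots> = torus_exp j \<theta> * exp ((2 * of_int j * of_real pi) * \<i>)"
        by (simp only: exp_add torus_exp_def)
      also have "exp ((2 * of_int j * of_real pi) * \<i>) = 1"
        using exp_integer_2pi[of "of_int j"] by (simp add: mult_ac)
      finally show ?thesis by simp
    qed
    then show ?thesis by (simp add: trig_sum_def mode_def)
  qed
  have "Lp_mass p ?f = (\<integral>\<^sup>+x. \<integral>\<^sup>+\<theta>. ennreal (cmod (?f (x, \<theta>)) powr p) * indicator {0..<1} \<theta> \<partial>lborel \<partial>lborel)"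
    unfolding Lp_mass_def
  proof (rule nn_integral_cylinder_iterated)
    have [measurable]: "?f \<in> borel_measurable cylinder"
      using a u(1) by (intro borel_measurable_sum mode_measurable borel_measurable_times)
    show "(\<lambda>w. ennreal (cmod (?f w) powr p)) \<in> borel_measurable cylinder" by measurable
  qed
  also have "\<dots> = (\<integral>\<^sup>+x. \<integral>\<^sup>+\<theta>. ennreal (cmod (trig_sum J a (x, \<theta>)) powr p) * indicator {0..<1} \<theta> \<partial>lborel \<partial>lborel)"
  proof (rule nn_integral_cong)
    fix x
    have [measurable]: "(\<lambda>\<theta>. trig_sum J a (x, \<theta>)) \<in> borel_measurable borel"
      unfolding trig_sum_def mode_def fst_conv snd_conv
      by (intro borel_measurable_sum borel_measurable_times borel_measurable_const torus_exp_measurable)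
    show "(\<integral>\<^sup>+\<theta>. ennreal (cmod (?f (x, \<theta>)) powr p) * indicator {0..<1} \<theta> \<partial>lborel) =
        (\<integral>\<^sup>+\<theta>. ennreal (cmod (trig_sum J a (x, \<theta>)) powr p) * indicator {0..<1} \<theta> \<partial>lborel)"
      unfolding abs by (rule nn_integral_periodic_dilation[OF _ _ N]) (auto simp: per)
  qed
  also have "\<dots> = Lp_mass p (trig_sum J a)"
    unfolding Lp_mass_def
  proof (rule nn_integral_cylinder_iterated[symmetric])
    have [measurable]: "trig_sum J a \<in> borel_measurable cylinder" by (rule trig_sum_measurable[OF a])
    show "(\<lambda>w. ennreal (cmod (trig_sum J a w) powr p)) \<in> borel_measurable cylinder" by measurable
  qed
  finally show ?thesis .
qed

text \<open>The parameter \<open>a\<close> tends to \<open>b\<close> at the rate \<open>1 / n\<^sup>2\<close> while the argument moves away at the rate \<open>n\<close>, so the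
  defect \<open>b - a\<close> has no effect in the limit and the step is seen from far away on one of its sides.\<close>

lemma damped_exp_limit:
  fixes b r \<eta> :: real
  assumes b: "b > 0" and r: "r \<noteq> 0"
  shows "(\<lambda>n. damped_exp (b - 1 / (real (Suc n))\<^sup>2) b (\<eta> - real (Suc n) * r)) \<longlonglongrightarrow> (if r > 0 then 1 else 0)"
proof -
  have eq: "damped_exp (b - \<epsilon>) b w = exp (\<epsilon> * w) / (1 + exp (2 * b * w))" for \<epsilon> w
  proof -
    have "exp (- (b - \<epsilon>) * w) = exp (\<epsilon> * w) * exp (- (b * w))"
      by (simp add: exp_add[symmetric] algebra_simps)
    moreover have "2 * cosh (b * w) = (1 + exp (2 * b * w)) * exp (- (b * w))"
      by (simp add: cosh_field_def distrib_right exp_add[symmetric])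
    ultimately show ?thesis by (simp add: damped_exp_def)
  qed
  show ?thesis
  proof (cases "r > 0")
    case True
    then show ?thesis unfolding eq using b by simp real_asymp
  next
    case False
    define q where "q = - r"
    have q: "q > 0" "r = - q" using False r by (simp_all add: q_def)
    have "(\<lambda>n. exp (1 / (real (Suc n))\<^sup>2 * (\<eta> + real (Suc n) * q)) / (1 + exp (2 * b * (\<eta> + real (Suc n) * q)))) \<longlonglongrightarrow> 0"
      using b q(1) by real_asymp
    then show ?thesis unfolding eq using q by simp
  qed
qed

text \<open>A modulation of the function translates the multiplier.\<close>

lemma convolve_modulated:
  assumes f: "Cc_infinity f" and m: "integrable lborel m"
  shows "convolve (\<lambda>x. exp (- \<i> * of_real (K * x)) * f x) (inv_fourier m) x =
    exp (- \<i> * of_real (K * x)) * inv_fourier (\<lambda>\<eta>. m (\<eta> - K) * fourier f \<eta>) x"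
proof -
  let ?e = "\<lambda>x. exp (- \<i> * of_real (K * x))"
  have int: "integrable lborel (\<lambda>x. ?e x * f x)"
    using fourier_integrand_integrable[OF Cc_infinity_integrable[OF f], of K] by (simp add: mult.commute)
  have ff: "fourier (\<lambda>x. ?e x * f x) \<xi> = fourier f (K + \<xi>)" for \<xi>
  proof -
    have "exp (- \<i> * of_real (x * \<xi>)) * ?e x = exp (- \<i> * of_real (x * (K + \<xi>)))" for x
      by (simp add: exp_add[symmetric] algebra_simps)
    then show ?thesis unfolding fourier_def mult.assoc[symmetric] by (simp only:)
  qed
  have "convolve (\<lambda>x. ?e x * f x) (inv_fourier m) x = inv_fourier (\<lambda>\<xi>. m \<xi> * fourier f (K + \<xi>)) x"
    unfolding convolution_inv_fourier[OF m int] ff ..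
  also have "\<dots> = (LINT \<eta>|lborel. exp (\<i> * of_real (x * (- K + 1 * \<eta>))) * (m (- K + 1 * \<eta>) * fourier f (K + (- K + 1 * \<eta>)))) / (2 * of_real pi)"
    unfolding inv_fourier_def by (subst lborel_integral_real_affine[where c=1 and t="- K"]) auto
  also have "(LINT \<eta>|lborel. exp (\<i> * of_real (x * (- K + 1 * \<eta>))) * (m (- K + 1 * \<eta>) * fourier f (K + (- K + 1 * \<eta>)))) =
     ?e x * (LINT \<eta>|lborel. exp (\<i> * of_real (x * \<eta>)) * (m (\<eta> - K) * fourier f \<eta>))"
    unfolding integral_mult_right_zero[symmetric]
    by (intro Bochner_Integration.integral_cong refl) (simp add: algebra_simps exp_diff exp_minus divide_inverse)
  finally show ?thesis
    unfolding inv_fourier_def[of "\<lambda>\<eta>. m (\<eta> - K) * fourier f \<eta>"] by (simp only: times_divide_eq_right)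
qed

lemma Hp_norm_pow_cong:
  assumes "\<And>z. z \<in> worm \<beta> \<Longrightarrow> F z = G z"
  shows "Hp_norm_pow \<beta> p F = Hp_norm_pow \<beta> p G"
proof -
  have line: "line_integral p F y s = line_integral p G y s" if "\<bar>s\<bar> < \<beta> - pi / 2" "\<bar>y - s\<bar> < pi / 2" for y s
    unfolding line_integral_def using assms[OF trace_point_in_worm[OF that]] by simp
  have "L_functional p F t s = L_functional p G t s" if "t \<in> {0..<pi / 2}" "s \<in> {0..<\<beta> - pi / 2}" for t s
    unfolding L_functional_def using that by (simp add: line)
  then show ?thesis unfolding Hp_norm_pow_def by (intro SUP_cong) auto
qed

lemma Hp_norm_cong:
  assumes "\<And>z. z \<in> worm \<beta> \<Longrightarrow> F z = G z"
  shows "Hp_norm \<beta> p F = Hp_norm \<beta> p G"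
proof -
  have "Hp_norm_pow \<beta> p F = Hp_norm_pow \<beta> p G" by (rule Hp_norm_pow_cong) (rule assms)
  then show ?thesis by (simp add: Hp_norm_def)
qed

lemma Hp_space_cong:
  assumes "F \<in> Hp_space \<beta> p" and eq: "\<And>z. z \<in> worm \<beta> \<Longrightarrow> F z = G z"
  shows "G \<in> Hp_space \<beta> p"
proof -
  have "holomorphic2_on G (worm \<beta>)"
    unfolding holomorphic2_on_def
  proof
    fix z assume z: "z \<in> worm \<beta>"
    then obtain a b where "(F has_derivative (\<lambda>(h, k). a * h + b * k)) (at z within worm \<beta>)"
      using assms(1) unfolding Hp_space_def holomorphic2_on_def by blast
    then have "(G has_derivative (\<lambda>(h, k). a * h + b * k)) (at z within worm \<beta>)"
      by (rule has_derivative_transform[OF z, rotated]) (simp add: eq)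
    then show "\<exists>a b. (G has_derivative (\<lambda>(h, k). a * h + b * k)) (at z within worm \<beta>)" by blast
  qed
  moreover have "Hp_norm_pow \<beta> p G < \<infinity>"
    using assms(1) Hp_norm_pow_cong[of \<beta> F G p] eq by (simp add: Hp_space_def)
  ultimately show ?thesis by (simp add: Hp_space_def)
qed

text \<open>At \<open>\<theta> = 0\<close> the cylinder contains only one side of a neighbourhood, hence the approach from the right.\<close>

lemma continuous_AE_zero_on_cylinder:
  fixes D :: "real \<times> real \<Rightarrow> complex"
  assumes cont: "continuous_on UNIV D" and zero: "AE w in cylinder. D w = 0" and \<theta>: "\<theta> \<in> {0..<1}"
  shows "D (x, \<theta>) = 0"
proof (rule ccontr)
  assume nz: "D (x, \<theta>) \<noteq> 0"
  define U where "U = {w. D w \<noteq> 0} \<inter> (UNIV \<times> {0<..<1})"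
  have open_nz: "open {w. D w \<noteq> 0}"
    using cont by (intro open_Collect_neq continuous_on_const)
  have "open U" unfolding U_def by (intro open_Int open_nz open_Times) auto
  have "((\<lambda>h. (x, \<theta> + h)) \<longlongrightarrow> (x, \<theta> + 0)) (at_right 0)" by (intro tendsto_intros)
  then have "eventually (\<lambda>h. (x, \<theta> + h) \<in> {w. D w \<noteq> 0}) (at_right 0)"
    using open_nz nz by (intro topological_tendstoD) auto
  moreover have "eventually (\<lambda>h. h < 1 - \<theta>) (at_right 0)"
    using \<theta> by (intro eventually_at_right_less order_tendstoD tendsto_ident_at) auto
  moreover have "eventually (\<lambda>h::real. h > 0) (at_right 0)" by (rule eventually_at_right_less)
  ultimately have "eventually (\<lambda>h. (x, \<theta> + h) \<in> U) (at_right 0)"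
    by eventually_elim (use \<theta> in \<open>auto simp: U_def\<close>)
  then have "U \<noteq> {}" using eventually_happens[of _ "at_right (0::real)"] by fastforce
  have "AE w in lborel. w \<in> UNIV \<times> {0..<1} \<longrightarrow> D w = 0"
    using zero unfolding cylinder_def by (subst (asm) AE_restrict_space_iff) auto
  then have "AE w in lborel. w \<notin> U" by eventually_elim (auto simp: U_def)
  then have "emeasure lborel U = 0"
    using \<open>open U\<close> by (subst (asm) AE_iff_measurable[where N=U]) auto
  then have "negligible U"
    using \<open>open U\<close> by (subst negligible_iff_emeasure0) auto
  then show False using open_not_negligible[OF \<open>open U\<close> \<open>U \<noteq> {}\<close>] by blast
qed

lemma worm_point_polar:
  assumes "z \<in> worm \<beta>"
  obtains x y s \<theta> where "\<bar>s\<bar> < \<beta> - pi / 2" "\<bar>y - s\<bar> < pi / 2" "\<theta> \<in> {0..<1}"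
    "z = (Complex x y, of_real (exp (s / 2)) * exp (2 * of_real pi * \<i> * of_real \<theta>))"
proof -
  obtain z1 z2 where z: "z = (z1, z2)" by force
  define s where "s = ln ((cmod z2)\<^sup>2)"
  have z2: "z2 \<noteq> 0" and b: "\<bar>s\<bar> < \<beta> - pi / 2" "\<bar>Im z1 - s\<bar> < pi / 2"
    using assms by (auto simp: worm_def z s_def)
  have "exp (s / 2) = cmod z2"
    using z2 by (simp add: s_def ln_realpow)
  moreover have "z2 = of_real (cmod z2) * exp (\<i> * of_real (Arg2pi z2))"
    using Arg2pi_eq by simp
  moreover have "exp (2 * of_real pi * \<i> * of_real (Arg2pi z2 / (2 * pi))) = exp (\<i> * of_real (Arg2pi z2))"
    by (simp add: mult_ac)
  ultimately have "z = (Complex (Re z1) (Im z1), of_real (exp (s / 2)) * exp (2 * of_real pi * \<i> * of_real (Arg2pi z2 / (2 * pi))))"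
    unfolding z by simp
  moreover have "Arg2pi z2 / (2 * pi) \<in> {0..<1}"
    using Arg2pi[of z2] by (auto simp: field_simps)
  ultimately show ?thesis using that b by blast
qed

locale bounded_S =
  fixes \<beta> p :: real and S :: "boundary_fun \<Rightarrow> complex \<times> complex \<Rightarrow> complex"
  assumes beta: "\<beta> > pi / 2" and p: "1 < p" and S: "bounded_extension \<beta> p S"
begin

definition in_Lp :: "(real \<times> real \<Rightarrow> complex) \<Rightarrow> bool" where
  "in_Lp \<phi> \<longleftrightarrow> \<phi> \<in> borel_measurable cylinder \<and> Lp_mass p \<phi> < \<infinity>"

abbreviation T :: "(real \<times> real \<Rightarrow> complex) \<Rightarrow> complex \<times> complex \<Rightarrow> complex" where
  "T \<phi> \<equiv> S (on_E1 \<phi>)"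

lemma in_Lp_iff: "on_E1 \<phi> \<in> Lp_boundary p \<longleftrightarrow> in_Lp \<phi>"
proof -
  have "on_E1 \<phi> \<in> Lp_boundary p \<longleftrightarrow> \<phi> \<in> borel_measurable cylinder \<and> integrable cylinder (\<lambda>w. cmod (\<phi> w) powr p)"
  proof
    assume "on_E1 \<phi> \<in> Lp_boundary p"
    then have "on_E1 \<phi> 1 \<in> borel_measurable cylinder \<and> integrable cylinder (\<lambda>w. cmod (on_E1 \<phi> 1 w) powr p)"
      unfolding Lp_boundary_def by blast
    then show "\<phi> \<in> borel_measurable cylinder \<and> integrable cylinder (\<lambda>w. cmod (\<phi> w) powr p)"
      by (simp add: on_E1_def)
  next
    assume "\<phi> \<in> borel_measurable cylinder \<and> integrable cylinder (\<lambda>w. cmod (\<phi> w) powr p)"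
    then show "on_E1 \<phi> \<in> Lp_boundary p"
      by (auto simp: Lp_boundary_def on_E1_def)
  qed
  also have "\<dots> \<longleftrightarrow> in_Lp \<phi>"
    by (auto simp: in_Lp_def Lp_mass_def integrable_iff_bounded)
  finally show ?thesis .
qed

lemma Lp_norm_on_E1: assumes "in_Lp \<phi>" shows "Lp_norm p (on_E1 \<phi>) = enn2real (Lp_mass p \<phi>) powr (1 / p)"
proof -
  have "(LINT w|cylinder. cmod (on_E1 \<phi> l w) powr p) = (if l = 1 then LINT w|cylinder. cmod (\<phi> w) powr p else 0)" for l
    using p by (simp add: on_E1_def)
  then have "Lp_norm p (on_E1 \<phi>) = (LINT w|cylinder. cmod (\<phi> w) powr p) powr (1 / p)"
    by (simp add: Lp_norm_def)
  also have "(LINT w|cylinder. cmod (\<phi> w) powr p) = enn2real (Lp_mass p \<phi>)"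
    using assms unfolding Lp_mass_def in_Lp_def by (subst integral_eq_nn_integral) auto
  finally show ?thesis .
qed

lemma in_Lp_add: "in_Lp \<phi> \<Longrightarrow> in_Lp \<psi> \<Longrightarrow> in_Lp (\<lambda>w. \<phi> w + \<psi> w)"
  using Lp_mass_add[of p \<phi> \<psi>] p unfolding in_Lp_def
  by (auto intro!: le_less_trans[of "Lp_mass p (\<lambda>w. \<phi> w + \<psi> w)"] simp: ennreal_mult_less_top)

lemma in_Lp_cmult: "in_Lp \<phi> \<Longrightarrow> in_Lp (\<lambda>w. c * \<phi> w)"
  unfolding in_Lp_def by (auto simp: Lp_mass_cmult ennreal_mult_less_top)

lemma in_Lp_diff: "in_Lp \<phi> \<Longrightarrow> in_Lp \<psi> \<Longrightarrow> in_Lp (\<lambda>w. \<phi> w - \<psi> w)"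
  using in_Lp_add[of \<phi> "\<lambda>w. - 1 * \<psi> w"] in_Lp_cmult[of \<psi> "- 1"] by simp

lemma in_Lp_test_fun: "test_fun \<psi> \<Longrightarrow> in_Lp \<psi>"
  using test_fun_measurable test_fun_Lp p unfolding in_Lp_def by force

lemma in_Lp_imp_weighted: "in_Lp \<phi> \<Longrightarrow> weighted_mass \<phi> < \<infinity>"
  using weighted_mass_finite p unfolding in_Lp_def by blast

lemma T_Hp: "in_Lp \<phi> \<Longrightarrow> T \<phi> \<in> Hp_space \<beta> p"
  using S unfolding bounded_extension_def in_Lp_iff[symmetric] by blast

lemma T_add: "in_Lp \<phi> \<Longrightarrow> in_Lp \<psi> \<Longrightarrow> z \<in> worm \<beta> \<Longrightarrow> T (\<lambda>w. \<phi> w + \<psi> w) z = T \<phi> z + T \<psi> z"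
proof -
  assume *: "in_Lp \<phi>" "in_Lp \<psi>" "z \<in> worm \<beta>"
  have "on_E1 (\<lambda>w. \<phi> w + \<psi> w) = (\<lambda>l w. on_E1 \<phi> l w + on_E1 \<psi> l w)"
    by (auto simp: on_E1_def fun_eq_iff)
  then show ?thesis using * S unfolding bounded_extension_def in_Lp_iff[symmetric] by simp
qed

lemma T_cmult: "in_Lp \<phi> \<Longrightarrow> z \<in> worm \<beta> \<Longrightarrow> T (\<lambda>w. c * \<phi> w) z = c * T \<phi> z"
proof -
  assume *: "in_Lp \<phi>" "z \<in> worm \<beta>"
  have "on_E1 (\<lambda>w. c * \<phi> w) = (\<lambda>l w. c * on_E1 \<phi> l w)"
    by (auto simp: on_E1_def fun_eq_iff)
  then show ?thesis using * S unfolding bounded_extension_def in_Lp_iff[symmetric] by simp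
qed

lemma T_diff: "in_Lp \<phi> \<Longrightarrow> in_Lp \<psi> \<Longrightarrow> z \<in> worm \<beta> \<Longrightarrow> T (\<lambda>w. \<phi> w - \<psi> w) z = T \<phi> z - T \<psi> z"
  using T_add[of \<phi> "\<lambda>w. - 1 * \<psi> w" z] T_cmult[of \<psi> z "- 1"] in_Lp_cmult[of \<psi> "- 1"] by simp

lemma T_sum:
  assumes "finite J" "\<And>j. j \<in> J \<Longrightarrow> in_Lp (f j)" "z \<in> worm \<beta>"
  shows "T (\<lambda>w. \<Sum>j\<in>J. f j w) z = (\<Sum>j\<in>J. T (f j) z) \<and> in_Lp (\<lambda>w. \<Sum>j\<in>J. f j w)"
  using assms(1,2)
proof induction
  case empty
  have 0: "in_Lp (\<lambda>w. 0)" using p by (simp add: in_Lp_def Lp_mass_def)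
  then show ?case using T_cmult[OF 0 assms(3), of 0] by simp
next
  case (insert i J)
  then show ?case using T_add[of "f i" "\<lambda>w. \<Sum>j\<in>J. f j w" z] in_Lp_add[of "f i" "\<lambda>w. \<Sum>j\<in>J. f j w"] assms(3) by simp
qed

lemma T_bound: "\<exists>C\<ge>0. \<forall>\<phi>. in_Lp \<phi> \<longrightarrow> Hp_norm_pow \<beta> p (T \<phi>) \<le> ennreal C * Lp_mass p \<phi>"
proof -
  obtain C where C: "C \<ge> 0" "\<And>\<phi>. \<phi> \<in> Lp_boundary p \<Longrightarrow> Hp_norm \<beta> p (S \<phi>) \<le> ennreal (C * Lp_norm p \<phi>)"
    using S unfolding bounded_extension_def by blast
  have "Hp_norm_pow \<beta> p (T \<phi>) \<le> ennreal (C powr p) * Lp_mass p \<phi>" if \<phi>: "in_Lp \<phi>" for \<phi>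
  proof -
    define h m where "h = enn2real (Hp_norm_pow \<beta> p (T \<phi>))" and "m = enn2real (Lp_mass p \<phi>)"
    have fin: "Hp_norm_pow \<beta> p (T \<phi>) < \<infinity>" using T_Hp[OF \<phi>] by (simp add: Hp_space_def)
    then have h: "Hp_norm_pow \<beta> p (T \<phi>) = ennreal h" "h \<ge> 0" by (simp_all add: h_def)
    have m: "Lp_mass p \<phi> = ennreal m" "m \<ge> 0" using \<phi> by (simp_all add: m_def in_Lp_def)
    have "ennreal (h powr (1 / p)) = Hp_norm \<beta> p (T \<phi>)" using fin by (simp add: Hp_norm_def h_def)
    also have "\<dots> \<le> ennreal (C * m powr (1 / p))"
      using C(2)[of "on_E1 \<phi>"] \<phi> by (simp add: in_Lp_iff Lp_norm_on_E1 m_def)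
    finally have "h powr (1 / p) \<le> C * m powr (1 / p)"
      using C(1) by (subst (asm) ennreal_le_iff) auto
    then have "(h powr (1 / p)) powr p \<le> (C * m powr (1 / p)) powr p"
      using p by (intro powr_mono2) auto
    then have "h \<le> C powr p * m"
      using p h m C(1) by (simp add: powr_powr powr_mult)
    then show ?thesis unfolding h m using m by (simp add: ennreal_mult[symmetric] ennreal_leI)
  qed
  then show ?thesis by (intro exI[of _ "C powr p"]) auto
qed

lemma trace_T_continuous:
  assumes "in_Lp \<phi>" "\<bar>s\<bar> < \<beta> - pi / 2" "\<bar>y - s\<bar> < pi / 2"
  shows "continuous_on UNIV (trace_fun y s (T \<phi>))"
  using T_Hp[OF assms(1)] assms(2,3)
  by (intro continuous_trace[of \<beta>] holomorphic2_imp_continuous) (auto simp: Hp_space_def)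

lemma trace_T_mass:
  assumes "in_Lp \<phi>" "\<bar>s\<bar> < \<beta> - pi / 2" "\<bar>y - s\<bar> < pi / 2"
  shows "Lp_mass p (trace_fun y s (T \<phi>)) \<le> Hp_norm_pow \<beta> p (T \<phi>)"
  using line_integral_le_Hp_norm_pow[OF assms(2,3), of p "T \<phi>"]
  by (subst line_integral_eq_Lp_mass[symmetric])
     (auto intro: borel_imp_cylinder borel_measurable_continuous_onI trace_T_continuous assms)

lemma trace_T_mode:
  assumes c: "Cc_infinity c" and s: "\<bar>s\<bar> < \<beta> - pi / 2" and y: "\<bar>y - s\<bar> < pi / 2"
  shows "trace_fun y s (T (mode c n)) w = torus_exp n (snd w) * convolve c (S_kernel \<beta> n y s) (fst w)"
proof -
  let ?z = "(Complex (fst w) y, of_real (exp (s / 2)) * exp (2 * of_real pi * \<i> * of_real (snd w)))"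
  have fc: "fourier_coeff (mode c n) j = (if j = n then c else (\<lambda>x. 0))" for j
    using fourier_coeff_trig_sum[of "{n}" "\<lambda>_. c" j] by (simp add: trig_sum_def[abs_def])
  have wi: "weighted_integrable (fourier_coeff (mode c n) j)" for j
    unfolding fc using Cc_infinity_integrable[OF c] by (auto intro: integrable_imp_weighted_integrable)
  have "test_fun (mode c n)"
    using test_fun_mode[OF c, of n] by (simp add: mode_def[abs_def] case_prod_unfold)
  then have "T (mode c n) ?z = S_sum \<beta> (mode c n) ?z"
    using S trace_point_in_worm[OF s y] unfolding bounded_extension_def by blast
  also have "\<dots> = S_term \<beta> (mode c n) n ?z"
    unfolding S_sum_def
  proof -
    have "(\<Sum>\<^sub>\<infinity>j\<in>UNIV. S_term \<beta> (mode c n) j ?z) = (\<Sum>\<^sub>\<infinity>j\<in>{n}. S_term \<beta> (mode c n) j ?z)"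
      by (rule infsum_cong_neutral) (auto simp: S_term_eq[OF s y wi] fc convolve_def)
    then show "(\<Sum>\<^sub>\<infinity>j\<in>UNIV. S_term \<beta> (mode c n) j ?z) = S_term \<beta> (mode c n) n ?z" by simp
  qed
  also have "\<dots> = torus_exp n (snd w) * convolve c (S_kernel \<beta> n y s) (fst w)"
    unfolding S_term_eq[OF s y wi] by (simp add: fc torus_exp_def)
  finally show ?thesis by (simp add: trace_fun_def)
qed

section \<open>Partial sums are uniformly bounded\<close>

text \<open>The modes \<open>j\<close> of a test function are moved to \<open>2 K j - K (2 m + 1)\<close>, and the function is modulated by
  \<open>exp (- \<i> K x)\<close>.  In terms of the original frequency \<open>\<eta> = \<xi> + K\<close>, the arguments of the two factors of the
  multiplier become \<open>\<eta> - K (j - m + 1 / 2)\<close> and \<open>\<eta> - K\<close>.  The half-integer keeps every mode away from the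
  step: in the limit the first factor is 1 for \<open>j \<ge> m\<close> and 0 for \<open>j < m\<close>, and the second is 1.
  The torus must approach the boundary with \<open>K\<close>, since at a fixed torus the multiplier
  tends to 0 on both sides.\<close>

lemma half_line_truncation_bounded:
  "\<exists>C\<ge>0. \<forall>J c m. finite J \<longrightarrow> (\<forall>j. Cc_infinity (c j)) \<longrightarrow>
     Lp_mass p (trig_sum (J \<inter> {m..}) c) \<le> ennreal C * Lp_mass p (trig_sum J c)"
proof -
  obtain C where C: "C \<ge> 0" "\<And>\<phi>. in_Lp \<phi> \<Longrightarrow> Hp_norm_pow \<beta> p (T \<phi>) \<le> ennreal C * Lp_mass p \<phi>"
    using T_bound by blast
  have "Lp_mass p (trig_sum (J \<inter> {m..}) c) \<le> ennreal C * Lp_mass p (trig_sum J c)"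
    if J: "finite J" and c: "\<And>j. Cc_infinity (c j)" for J c m
  proof -
    define B where "B = \<beta> - pi / 2"
    have B: "B > 0" using beta by (simp add: B_def)
    define K where "K n = real (Suc n)" for n
    define \<epsilon> where "\<epsilon> n = 1 / (K n)\<^sup>2" for n
    define s t where "s n = B - \<epsilon> n" and "t n = pi / 2 - \<epsilon> n" for n
    define fr where "fr n j = int (2 * Suc n) * j + (- int (Suc n) * (2 * m + 1))" for n j
    define u where "u n x = exp (- \<i> * of_real (K n * x))" for n x
    define M where "M n j \<xi> = complex_of_real (S_multiplier \<beta> (fr n j) (s n + t n) (s n) \<xi>)" for n j \<xi>
    define a where "a n j = inv_fourier (\<lambda>\<eta>. M n j (\<eta> - K n) * fourier (c j) \<eta>)" for n j
    define \<psi> where "\<psi> n w = (\<Sum>j\<in>J. mode (\<lambda>x. u n x * c j x) (fr n j) w)" for n w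
    have cm [measurable]: "c j \<in> borel_measurable borel" for j
      using Cc_infinity_integrable[OF c] by auto
    have um [measurable]: "u n \<in> borel_measurable borel" for n unfolding u_def by measurable
    have u1: "cmod (u n x) = 1" for n x by (simp add: u_def)
    have uc: "Cc_infinity (\<lambda>x. u n x * c j x)" for n j
    proof -
      have "infinitely_differentiable (u n)"
        using infinitely_differentiable_exp[of 1 "- \<i> * of_real (K n)"] by (simp add: u_def[abs_def] mult_ac)
      then show ?thesis by (rule Cc_infinity_mult[OF _ c])
    qed
    have mode_Lp: "in_Lp (mode (\<lambda>x. u n x * c j x) (fr n j))" for n j
      using test_fun_mode[OF uc, of n j "fr n j"] by (intro in_Lp_test_fun) (simp add: mode_def[abs_def] case_prod_unfold)
    have mult: "M n j (\<eta> - K n) = of_real (damped_exp (2 * B - \<epsilon> n) (2 * B) (\<eta> - K n * (of_int j - of_int m + 1 / 2)) *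
        damped_exp (pi - \<epsilon> n) pi (\<eta> - K n * 1))" for n j \<eta>
    proof -
      have "\<eta> - K n - of_int (fr n j) / 2 = \<eta> - K n * (of_int j - of_int m + 1 / 2)"
        by (simp add: fr_def K_def field_simps)
      then show ?thesis
        unfolding M_def S_multiplier_eq by (simp add: s_def t_def B_def algebra_simps)
    qed
    have "\<epsilon> \<longlonglongrightarrow> 0" unfolding \<epsilon>_def K_def by real_asymp
    then have "eventually (\<lambda>n. \<epsilon> n < B) sequentially" "eventually (\<lambda>n. \<epsilon> n < pi / 2) sequentially"
      using order_tendstoD(2)[of \<epsilon> 0 sequentially B] order_tendstoD(2)[of \<epsilon> 0 sequentially "pi / 2"] B by simp_all
    then have small: "eventually (\<lambda>n. \<epsilon> n < B \<and> \<epsilon> n < pi / 2) sequentially" by (rule eventually_conj)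
    have eps: "\<epsilon> n > 0" for n by (simp add: \<epsilon>_def K_def)
    have am [measurable]: "a n j \<in> borel_measurable borel" for n j
    proof -
      have "(\<lambda>\<eta>. M n j (\<eta> - K n)) \<in> borel_measurable borel"
        unfolding M_def S_multiplier_def cosh_field_def by measurable
      then have "(\<lambda>\<eta>. M n j (\<eta> - K n) * fourier (c j) \<eta>) \<in> borel_measurable borel" by measurable
      then show ?thesis unfolding a_def by (rule inv_fourier_measurable)
    qed
    have bound: "eventually (\<lambda>n. Lp_mass p (trig_sum J (a n)) \<le> ennreal C * Lp_mass p (trig_sum J c)) sequentially"
      using small
    proof eventually_elim
      case (elim n)
      have sy: "\<bar>s n\<bar> < \<beta> - pi / 2" "\<bar>(s n + t n) - s n\<bar> < pi / 2"
        using elim eps[of n] by (auto simp: s_def t_def B_def)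
      have "trace_fun (s n + t n) (s n) (T (\<psi> n)) w = (\<Sum>j\<in>J. mode (\<lambda>x. u n x * a n j x) (fr n j) w)" for w
      proof -
        have "trace_fun (s n + t n) (s n) (T (\<psi> n)) w = (\<Sum>j\<in>J. trace_fun (s n + t n) (s n) (T (mode (\<lambda>x. u n x * c j x) (fr n j))) w)"
          unfolding trace_fun_def \<psi>_def[abs_def]
          using T_sum[where f="\<lambda>j. mode (\<lambda>x. u n x * c j x) (fr n j)", OF J mode_Lp trace_point_in_worm[OF sy]] by blast
        also have "\<dots> = (\<Sum>j\<in>J. mode (\<lambda>x. u n x * a n j x) (fr n j) w)"
        proof (intro sum.cong refl)
          fix j
          have "convolve (\<lambda>x. u n x * c j x) (S_kernel \<beta> (fr n j) (s n + t n) (s n)) x = u n x * a n j x" for x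
            using convolve_modulated[OF c S_kernel_decay(1)[OF sy], of "K n" j "fr n j" x]
            unfolding S_kernel_def a_def M_def u_def .
          then show "trace_fun (s n + t n) (s n) (T (mode (\<lambda>x. u n x * c j x) (fr n j))) w = mode (\<lambda>x. u n x * a n j x) (fr n j) w"
            unfolding trace_T_mode[OF uc sy] by (simp add: mode_def)
        qed
        finally show ?thesis .
      qed
      then have "Lp_mass p (trace_fun (s n + t n) (s n) (T (\<psi> n))) = Lp_mass p (\<lambda>w. \<Sum>j\<in>J. mode (\<lambda>x. u n x * a n j x) (fr n j) w)"
        by (intro arg_cong[where f="Lp_mass p"]) auto
      also have "\<dots> = Lp_mass p (trig_sum J (a n))"
        unfolding fr_def by (rule Lp_mass_dilated[OF _ am um u1]) simp
      finally have 1: "Lp_mass p (trig_sum J (a n)) = Lp_mass p (trace_fun (s n + t n) (s n) (T (\<psi> n)))" ..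
      have psi: "in_Lp (\<psi> n)"
        unfolding \<psi>_def[abs_def] using T_sum[where f="\<lambda>j. mode (\<lambda>x. u n x * c j x) (fr n j)", OF J mode_Lp trace_point_in_worm[OF sy]] by blast
      have "Lp_mass p (trig_sum J (a n)) \<le> ennreal C * Lp_mass p (\<psi> n)"
        unfolding 1 by (rule order_trans[OF trace_T_mass[OF psi sy] C(2)[OF psi]])
      also have "Lp_mass p (\<psi> n) = Lp_mass p (trig_sum J c)"
        unfolding \<psi>_def[abs_def] fr_def by (rule Lp_mass_dilated[OF _ cm um u1]) simp
      finally show ?case .
    qed
    \<comment> \<open>On the Fourier side the multipliers are bounded by 1 and converge; Fourier inversion identifies the limit.\<close>
    have lim: "(\<lambda>n. a n j x) \<longlonglongrightarrow> (if m \<le> j then c j x else 0)" for j x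
    proof -
      define L :: complex where "L = (if m \<le> j then 1 else 0)"
      define r :: real where "r = of_int j - of_int m + 1 / 2"
      have r: "r \<noteq> 0" "r > 0 \<longleftrightarrow> m \<le> j"
      proof -
        have "r = (2 * of_int (j - m) + 1) / 2" by (simp add: r_def field_simps)
        moreover have "2 * (j - m) + 1 \<noteq> 0" by presburger
        then have "real_of_int (2 * (j - m) + 1) \<noteq> 0" by (simp only: of_int_eq_0_iff not_False_eq_True)
        ultimately show "r \<noteq> 0" by simp
        show "r > 0 \<longleftrightarrow> m \<le> j" unfolding r_def by linarith
      qed
      have ff: "integrable lborel (fourier (c j))" by (rule fourier_Cc_infinity_integrable[OF c])
      have b1: "damped_exp (b - \<epsilon> n) b v \<le> 1" if "\<epsilon> n < b" for b n v
        using that eps[of n] by (intro damped_exp_le_1) auto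
      obtain n0 where n0: "\<And>n. n \<ge> n0 \<Longrightarrow> \<epsilon> n < B \<and> \<epsilon> n < pi / 2"
        using small by (auto simp: eventually_sequentially)
      have "(\<lambda>n. LINT \<eta>|lborel. exp (\<i> * of_real (x * \<eta>)) * (M (n + n0) j (\<eta> - K (n + n0)) * fourier (c j) \<eta>)) \<longlonglongrightarrow>
         (LINT \<eta>|lborel. exp (\<i> * of_real (x * \<eta>)) * (L * fourier (c j) \<eta>))"
      proof (rule integral_dominated_convergence[where w="\<lambda>\<eta>. cmod (fourier (c j) \<eta>)"])
        show "integrable lborel (\<lambda>\<eta>. cmod (fourier (c j) \<eta>))" using ff by simp
        show "(\<lambda>\<eta>. exp (\<i> * of_real (x * \<eta>)) * (L * fourier (c j) \<eta>)) \<in> borel_measurable lborel" by measurable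
        show "(\<lambda>\<eta>. exp (\<i> * of_real (x * \<eta>)) * (M (n + n0) j (\<eta> - K (n + n0)) * fourier (c j) \<eta>)) \<in> borel_measurable lborel" for n
          unfolding M_def S_multiplier_def cosh_field_def by measurable
        have "(\<lambda>n. M n j (\<eta> - K n)) \<longlonglongrightarrow> L" for \<eta>
        proof -
          have "(\<lambda>n. damped_exp (2 * B - \<epsilon> n) (2 * B) (\<eta> - K n * r)) \<longlonglongrightarrow> (if r > 0 then 1 else 0)"
            unfolding \<epsilon>_def K_def using B by (intro damped_exp_limit r) auto
          moreover have "(\<lambda>n. damped_exp (pi - \<epsilon> n) pi (\<eta> - K n * 1)) \<longlonglongrightarrow> (if (1::real) > 0 then 1 else 0)"
            unfolding \<epsilon>_def K_def by (intro damped_exp_limit) auto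
          ultimately have "(\<lambda>n. M n j (\<eta> - K n)) \<longlonglongrightarrow> of_real ((if r > 0 then 1 else 0) * (if (1::real) > 0 then 1 else 0))"
            unfolding mult r_def[symmetric] by (intro tendsto_of_real tendsto_mult)
          then show ?thesis using r(2) by (auto simp: L_def split: if_splits)
        qed
        then have "(\<lambda>n. M (n + n0) j (\<eta> - K (n + n0))) \<longlonglongrightarrow> L" for \<eta>
          by (rule LIMSEQ_ignore_initial_segment)
        then show "AE \<eta> in lborel. (\<lambda>n. exp (\<i> * of_real (x * \<eta>)) * (M (n + n0) j (\<eta> - K (n + n0)) * fourier (c j) \<eta>)) \<longlonglongrightarrow>
           exp (\<i> * of_real (x * \<eta>)) * (L * fourier (c j) \<eta>)"
          by (intro AE_I2 tendsto_mult_left tendsto_mult_right)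
        have "cmod (M (n + n0) j (\<eta> - K (n + n0))) \<le> 1" for n \<eta>
        proof -
          have "\<epsilon> (n + n0) < B" "\<epsilon> (n + n0) < pi / 2" using n0[of "n + n0"] by auto
          then have "\<epsilon> (n + n0) < 2 * B" "\<epsilon> (n + n0) < pi" using B pi_gt_zero by linarith+
          then show ?thesis unfolding mult norm_of_real abs_mult abs_of_pos[OF damped_exp_pos]
            by (intro mult_le_one b1 less_imp_le[OF damped_exp_pos])
        qed
        then show "AE \<eta> in lborel. norm (exp (\<i> * of_real (x * \<eta>)) * (M (n + n0) j (\<eta> - K (n + n0)) * fourier (c j) \<eta>)) \<le> cmod (fourier (c j) \<eta>)" for n
          by (intro AE_I2) (simp add: norm_mult mult_left_le_one_le)
      qed
      then have "(\<lambda>n. a (n + n0) j x) \<longlonglongrightarrow> (LINT \<eta>|lborel. exp (\<i> * of_real (x * \<eta>)) * (L * fourier (c j) \<eta>)) / (2 * of_real pi)"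
        unfolding a_def inv_fourier_def by (intro tendsto_divide tendsto_const) auto
      also have "(LINT \<eta>|lborel. exp (\<i> * of_real (x * \<eta>)) * (L * fourier (c j) \<eta>)) / (2 * of_real pi) = L * inv_fourier (fourier (c j)) x"
        unfolding inv_fourier_def by (simp add: mult.left_commute[of _ L])
      also have "inv_fourier (fourier (c j)) x = c j x"
      proof -
        obtain b where "\<And>x. cmod (c j x) \<le> b" using Cc_infinity_bounded[OF c[of j]] by blast
        then show ?thesis
          by (rule fourier_inversion[OF Cc_infinity_integrable[OF c] Cc_infinity_imp_cont[OF c] _ ff])
      qed
      finally have "(\<lambda>n. a (n + n0) j x) \<longlonglongrightarrow> (if m \<le> j then c j x else 0)" by (simp add: L_def split: if_splits)
      then show ?thesis by (rule LIMSEQ_offset)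
    qed
    show ?thesis
    proof (rule Lp_mass_Fatou[OF _ _ _ bound])
      show "trig_sum J (a n) \<in> borel_measurable cylinder" for n by (rule trig_sum_measurable[OF am])
      fix w
      have "(\<lambda>n. trig_sum J (a n) w) \<longlonglongrightarrow> (\<Sum>j\<in>J. (if m \<le> j then c j (fst w) else 0) * torus_exp j (snd w))"
        unfolding trig_sum_def mode_def by (intro tendsto_sum tendsto_mult_right lim)
      also have "(\<Sum>j\<in>J. (if m \<le> j then c j (fst w) else 0) * torus_exp j (snd w)) = trig_sum (J \<inter> {m..}) c w"
        unfolding trig_sum_def mode_def using J by (intro sum.mono_neutral_cong_right) auto
      finally show "(\<lambda>n. trig_sum J (a n) w) \<longlonglongrightarrow> trig_sum (J \<inter> {m..}) c w" .
    qed (use p in simp)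
  qed
  then show ?thesis using C(1) by blast
qed

abbreviation modes :: "nat \<Rightarrow> int set" where
  "modes N \<equiv> {- int N..int N}"

text \<open>An interval of modes is the difference of two half-lines.\<close>

lemma interval_truncation_bounded:
  "\<exists>C\<ge>0. \<forall>\<psi> N. test_fun \<psi> \<longrightarrow> Lp_mass p (truncation (modes N) \<psi>) \<le> ennreal C * Lp_mass p \<psi>"
proof -
  obtain C where C: "C \<ge> 0" "\<And>J c m. finite J \<Longrightarrow> (\<forall>j. Cc_infinity (c j)) \<Longrightarrow>
     Lp_mass p (trig_sum (J \<inter> {m..}) c) \<le> ennreal C * Lp_mass p (trig_sum J c)"
    using half_line_truncation_bounded by blast
  have "Lp_mass p (truncation (modes N) \<psi>) \<le> ennreal (2 powr p * (2 * C)) * Lp_mass p \<psi>" if \<psi>: "test_fun \<psi>" for \<psi> N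
  proof -
    obtain J c where J: "finite J" "\<forall>j. Cc_infinity (c j)" and eq: "\<psi> = trig_sum J c"
      using test_fun_imp_trig_sum[OF \<psi>] by blast
    have cm: "c j \<in> borel_measurable borel" for j
      using Cc_infinity_integrable[of "c j"] J(2) by auto
    have "truncation (modes N) \<psi> w = trig_sum (J \<inter> {- int N..}) c w - trig_sum (J \<inter> {int N + 1..}) c w" for w
    proof -
      have "J \<inter> {- int N..} = (modes N \<inter> J) \<union> (J \<inter> {int N + 1..})" by auto
      moreover have "(modes N \<inter> J) \<inter> (J \<inter> {int N + 1..}) = {}" by auto
      ultimately have "trig_sum (J \<inter> {- int N..}) c w = trig_sum (modes N \<inter> J) c w + trig_sum (J \<inter> {int N + 1..}) c w"
        unfolding trig_sum_def using J(1) by (simp add: sum.union_disjoint)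
      then show ?thesis unfolding eq by (simp add: trig_sum_restrict[OF J(1)])
    qed
    then have "Lp_mass p (truncation (modes N) \<psi>) = Lp_mass p (\<lambda>w. trig_sum (J \<inter> {- int N..}) c w - trig_sum (J \<inter> {int N + 1..}) c w)"
      by (intro arg_cong[where f="Lp_mass p"]) auto
    also have "\<dots> \<le> ennreal (2 powr p) * (Lp_mass p (trig_sum (J \<inter> {- int N..}) c) + Lp_mass p (trig_sum (J \<inter> {int N + 1..}) c))"
      using p by (intro Lp_mass_diff trig_sum_measurable cm) auto
    also have "\<dots> \<le> ennreal (2 powr p) * (ennreal C * Lp_mass p \<psi> + ennreal C * Lp_mass p \<psi>)"
      unfolding eq by (intro mult_left_mono add_mono C J) auto
    also have "\<dots> = ennreal (2 powr p * (2 * C)) * Lp_mass p \<psi>"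
      unfolding mult_2[symmetric] using C(1) by (simp add: ennreal_mult mult.assoc)
    finally show ?thesis .
  qed
  then show ?thesis using C(1) by (intro exI[of _ "2 powr p * (2 * C)"]) auto
qed

lemma in_Lp_truncation: "in_Lp \<phi> \<Longrightarrow> finite J \<Longrightarrow> in_Lp (truncation J \<phi>)"
  using truncation_bounded[OF p, of J] unfolding in_Lp_def
  by (force intro: truncation_measurable le_less_trans simp: ennreal_mult_less_top)

lemma truncation_diff_le:
  assumes J: "finite J"
  shows "\<exists>K\<ge>0. \<forall>\<phi> \<psi>. in_Lp \<phi> \<longrightarrow> in_Lp \<psi> \<longrightarrow>
    Lp_mass p (\<lambda>w. truncation J \<phi> w - truncation J \<psi> w) \<le> ennreal K * Lp_mass p (\<lambda>w. \<phi> w - \<psi> w)"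
proof -
  obtain K where K: "K \<ge> 0" "\<And>\<phi>. \<phi> \<in> borel_measurable cylinder \<Longrightarrow> Lp_mass p (truncation J \<phi>) \<le> ennreal K * Lp_mass p \<phi>"
    using truncation_bounded[OF p J] by blast
  have "Lp_mass p (\<lambda>w. truncation J \<phi> w - truncation J \<psi> w) \<le> ennreal K * Lp_mass p (\<lambda>w. \<phi> w - \<psi> w)" if "in_Lp \<phi>" "in_Lp \<psi>" for \<phi> \<psi>
    using truncation_diff_mass[of \<phi> \<psi> p J] that in_Lp_imp_weighted K(2)[of "\<lambda>w. \<phi> w - \<psi> w"] in_Lp_diff[OF that]
    unfolding in_Lp_def by simp
  then show ?thesis using K(1) by blast
qed

lemma approximating_test_fun:
  assumes "in_Lp \<phi>" "e > 0" obtains \<psi> where "test_fun \<psi>" "Lp_mass p (\<lambda>w. \<phi> w - \<psi> w) \<le> ennreal e"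
  using test_functions_dense[of p \<phi>] assms p unfolding in_Lp_def approximable_def by auto

text \<open>By density the uniform bound extends from test functions to all of \<open>L\<^sup>p\<close>: this is M. Riesz's
  theorem on the boundedness of the partial sums.\<close>

lemma truncation_uniformly_bounded:
  "\<exists>C\<ge>0. \<forall>\<phi> N. in_Lp \<phi> \<longrightarrow> Lp_mass p (truncation (modes N) \<phi>) \<le> ennreal C * Lp_mass p \<phi>"
proof -
  obtain C where C: "C \<ge> 0" "\<And>\<psi> N. test_fun \<psi> \<Longrightarrow> Lp_mass p (truncation (modes N) \<psi>) \<le> ennreal C * Lp_mass p \<psi>"
    using interval_truncation_bounded by blast
  have "Lp_mass p (truncation (modes N) \<phi>) \<le> ennreal (2 powr p * (1 + C * (2 powr p * 2))) * Lp_mass p \<phi>"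
    if \<phi>: "in_Lp \<phi>" for \<phi> N
  proof -
    obtain K where K: "K \<ge> 0" "\<And>\<phi> \<psi>. in_Lp \<phi> \<Longrightarrow> in_Lp \<psi> \<Longrightarrow>
        Lp_mass p (\<lambda>w. truncation (modes N) \<phi> w - truncation (modes N) \<psi> w) \<le> ennreal K * Lp_mass p (\<lambda>w. \<phi> w - \<psi> w)"
      using truncation_diff_le[of "modes N"] by auto
    define m where "m = enn2real (Lp_mass p \<phi>)"
    have m: "Lp_mass p \<phi> = ennreal m" "m \<ge> 0" using \<phi> by (simp_all add: m_def in_Lp_def)
    have meas: "\<phi> \<in> borel_measurable cylinder" using \<phi> by (simp add: in_Lp_def)
    show ?thesis
    proof (cases "m = 0")
      case True
      obtain K' where "\<And>\<phi>. \<phi> \<in> borel_measurable cylinder \<Longrightarrow> Lp_mass p (truncation (modes N) \<phi>) \<le> ennreal K' * Lp_mass p \<phi>"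
        using truncation_bounded[OF p, of "modes N"] by auto
      from this[OF meas] show ?thesis using True m by simp
    next
      case False
      \<comment> \<open>\<open>K\<close> depends on \<open>N\<close>; the approximation is chosen so good that this bound costs no more than \<open>m\<close>.\<close>
      define e where "e = m / (K + 1)"
      have e: "e > 0" "K * e \<le> m" "e \<le> m"
        using False m K(1) by (auto simp: e_def field_simps)
      obtain \<psi> where \<psi>: "test_fun \<psi>" "Lp_mass p (\<lambda>w. \<phi> w - \<psi> w) \<le> ennreal e"
        by (rule approximating_test_fun[OF \<phi> e(1)])
      have \<psi>_Lp: "in_Lp \<psi>" and \<psi>m: "\<psi> \<in> borel_measurable cylinder"
        using \<psi>(1) by (auto intro: in_Lp_test_fun test_fun_measurable)
      have "Lp_mass p \<psi> = Lp_mass p (\<lambda>w. \<phi> w - (\<phi> w - \<psi> w))" by simp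
      also have "\<dots> \<le> ennreal (2 powr p) * (Lp_mass p \<phi> + Lp_mass p (\<lambda>w. \<phi> w - \<psi> w))"
        using p meas \<psi>m by (intro Lp_mass_diff) auto
      also have "\<dots> \<le> ennreal (2 powr p) * (ennreal m + ennreal m)"
        unfolding m(1) using e(3) by (intro mult_left_mono add_left_mono order_trans[OF \<psi>(2)] ennreal_leI) auto
      finally have 1: "Lp_mass p \<psi> \<le> ennreal (2 powr p) * (ennreal m + ennreal m)" .
      have 2: "Lp_mass p (truncation (modes N) \<psi>) \<le> ennreal C * (ennreal (2 powr p) * (ennreal m + ennreal m))"
        by (rule order_trans[OF C(2)[OF \<psi>(1)]]) (intro mult_left_mono 1, simp)
      have "Lp_mass p (\<lambda>w. truncation (modes N) \<phi> w - truncation (modes N) \<psi> w) \<le> ennreal K * ennreal e"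
        by (rule order_trans[OF K(2)[OF \<phi> \<psi>_Lp]]) (intro mult_left_mono \<psi>(2), simp)
      also have "\<dots> \<le> ennreal m"
        using K(1) e by (simp add: ennreal_mult[symmetric] ennreal_leI)
      finally have 3: "Lp_mass p (\<lambda>w. truncation (modes N) \<phi> w - truncation (modes N) \<psi> w) \<le> ennreal m" .
      have "Lp_mass p (truncation (modes N) \<phi>) =
        Lp_mass p (\<lambda>w. (truncation (modes N) \<phi> w - truncation (modes N) \<psi> w) + truncation (modes N) \<psi> w)" by simp
      also have "\<dots> \<le> ennreal (2 powr p) * (Lp_mass p (\<lambda>w. truncation (modes N) \<phi> w - truncation (modes N) \<psi> w) + Lp_mass p (truncation (modes N) \<psi>))"
        using p truncation_measurable[OF meas] truncation_measurable[OF \<psi>m]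
        by (intro Lp_mass_add borel_measurable_diff) auto
      also have "\<dots> \<le> ennreal (2 powr p) * (ennreal m + ennreal C * (ennreal (2 powr p) * (ennreal m + ennreal m)))"
        by (intro mult_left_mono add_mono 2 3) auto
      also have "\<dots> = ennreal (2 powr p * (1 + C * (2 powr p * 2))) * ennreal m"
        using C(1) m(2) by (simp add: ennreal_mult[symmetric] algebra_simps flip: ennreal_plus)
      finally show ?thesis unfolding m(1) .
    qed
  qed
  then show ?thesis using C(1) by (intro exI[of _ "2 powr p * (1 + C * (2 powr p * 2))"]) auto
qed

lemma truncation_tendsto:
  assumes \<phi>: "in_Lp \<phi>"
  shows "(\<lambda>N. Lp_mass p (\<lambda>w. \<phi> w - truncation (modes N) \<phi> w)) \<longlonglongrightarrow> 0"
proof (rule order_tendstoI)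
  obtain C where C: "C \<ge> 0" "\<And>\<phi> N. in_Lp \<phi> \<Longrightarrow> Lp_mass p (truncation (modes N) \<phi>) \<le> ennreal C * Lp_mass p \<phi>"
    using truncation_uniformly_bounded by blast
  fix a :: ennreal assume "0 < a"
  then obtain z where z: "0 < z" "z < a" using dense by blast
  then obtain e where e: "z = ennreal e" "e > 0" by (cases z) auto
  define d where "d = e / (2 powr p * (1 + C))"
  have D: "2 powr p * (1 + C) > 0" using C(1) by (intro mult_pos_pos) auto
  then have d: "d > 0" using e(2) unfolding d_def by (intro divide_pos_pos)
  have "2 powr p * (d + C * d) = (2 powr p * (1 + C)) * d" by (simp add: algebra_simps)
  also have "\<dots> = e" using D unfolding d_def by (simp only: nonzero_mult_div_cancel_left times_divide_eq_right)
  finally have d2: "2 powr p * (d + C * d) = e" .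
  obtain \<psi> where \<psi>: "test_fun \<psi>" "Lp_mass p (\<lambda>w. \<phi> w - \<psi> w) \<le> ennreal d"
    by (rule approximating_test_fun[OF \<phi> d])
  have \<psi>_Lp: "in_Lp \<psi>" using \<psi>(1) by (rule in_Lp_test_fun)
  obtain J c where J: "finite J" "\<psi> = trig_sum J c"
    using test_fun_imp_trig_sum[OF \<psi>(1)] by blast
  have meas: "\<phi> \<in> borel_measurable cylinder" "\<psi> \<in> borel_measurable cylinder"
    using \<phi> \<psi>_Lp by (auto simp: in_Lp_def)
  define N0 where "N0 = nat (\<Sum>j\<in>J. \<bar>j\<bar>)"
  have "Lp_mass p (\<lambda>w. \<phi> w - truncation (modes N) \<phi> w) < a" if "N \<ge> N0" for N
  proof -
    have "\<bar>j\<bar> \<le> int N" if "j \<in> J" for j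
    proof -
      have "\<bar>j\<bar> \<le> (\<Sum>j\<in>J. \<bar>j\<bar>)" using J(1) that by (intro member_le_sum) auto
      then show ?thesis using \<open>N \<ge> N0\<close> unfolding N0_def by linarith
    qed
    then have "modes N \<inter> J = J" by (auto simp: abs_le_iff) (metis minus_le_iff)+
    then have tr: "truncation (modes N) \<psi> = \<psi>" unfolding J(2) by (simp add: trig_sum_restrict[OF J(1)])
    have "Lp_mass p (\<lambda>w. truncation (modes N) \<phi> w - truncation (modes N) \<psi> w) = Lp_mass p (truncation (modes N) (\<lambda>w. \<phi> w - \<psi> w))"
      using in_Lp_imp_weighted[OF \<phi>] in_Lp_imp_weighted[OF \<psi>_Lp] by (intro truncation_diff_mass meas) auto
    also have "\<dots> \<le> ennreal C * Lp_mass p (\<lambda>w. \<phi> w - \<psi> w)" by (intro C in_Lp_diff \<phi> \<psi>_Lp)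
    also have "\<dots> \<le> ennreal C * ennreal d" by (intro mult_left_mono \<psi>) auto
    finally have 1: "Lp_mass p (\<lambda>w. truncation (modes N) \<phi> w - truncation (modes N) \<psi> w) \<le> ennreal C * ennreal d" .
    have "Lp_mass p (\<lambda>w. \<phi> w - truncation (modes N) \<phi> w) =
       Lp_mass p (\<lambda>w. (\<phi> w - \<psi> w) - (truncation (modes N) \<phi> w - truncation (modes N) \<psi> w))"
      unfolding tr by simp
    also have "\<dots> \<le> ennreal (2 powr p) * (Lp_mass p (\<lambda>w. \<phi> w - \<psi> w) + Lp_mass p (\<lambda>w. truncation (modes N) \<phi> w - truncation (modes N) \<psi> w))"
      using p truncation_measurable[OF meas(1)] truncation_measurable[OF meas(2)] meas
      by (intro Lp_mass_diff borel_measurable_diff) auto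
    also have "\<dots> \<le> ennreal (2 powr p) * (ennreal d + ennreal C * ennreal d)"
      by (intro mult_left_mono add_mono 1 \<psi>) auto
    also have "\<dots> = ennreal (2 powr p * (d + C * d))"
      using C(1) d by (simp add: ennreal_mult[symmetric] flip: ennreal_plus)
    also have "\<dots> < a" unfolding d2 using z e by simp
    finally show ?thesis .
  qed
  then show "eventually (\<lambda>N. Lp_mass p (\<lambda>w. \<phi> w - truncation (modes N) \<phi> w) < a) sequentially"
    by (auto simp: eventually_sequentially)
qed auto

section \<open>The partial sums are the images of the truncations\<close>

lemma trace_S_partial:
  assumes \<phi>: "in_Lp \<phi>" and s: "\<bar>s\<bar> < \<beta> - pi / 2" and y: "\<bar>y - s\<bar> < pi / 2"
  shows "trace_fun y s (S_partial \<beta> N \<phi>) w =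
    (\<Sum>j\<in>modes N. torus_exp j (snd w) * convolve (fourier_coeff \<phi> j) (S_kernel \<beta> j y s) (fst w))"
proof -
  have "weighted_integrable (fourier_coeff \<phi> j)" for j
    using \<phi> in_Lp_imp_weighted[OF \<phi>] by (intro fourier_coeff_weighted) (auto simp: in_Lp_def)
  then show ?thesis
    unfolding trace_fun_def S_partial_def by (simp add: S_term_eq[OF s y] torus_exp_def)
qed

lemma trace_S_partial_test_fun:
  assumes \<psi>: "test_fun \<psi>" and s: "\<bar>s\<bar> < \<beta> - pi / 2" and y: "\<bar>y - s\<bar> < pi / 2"
  shows "trace_fun y s (S_partial \<beta> N \<psi>) w = trace_fun y s (T (truncation (modes N) \<psi>)) w"
proof -
  obtain J c where J: "finite J" "\<forall>j. Cc_infinity (c j)" "\<psi> = trig_sum J c"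
    using test_fun_imp_trig_sum[OF \<psi>] by blast
  have fc: "Cc_infinity (fourier_coeff \<psi> j)" for j
    unfolding J(3) fourier_coeff_trig_sum[OF J(1)] using J(2) by (simp add: Cc_infinity_0)
  have m: "in_Lp (mode (fourier_coeff \<psi> j) j)" for j
    using test_fun_mode[OF fc, of j j] by (intro in_Lp_test_fun) (simp add: mode_def[abs_def] case_prod_unfold)
  have "trace_fun y s (T (truncation (modes N) \<psi>)) w = (\<Sum>j\<in>modes N. trace_fun y s (T (mode (fourier_coeff \<psi> j) j)) w)"
    unfolding trace_fun_def trig_sum_def[abs_def]
    using T_sum[where f="\<lambda>j. mode (fourier_coeff \<psi> j) j" and J="modes N", OF _ m trace_point_in_worm[OF s y]] by blast
  then show ?thesis
    by (simp add: trace_T_mode[OF fc s y] trace_S_partial[OF in_Lp_test_fun[OF \<psi>] s y])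
qed

lemma trace_S_partial_continuous:
  assumes \<phi>: "in_Lp \<phi>" and s: "\<bar>s\<bar> < \<beta> - pi / 2" and y: "\<bar>y - s\<bar> < pi / 2"
  shows "continuous_on UNIV (trace_fun y s (S_partial \<beta> N \<phi>))"
proof -
  have wi: "weighted_integrable (fourier_coeff \<phi> j)" for j
    using \<phi> in_Lp_imp_weighted[OF \<phi>] by (intro fourier_coeff_weighted) (auto simp: in_Lp_def)
  have "continuous_on UNIV (convolve (fourier_coeff \<phi> j) (S_kernel \<beta> j y s))" for j
  proof -
    obtain A where "decaying_kernel (S_kernel \<beta> j y s) A"
      using S_kernel_decay(2)[OF s y, of j] unfolding S_kernel_def by blast
    then show ?thesis by (rule decaying_kernel.continuous_convolution[OF _ wi])
  qed
  then have "continuous_on UNIV (\<lambda>w. \<Sum>j\<in>modes N. torus_exp j (snd w) * convolve (fourier_coeff \<phi> j) (S_kernel \<beta> j y s) (fst w))"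
    by (intro continuous_intros continuous_on_compose2[OF _ continuous_on_fst[OF continuous_on_id]]
          continuous_on_compose2[OF continuous_torus_exp[of UNIV]]) auto
  then show ?thesis using trace_S_partial[OF assms] by simp
qed

lemma trace_S_partial_tendsto:
  assumes \<phi>: "in_Lp \<phi>" and \<psi>: "\<And>n. in_Lp (\<psi> n)" and lim: "(\<lambda>n. Lp_mass p (\<lambda>w. \<phi> w - \<psi> n w)) \<longlonglongrightarrow> 0"
    and s: "\<bar>s\<bar> < \<beta> - pi / 2" and y: "\<bar>y - s\<bar> < pi / 2"
  shows "(\<lambda>n. trace_fun y s (S_partial \<beta> N (\<psi> n)) w) \<longlonglongrightarrow> trace_fun y s (S_partial \<beta> N \<phi>) w"
  unfolding trace_S_partial[OF \<phi> s y] trace_S_partial[OF \<psi> s y]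
proof (intro tendsto_sum tendsto_mult_left)
  fix j
  obtain A where "decaying_kernel (S_kernel \<beta> j y s) A"
    using S_kernel_decay(2)[OF s y, of j] unfolding S_kernel_def by blast
  then interpret decaying_kernel "S_kernel \<beta> j y s" A .
  let ?k = "S_kernel \<beta> j y s" and ?x = "fst w"
  have meas: "\<phi> \<in> borel_measurable cylinder" "\<psi> n \<in> borel_measurable cylinder" for n
    using \<phi> \<psi> by (auto simp: in_Lp_def)
  have wm: "weighted_mass \<phi> < \<infinity>" "weighted_mass (\<psi> n) < \<infinity>" "weighted_mass (\<lambda>w. \<phi> w - \<psi> n w) < \<infinity>" for n
    using in_Lp_imp_weighted[OF \<phi>] in_Lp_imp_weighted[OF \<psi>] in_Lp_imp_weighted[OF in_Lp_diff[OF \<phi> \<psi>]] by auto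
  have dm: "(\<lambda>w. \<phi> w - \<psi> n w) \<in> borel_measurable cylinder" for n using meas by auto
  have diff: "convolve (fourier_coeff \<phi> j) ?k ?x - convolve (fourier_coeff (\<psi> n) j) ?k ?x =
      convolve (fourier_coeff (\<lambda>w. \<phi> w - \<psi> n w) j) ?k ?x" for n
  proof -
    have "convolve (\<lambda>x. fourier_coeff \<phi> j x - fourier_coeff (\<psi> n) j x) ?k ?x = convolve (fourier_coeff (\<lambda>w. \<phi> w - \<psi> n w) j) ?k ?x"
      unfolding convolve_def
    proof (rule integral_cong_AE)
      have [measurable]: "fourier_coeff \<phi> j \<in> borel_measurable borel" "fourier_coeff (\<psi> n) j \<in> borel_measurable borel"
        "fourier_coeff (\<lambda>w. \<phi> w - \<psi> n w) j \<in> borel_measurable borel"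
        by (intro fourier_coeff_measurable meas dm)+
      show "(\<lambda>y. (fourier_coeff \<phi> j y - fourier_coeff (\<psi> n) j y) * ?k (?x - y)) \<in> borel_measurable lborel"
        "(\<lambda>y. fourier_coeff (\<lambda>w. \<phi> w - \<psi> n w) j y * ?k (?x - y)) \<in> borel_measurable lborel"
        by measurable
      show "AE y in lborel. (fourier_coeff \<phi> j y - fourier_coeff (\<psi> n) j y) * ?k (?x - y) = fourier_coeff (\<lambda>w. \<phi> w - \<psi> n w) j y * ?k (?x - y)"
        using fourier_coeff_diff_AE[OF meas(1) wm(1) meas(2)[of n] wm(2)[of n]] by eventually_elim simp
    qed
    then show ?thesis
      by (simp add: convolution_diff[OF fourier_coeff_weighted(1)[OF meas(1) wm(1)] fourier_coeff_weighted(1)[OF meas(2) wm(2)]])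
  qed
  have "(\<lambda>n. convolve (fourier_coeff \<phi> j) ?k ?x - convolve (fourier_coeff (\<psi> n) j) ?k ?x) \<longlonglongrightarrow> 0"
  proof (rule Lim_null_comparison)
    have "cmod (convolve (fourier_coeff \<phi> j) ?k ?x - convolve (fourier_coeff (\<psi> n) j) ?k ?x) \<le>
       2 * A * (1 + ?x\<^sup>2) * enn2real (weighted_mass (\<lambda>w. \<phi> w - \<psi> n w))" for n
    proof -
      have "weighted_norm (fourier_coeff (\<lambda>w. \<phi> w - \<psi> n w) j) \<le> enn2real (weighted_mass (\<lambda>w. \<phi> w - \<psi> n w))"
      proof -
        have "0 \<le> weighted_norm (fourier_coeff (\<lambda>w. \<phi> w - \<psi> n w) j)"
          unfolding weighted_norm_def by (intro Bochner_Integration.integral_nonneg mult_nonneg_nonneg less_imp_le[OF weight_pos]) auto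
        then show ?thesis
          using fourier_coeff_weighted(2)[OF dm[of n] wm(3)[of n], of j] enn2real_mono[of "ennreal (weighted_norm (fourier_coeff (\<lambda>w. \<phi> w - \<psi> n w) j))"] wm(3)[of n]
          by (metis enn2real_ennreal infinity_ennreal_def)
      qed
      then have "2 * A * (1 + ?x\<^sup>2) * weighted_norm (fourier_coeff (\<lambda>w. \<phi> w - \<psi> n w) j) \<le>
          2 * A * (1 + ?x\<^sup>2) * enn2real (weighted_mass (\<lambda>w. \<phi> w - \<psi> n w))"
        using A_nonneg by (intro mult_left_mono) auto
      then show ?thesis
        unfolding diff by (rule order_trans[OF norm_convolution_le[OF fourier_coeff_weighted(1)[OF dm wm(3)]]])
    qed
    then show "eventually (\<lambda>n. norm (convolve (fourier_coeff \<phi> j) ?k ?x - convolve (fourier_coeff (\<psi> n) j) ?k ?x) \<le>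
       2 * A * (1 + ?x\<^sup>2) * enn2real (weighted_mass (\<lambda>w. \<phi> w - \<psi> n w))) sequentially" by simp
    have "(\<lambda>n. enn2real (weighted_mass (\<lambda>w. \<phi> w - \<psi> n w))) \<longlonglongrightarrow> enn2real 0"
      using weighted_mass_tendsto_0[OF dm p lim] by (intro tendsto_enn2real) auto
    then show "(\<lambda>n. 2 * A * (1 + ?x\<^sup>2) * enn2real (weighted_mass (\<lambda>w. \<phi> w - \<psi> n w))) \<longlonglongrightarrow> 0"
      by (intro tendsto_mult_right_zero) simp
  qed
  from tendsto_diff[OF tendsto_const[of "convolve (fourier_coeff \<phi> j) ?k ?x"] this]
  show "(\<lambda>n. convolve (fourier_coeff (\<psi> n) j) ?k ?x) \<longlonglongrightarrow> convolve (fourier_coeff \<phi> j) ?k ?x"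
    by simp
qed

text \<open>For test functions this holds by definition.  In general both sides are limits along test
  functions, but in different senses: the partial sum pointwise, its counterpart in \<open>L\<^sup>p\<close> of every
  torus.  So they agree almost everywhere on every torus, and both are continuous.\<close>

lemma S_partial_eq:
  assumes \<phi>: "in_Lp \<phi>" and z: "z \<in> worm \<beta>"
  shows "S_partial \<beta> N \<phi> z = T (truncation (modes N) \<phi>) z"
proof -
  obtain x y s \<theta> where s: "\<bar>s\<bar> < \<beta> - pi / 2" and y: "\<bar>y - s\<bar> < pi / 2" and \<theta>: "\<theta> \<in> {0..<1}"
    and z_eq: "z = (Complex x y, of_real (exp (s / 2)) * exp (2 * of_real pi * \<i> * of_real \<theta>))"
    by (rule worm_point_polar[OF z])
  obtain C where C: "C \<ge> 0" "\<And>\<phi>. in_Lp \<phi> \<Longrightarrow> Hp_norm_pow \<beta> p (T \<phi>) \<le> ennreal C * Lp_mass p \<phi>"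
    using T_bound by blast
  obtain K where K: "K \<ge> 0" "\<And>\<phi> \<psi>. in_Lp \<phi> \<Longrightarrow> in_Lp \<psi> \<Longrightarrow>
      Lp_mass p (\<lambda>w. truncation (modes N) \<phi> w - truncation (modes N) \<psi> w) \<le> ennreal K * Lp_mass p (\<lambda>w. \<phi> w - \<psi> w)"
    using truncation_diff_le[of "modes N"] by auto
  have "\<exists>\<psi>. test_fun \<psi> \<and> Lp_mass p (\<lambda>w. \<phi> w - \<psi> w) \<le> ennreal (inverse (real (Suc n)))" for n
    by (rule approximating_test_fun[OF \<phi>, of "inverse (real (Suc n))"]) auto
  then obtain \<psi> where \<psi>: "\<And>n. test_fun (\<psi> n)" "\<And>n. Lp_mass p (\<lambda>w. \<phi> w - \<psi> n w) \<le> ennreal (inverse (real (Suc n)))"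
    by metis
  have inv0: "(\<lambda>n. ennreal (inverse (real (Suc n)))) \<longlonglongrightarrow> 0"
    using tendsto_ennrealI[OF LIMSEQ_inverse_real_of_nat] by simp
  have lim: "(\<lambda>n. Lp_mass p (\<lambda>w. \<phi> w - \<psi> n w)) \<longlonglongrightarrow> 0"
    by (rule tendsto_sandwich[OF _ _ tendsto_const inv0]) (use \<psi>(2) in auto)
  have \<psi>_Lp: "in_Lp (\<psi> n)" for n by (rule in_Lp_test_fun[OF \<psi>(1)])
  have tr_Lp: "in_Lp (truncation (modes N) \<phi>)" "in_Lp (truncation (modes N) (\<psi> n))" for n
    by (intro in_Lp_truncation \<phi> \<psi>_Lp; simp)+
  let ?H = "trace_fun y s (T (truncation (modes N) \<phi>))"
  let ?G = "trace_fun y s (S_partial \<beta> N \<phi>)"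
  define F where "F n w = ?H w - trace_fun y s (T (truncation (modes N) (\<psi> n))) w" for n w
  have F: "F n = trace_fun y s (T (\<lambda>w. truncation (modes N) \<phi> w - truncation (modes N) (\<psi> n) w))" for n
    unfolding F_def trace_fun_def using T_diff[OF tr_Lp(1) tr_Lp(2) trace_point_in_worm[OF s y]] by auto
  have F_meas: "F n \<in> borel_measurable cylinder" for n
    unfolding F by (intro borel_imp_cylinder borel_measurable_continuous_onI trace_T_continuous in_Lp_diff tr_Lp s y)
  have F_le: "Lp_mass p (F n) \<le> ennreal C * (ennreal K * ennreal (inverse (real (Suc n))))" for n
  proof -
    have "Lp_mass p (F n) \<le> ennreal C * Lp_mass p (\<lambda>w. truncation (modes N) \<phi> w - truncation (modes N) (\<psi> n) w)"
      unfolding F by (rule order_trans[OF trace_T_mass C(2)]; intro in_Lp_diff tr_Lp s y)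
    also have "\<dots> \<le> ennreal C * (ennreal K * ennreal (inverse (real (Suc n))))"
      by (intro mult_left_mono order_trans[OF K(2)[OF \<phi> \<psi>_Lp]] \<psi>(2)) auto
    finally show ?thesis .
  qed
  have le: "Lp_mass p (\<lambda>w. ?H w - ?G w) \<le> ennreal e" if "e > 0" for e
  proof (rule Lp_mass_Fatou[of p F, OF _ F_meas])
    have "(\<lambda>n. trace_fun y s (T (truncation (modes N) (\<psi> n))) w) \<longlonglongrightarrow> ?G w" for w
      using trace_S_partial_tendsto[OF \<phi> \<psi>_Lp lim s y] by (simp add: trace_S_partial_test_fun[OF \<psi>(1) s y])
    then show "(\<lambda>n. F n w) \<longlonglongrightarrow> ?H w - ?G w" for w
      unfolding F_def by (intro tendsto_diff tendsto_const)
    have "(\<lambda>n. ennreal (C * (K * inverse (real (Suc n))))) \<longlonglongrightarrow> ennreal (C * (K * 0))"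
      by (intro tendsto_ennrealI tendsto_mult_left LIMSEQ_inverse_real_of_nat)
    then have "eventually (\<lambda>n. ennreal (C * (K * inverse (real (Suc n)))) < ennreal e) sequentially"
      using \<open>e > 0\<close> by (intro order_tendstoD) auto
    then show "eventually (\<lambda>n. Lp_mass p (F n) \<le> ennreal e) sequentially"
    proof eventually_elim
      case (elim n)
      have "Lp_mass p (F n) \<le> ennreal (C * (K * inverse (real (Suc n))))"
        using F_le[of n] C(1) K(1) by (simp add: ennreal_mult)
      then show ?case using elim by simp
    qed
  qed (use p in simp)
  have "Lp_mass p (\<lambda>w. ?H w - ?G w) \<le> 0"
    by (rule ennreal_le_epsilon) (simp add: le)
  then have "Lp_mass p (\<lambda>w. ?H w - ?G w) = 0" by simp
  moreover have cont: "continuous_on UNIV (\<lambda>w. ?H w - ?G w)"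
    by (intro continuous_on_diff trace_T_continuous trace_S_partial_continuous tr_Lp \<phi> s y)
  moreover have [measurable]: "(\<lambda>w. ?H w - ?G w) \<in> borel_measurable cylinder"
    by (intro borel_imp_cylinder borel_measurable_continuous_onI cont)
  ultimately have "AE w in cylinder. ?H w - ?G w = 0"
    unfolding Lp_mass_def by (subst (asm) nn_integral_0_iff_AE) (auto elim!: eventually_mono)
  from continuous_AE_zero_on_cylinder[OF cont this \<theta>, of x]
  show ?thesis by (simp add: trace_fun_def z_eq)
qed

theorem S_partial_tendsto:
  assumes \<phi>: "in_Lp \<phi>"
  shows "S_partial \<beta> N \<phi> \<in> Hp_space \<beta> p" "(\<lambda>N. Hp_norm \<beta> p (\<lambda>z. T \<phi> z - S_partial \<beta> N \<phi> z)) \<longlonglongrightarrow> 0"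
proof -
  have tr_Lp: "in_Lp (truncation (modes N) \<phi>)" for N by (intro in_Lp_truncation \<phi>) simp
  show "S_partial \<beta> N \<phi> \<in> Hp_space \<beta> p"
    by (rule Hp_space_cong[OF T_Hp[OF tr_Lp[of N]]]) (simp add: S_partial_eq[OF \<phi>])
  obtain C where C: "C \<ge> 0" "\<And>\<phi>. in_Lp \<phi> \<Longrightarrow> Hp_norm_pow \<beta> p (T \<phi>) \<le> ennreal C * Lp_mass p \<phi>"
    using T_bound by blast
  define R where "R N w = \<phi> w - truncation (modes N) \<phi> w" for N w
  have R: "in_Lp (R N)" for N unfolding R_def[abs_def] by (intro in_Lp_diff \<phi> tr_Lp)
  have eq: "Hp_norm \<beta> p (\<lambda>z. T \<phi> z - S_partial \<beta> N \<phi> z) = Hp_norm \<beta> p (T (R N))" for N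
    unfolding R_def[abs_def] by (intro Hp_norm_cong) (simp add: S_partial_eq[OF \<phi>] T_diff[OF \<phi> tr_Lp])
  have "(\<lambda>N. ennreal C * Lp_mass p (R N)) \<longlonglongrightarrow> ennreal C * 0"
    using truncation_tendsto[OF \<phi>] unfolding R_def[abs_def] by (intro ennreal_tendsto_cmult) auto
  then have lim: "(\<lambda>N. ennreal C * Lp_mass p (R N)) \<longlonglongrightarrow> 0" by simp
  have "(\<lambda>N. Hp_norm_pow \<beta> p (T (R N))) \<longlonglongrightarrow> 0"
    by (rule tendsto_sandwich[OF _ _ tendsto_const lim]) (use C(2)[OF R] in auto)
  then have "(\<lambda>N. enn2real (Hp_norm_pow \<beta> p (T (R N)))) \<longlonglongrightarrow> enn2real 0"
    by (intro tendsto_enn2real) auto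
  then have "(\<lambda>N. enn2real (Hp_norm_pow \<beta> p (T (R N))) powr (1 / p)) \<longlonglongrightarrow> 0 powr (1 / p)"
    using p by (intro tendsto_powr2 tendsto_const) auto
  then have "(\<lambda>N. ennreal (enn2real (Hp_norm_pow \<beta> p (T (R N))) powr (1 / p))) \<longlonglongrightarrow> ennreal 0"
    by (intro tendsto_ennrealI) simp
  moreover have "Hp_norm \<beta> p (T (R N)) = ennreal (enn2real (Hp_norm_pow \<beta> p (T (R N))) powr (1 / p))" for N
    using T_Hp[OF R[of N]] by (auto simp: Hp_norm_def Hp_space_def)
  ultimately show "(\<lambda>N. Hp_norm \<beta> p (\<lambda>z. T \<phi> z - S_partial \<beta> N \<phi> z)) \<longlonglongrightarrow> 0"
    unfolding eq by simp
qed

end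

theorem proposition4p8:
  fixes \<beta> p :: real
    and S :: "boundary_fun \<Rightarrow> complex \<times> complex \<Rightarrow> complex"
    and \<phi>1 :: "real \<times> real \<Rightarrow> complex"
  assumes "\<beta> > pi / 2"
    and "1 < p"
    and "bounded_extension \<beta> p S"
    and "on_E1 \<phi>1 \<in> Lp_boundary p"
  shows "(\<forall>N. S_partial \<beta> N \<phi>1 \<in> Hp_space \<beta> p) \<and>
         (\<lambda>N. Hp_norm \<beta> p (\<lambda>z. S (on_E1 \<phi>1) z - S_partial \<beta> N \<phi>1 z)) \<longlonglongrightarrow> 0"
proof -
  interpret bounded_S \<beta> p S by (rule bounded_S.intro) fact+
  have "in_Lp \<phi>1" using assms(4) by (simp add: in_Lp_iff)
  from S_partial_tendsto[OF this] show ?thesis by simp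
qed


end
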